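(* Let $W$ be a vector space over $\mathbb C$. Every quasi-local subset $U$ of $\mathcal E^o(W)=\operatorname{Hom}(W,W((x^{-1})))$ is quasi-compatible, and the nonlocal vertex algebra $\langle U\rangle$ generated by $U$ inside $\mathcal E^o(W)$ is a vertex algebra with $W$ as a (left) quasi module-at-infinity, where $Y_W(a(x),x_0)=a(x_0)$ for $a(x)\in\langle U\rangle$. If $U$ is local, $W$ is a module-at-infinity.
   Context: All vector spaces are over $\mathbb C$; $\mathbb N=\{0,1,2,\dots\}$; powers $(y+z)^n$ of binomials are expanded in nonnegative powers of the second variable $z$. $W((x_1^{-1},\dots,x_r^{-1}))$ denotes $W[[x_1^{-1},\dots,x_r^{-1}]][x_1,\dots,x_r]$. $1_W$ is the identity operator on $W$. $\iota_{x,\infty;x_0,0}:\mathbb C(x,x_0)\to\mathbb C((x^{-1}))((x_0))$ is the unique field embedding extending the inclusion of $\mathbb C[x,x_0]$. For $A\in\operatorname{Hom}(W,W((x_1^{-1},x^{-1})))$, $A(x_1,x)|_{x_1=x+x_0}=\big(e^{x_0\partial/\partial x_1}A(x_1,x)\big)|_{x_1=x}$. **Quasi-local, local.** $S\subset\mathcal E^o(W)$ is quasi-local if for any $a(x),b(x)\in S$ there is a nonzero polynomial $p(x_1,x_2)$ with $p(x_1,x_2)a(x_1)b(x_2)=p(x_1,x_2)b(x_2)a(x_1)$; it is local if for any $a(x),b(x)\in S$ one can take $p=(x_1-x_2)^k$ for some $k\in\mathbb N$. **Quasi-compatible.** A finite sequence $a_1(x),\dots,a_r(x)$ in $\mathcal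 E^o(W)$ is quasi-compatible if there is a nonzero polynomial $p(x_1,x_2)$ with $\big(\prod_{1\le i<j\le r}p(x_i,x_j)\big)a_1(x_1)\cdots a_r(x_r)\in\operatorname{Hom}(W,W((x_1^{-1},\dots,x_r^{-1})))$. A subset is quasi-compatible if every finite sequence in it is. **Operation $Y_{\mathcal E^o}$.** For a quasi-compatible pair $(a(x),b(x))$ choose a nonzero polynomial $p$ with $p(x_1,x_2)a(x_1)b(x_2)\in\operatorname{Hom}(W,W((x_1^{-1},x_2^{-1})))$ and set $$Y_{\mathcal E^o}(a(x),x_0)b(x)=\sum_{n\in\mathbb Z}a(x)_nb(x)\,x_0^{-n-1}=\iota_{x,\infty;x_0,0}\big(1/p(x_0+x,x)\big)\big(p(x_1,x)a(x_1)b(x)\big)|_{x_1=x+x_0},$$ independent of $p$. A quasi-compatible subspace $K$ is closed if $a(x)_nb(x)\in K$ for all $a(x),b(x)\in K$, $n\in\mathbb Z$. For a quasi-compatible subset $S$, $\langle S\rangle$ is the smallest closed quasi-compatible subspace containing $S$ and $1_W$; $(\langle S\rangle,Y_{\mathcal E^o},1_W)$ is a nonlocal vertex algebra, called the one generated by $S$. **Nonlocal vertex algebra.** A vector space $V$ with a linear map $Y:V\to\operatorname{Hom}(V,V((x)))$ and $\mathbf 1\in V$ such that $Y(\mathbf 1,x)v=v$, $Y(v,x)\mathbf 1\in V[[x]]$, $\lim_{x\to0}Y(v,x)\mathbf 1=v$, and for all $u,v,w$ there is $l\in\mathbb N$ with $(x_0+x_2)^lY(u,x_0+x_2)Y(v,x_2)w=(x_0+x_2)^lY(Y(u,x_0)v,x_2)w$.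 It is a vertex algebra (in the usual sense) exactly when for all $u,v\in V$ there is $k\in\mathbb N$ with $(x_1-x_2)^k[Y(u,x_1),Y(v,x_2)]=0$. **Quasi module-at-infinity.** For a nonlocal vertex algebra $V$: a vector space $W$ with a linear map $Y_W:V\to\operatorname{Hom}(W,W((x^{-1})))$ such that $Y_W(\mathbf 1,x)=1_W$ and for any $u,v\in V$ there is a nonzero polynomial $p(x_1,x_2)$ with $p(x_1,x_2)Y_W(u,x_1)Y_W(v,x_2)\in\operatorname{Hom}(W,W((x_1^{-1},x_2^{-1})))$ and $p(x_0+x_2,x_2)Y_W(Y(u,x_0)v,x_2)=\big(p(x_1,x_2)Y_W(u,x_1)Y_W(v,x_2)\big)|_{x_1=x_2+x_0}$. It is a module-at-infinity if for any $u,v$ one can take $p=(x_1-x_2)^k$ with $k\in\mathbb N$. *)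

theory Defs
  imports
    Complex_Main
    "HOL.Hull"
    "HOL-Library.Function_Algebras"
    "HOL-Library.Groups_Big_Fun"
    "HOL-Computational_Algebra.Computational_Algebra"
begin

text \<open>
  A formal series is the family of its coefficients, indexed by exponents:
  \<open>a :: int \<Rightarrow> 'a\<close> is \<open>\<Sum>n. a n x^n\<close>, \<open>A :: int \<Rightarrow> int \<Rightarrow> 'a\<close> is \<open>\<Sum>m n. A m n y^m z^n\<close>, and in \<open>r\<close>
  variables \<open>A :: (nat \<Rightarrow> int) \<Rightarrow> 'a\<close>, where \<open>n i\<close> for \<open>i < r\<close> is the exponent of the \<open>i\<close>-th variable
  (counted from 0). An operator-valued series has \<open>'a = 'w \<Rightarrow> 'w\<close>. The indices are the exponents
  themselves, so the mode \<open>u_n\<close> of \<open>Y(u,x) = \<Sum>n. u_n x^(-n-1)\<close> sits at index \<open>-n-1\<close>.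

  A polynomial \<open>p(y,z)\<close> is a \<open>complex poly poly\<close> with outer variable \<open>y\<close> and inner variable \<open>z\<close>.

  Vector spaces over the complex numbers are given by a scalar multiplication on a type;
  function spaces carry the pointwise structure.
\<close>

definition fscale :: "(complex \<Rightarrow> 'a \<Rightarrow> 'a) \<Rightarrow> complex \<Rightarrow> ('b \<Rightarrow> 'a) \<Rightarrow> 'b \<Rightarrow> 'a" where
  "fscale s c f = (\<lambda>x. s c (f x))"

definition linear_on :: "(complex \<Rightarrow> 'a \<Rightarrow> 'a) \<Rightarrow> (complex \<Rightarrow> 'b \<Rightarrow> 'b) \<Rightarrow> 'a set
    \<Rightarrow> ('a::plus \<Rightarrow> 'b::plus) \<Rightarrow> bool" where
  "linear_on s1 s2 V f \<longleftrightarrow>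
     (\<forall>u\<in>V. \<forall>v\<in>V. f (u + v) = f u + f v) \<and> (\<forall>c. \<forall>u\<in>V. f (s1 c u) = s2 c (f u))"


subsection \<open>Polynomials acting on formal series\<close>

definition poly_times :: "(complex \<Rightarrow> 'a \<Rightarrow> 'a) \<Rightarrow> complex poly poly
    \<Rightarrow> (int \<Rightarrow> int \<Rightarrow> 'a) \<Rightarrow> int \<Rightarrow> int \<Rightarrow> 'a::ab_group_add" where
  "poly_times s p A = (\<lambda>m n. \<Sum>k\<le>degree p. \<Sum>l\<le>degree (coeff p k).
     s (coeff (coeff p k) l) (A (m - int k) (n - int l)))"

text \<open>Multiplication by \<open>p(x_i, x_j)\<close>, for \<open>i \<noteq> j\<close>.\<close>

definition poly_times_at :: "(complex \<Rightarrow> 'a \<Rightarrow> 'a) \<Rightarrow> complex poly poly \<Rightarrow> nat \<Rightarrow> nat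
    \<Rightarrow> ((nat \<Rightarrow> int) \<Rightarrow> 'a) \<Rightarrow> (nat \<Rightarrow> int) \<Rightarrow> 'a::ab_group_add" where
  "poly_times_at s p i j A = (\<lambda>n. \<Sum>k\<le>degree p. \<Sum>l\<le>degree (coeff p k).
     s (coeff (coeff p k) l) (A (n(i := n i - int k, j := n j - int l))))"

text \<open>Multiplication by the product of \<open>p(x_i, x_j)\<close> over all \<open>i < j < r\<close>, one factor after
  the other.\<close>

definition poly_times_pairs :: "(complex \<Rightarrow> 'a \<Rightarrow> 'a) \<Rightarrow> complex poly poly \<Rightarrow> nat
    \<Rightarrow> ((nat \<Rightarrow> int) \<Rightarrow> 'a) \<Rightarrow> (nat \<Rightarrow> int) \<Rightarrow> 'a::ab_group_add" where
  "poly_times_pairs s p r A =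
     fold (\<lambda>(i, j). poly_times_at s p i j) [(i, j). i \<leftarrow> [0..<r], j \<leftarrow> [Suc i..<r]] A"

definition var_inner :: "complex poly poly" where
  "var_inner = [:[:0, 1:]:]"

definition var_outer :: "complex poly poly" where
  "var_outer = [:0, 1:]"

text \<open>\<open>p(x\<^sub>1,x\<^sub>2) \<mapsto> p(x\<^sub>0 + x\<^sub>2, x\<^sub>2)\<close>; in the result the outer variable is \<open>x\<^sub>0\<close>.\<close>

definition shift_poly :: "complex poly poly \<Rightarrow> complex poly poly" where
  "shift_poly p = pcompose p (var_outer + var_inner)"


subsection \<open>The spaces \<open>Hom(W, W((x\<^sup>-\<^sup>1)))\<close> in one, two and many variables\<close>

text \<open>\<open>W((x_1^-1,\<dots>,x_r^-1)) = W[[x_1^-1,\<dots>,x_r^-1]][x_1,\<dots>,x_r]\<close> consists of the series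
  whose exponents are bounded above in each of the variables.\<close>

definition Eo :: "(complex \<Rightarrow> 'w \<Rightarrow> 'w) \<Rightarrow> (int \<Rightarrow> 'w \<Rightarrow> 'w::ab_group_add) set" where
  "Eo s = {a. (\<forall>n. Vector_Spaces.linear s s (a n)) \<and> (\<forall>w. \<exists>N. \<forall>n>N. a n w = 0)}"

definition Hom2 :: "(complex \<Rightarrow> 'w \<Rightarrow> 'w) \<Rightarrow> (int \<Rightarrow> int \<Rightarrow> 'w \<Rightarrow> 'w::ab_group_add) set" where
  "Hom2 s = {A. (\<forall>m n. Vector_Spaces.linear s s (A m n)) \<and>
     (\<forall>w. \<exists>N. \<forall>m n. m > N \<or> n > N \<longrightarrow> A m n w = 0)}"

definition Homr :: "(complex \<Rightarrow> 'w \<Rightarrow> 'w) \<Rightarrow> nat \<Rightarrow> ((nat \<Rightarrow> int) \<Rightarrow> 'w \<Rightarrow> 'w::ab_group_add) set" where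
  "Homr s r = {A. (\<forall>n. Vector_Spaces.linear s s (A n)) \<and>
     (\<forall>w. \<exists>N. \<forall>n. (\<exists>i<r. n i > N) \<longrightarrow> A n w = 0)}"

definition one_Eo :: "int \<Rightarrow> 'w \<Rightarrow> 'w::ab_group_add" where
  "one_Eo n = (if n = 0 then id else 0)"

text \<open>\<open>a(x\<^sub>1) b(x\<^sub>2)\<close>, and \<open>a_1(x_1) \<cdots> a_r(x_r)\<close> for a list of series.\<close>

definition prod2 :: "(int \<Rightarrow> 'w \<Rightarrow> 'w) \<Rightarrow> (int \<Rightarrow> 'w \<Rightarrow> 'w) \<Rightarrow> int \<Rightarrow> int \<Rightarrow> 'w \<Rightarrow> 'w" where
  "prod2 a b = (\<lambda>m n. a m \<circ> b n)"

definition prod_list_series :: "(int \<Rightarrow> 'w \<Rightarrow> 'w) list \<Rightarrow> (nat \<Rightarrow> int) \<Rightarrow> 'w \<Rightarrow> 'w" where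
  "prod_list_series as n = foldr (\<lambda>i f. (as ! i) (n i) \<circ> f) [0..<length as] id"


subsection \<open>Quasi-locality, locality and quasi-compatibility\<close>

text \<open>In the variables \<open>x\<^sub>1, x\<^sub>2\<close> the coefficients of \<open>b(x\<^sub>2) a(x\<^sub>1)\<close> are \<open>\<lambda>m n. b n \<circ> a m\<close>.\<close>

definition quasi_local :: "(complex \<Rightarrow> 'w \<Rightarrow> 'w) \<Rightarrow> (int \<Rightarrow> 'w \<Rightarrow> 'w::ab_group_add) set \<Rightarrow> bool" where
  "quasi_local s S \<longleftrightarrow> S \<subseteq> Eo s \<and> (\<forall>a\<in>S. \<forall>b\<in>S. \<exists>p. p \<noteq> 0 \<and>
     poly_times (fscale s) p (prod2 a b) = poly_times (fscale s) p (\<lambda>m n. b n \<circ> a m))"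

definition mutually_local :: "(complex \<Rightarrow> 'w \<Rightarrow> 'w) \<Rightarrow> (int \<Rightarrow> 'w \<Rightarrow> 'w::ab_group_add) set \<Rightarrow> bool" where
  "mutually_local s S \<longleftrightarrow> S \<subseteq> Eo s \<and> (\<forall>a\<in>S. \<forall>b\<in>S. \<exists>k.
     poly_times (fscale s) ((var_outer - var_inner) ^ k) (prod2 a b) =
     poly_times (fscale s) ((var_outer - var_inner) ^ k) (\<lambda>m n. b n \<circ> a m))"

definition quasi_compatible_seq :: "(complex \<Rightarrow> 'w \<Rightarrow> 'w) \<Rightarrow> (int \<Rightarrow> 'w \<Rightarrow> 'w::ab_group_add) list \<Rightarrow> bool" where
  "quasi_compatible_seq s as \<longleftrightarrow> set as \<subseteq> Eo s \<and> (\<exists>p. p \<noteq> 0 \<and>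
     poly_times_pairs (fscale s) p (length as) (prod_list_series as) \<in> Homr s (length as))"

definition quasi_compatible :: "(complex \<Rightarrow> 'w \<Rightarrow> 'w) \<Rightarrow> (int \<Rightarrow> 'w \<Rightarrow> 'w::ab_group_add) set \<Rightarrow> bool" where
  "quasi_compatible s S \<longleftrightarrow> S \<subseteq> Eo s \<and> (\<forall>as. set as \<subseteq> S \<longrightarrow> quasi_compatible_seq s as)"


subsection \<open>The embedding \<open>\<iota>\<close> of \<open>\<complex>(x,x\<^sub>0)\<close> into \<open>\<complex>((x\<^sup>-\<^sup>1))((x\<^sub>0))\<close>\<close>

text \<open>
  \<open>\<complex>(x,x\<^sub>0)\<close> is the fraction field of \<open>complex poly poly\<close> with outer variable \<open>x\<^sub>0\<close>.
  \<open>\<complex>((x\<^sup>-\<^sup>1))((x\<^sub>0))\<close> is \<open>complex fls fls\<close>, where the uniformizer of the inner Laurent series is \<open>x\<^sup>-\<^sup>1\<close>: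
  \<open>x\<close> is \<^term>\<open>fls_X_inv :: complex fls\<close>, and the coefficient of \<open>x^l\<close> is at inner index \<open>-l\<close>.
\<close>

definition poly_incl :: "complex poly poly \<Rightarrow> complex fls fls" where
  "poly_incl P =
     poly (map_poly (\<lambda>q. fls_const (poly (map_poly fls_const q) fls_X_inv)) P) fls_X"

definition field_embedding :: "('a::field \<Rightarrow> 'b::field) \<Rightarrow> bool" where
  "field_embedding f \<longleftrightarrow> f 1 = 1 \<and> (\<forall>x y. f (x + y) = f x + f y) \<and> (\<forall>x y. f (x * y) = f x * f y)"

definition iota :: "complex poly poly fract \<Rightarrow> complex fls fls" where
  "iota = (THE f. field_embedding f \<and> (\<forall>P. f (to_fract P) = poly_incl P))"


subsection \<open>Substitution \<open>x\<^sub>1 = x + x\<^sub>0\<close> and the operation \<open>Y\<close> on \<open>Eo\<close>\<close>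

text \<open>
  \<^const>\<open>Sum_any\<close> sums over the indices with nonzero summand (and is 0 if there are infinitely
  many). Operator-valued series are summed after evaluation at a vector \<open>w\<close>. There \<open>diagonal A\<close> is
  a finite sum for \<open>A \<in> Hom2 s\<close>, and so is \<open>fls_times s F B\<close> for \<open>B = subst_add s A\<close>.
\<close>

definition deriv1 :: "(complex \<Rightarrow> 'a \<Rightarrow> 'a) \<Rightarrow> (int \<Rightarrow> int \<Rightarrow> 'a) \<Rightarrow> int \<Rightarrow> int \<Rightarrow> 'a::ab_group_add" where
  "deriv1 s A = (\<lambda>m n. s (of_int (m + 1)) (A (m + 1) n))"

definition diagonal :: "(int \<Rightarrow> int \<Rightarrow> 'w \<Rightarrow> 'w) \<Rightarrow> int \<Rightarrow> 'w \<Rightarrow> 'w::ab_group_add" where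
  "diagonal A = (\<lambda>n w. Sum_any (\<lambda>i. A i (n - i) w))"

text \<open>\<open>A(x\<^sub>1,x) \<mapsto> (exp(x\<^sub>0 \<partial>/\<partial>x\<^sub>1) A(x\<^sub>1,x)) at x\<^sub>1 = x\<close>, as a series in \<open>x\<^sub>0\<close> (first index) and \<open>x\<close>.\<close>

definition subst_add :: "(complex \<Rightarrow> 'w \<Rightarrow> 'w) \<Rightarrow> (int \<Rightarrow> int \<Rightarrow> 'w \<Rightarrow> 'w)
    \<Rightarrow> int \<Rightarrow> int \<Rightarrow> 'w \<Rightarrow> 'w::ab_group_add" where
  "subst_add s A = (\<lambda>k. if k < 0 then 0 else
     diagonal (\<lambda>i j. fscale s (1 / fact (nat k)) ((deriv1 (fscale s) ^^ nat k) A i j)))"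

text \<open>Multiplication of a series in \<open>x\<^sub>0\<close> and \<open>x\<close> by an element of \<open>\<complex>((x\<^sup>-\<^sup>1))((x\<^sub>0))\<close>.\<close>

definition fls_times :: "(complex \<Rightarrow> 'w \<Rightarrow> 'w) \<Rightarrow> complex fls fls \<Rightarrow> (int \<Rightarrow> int \<Rightarrow> 'w \<Rightarrow> 'w)
    \<Rightarrow> int \<Rightarrow> int \<Rightarrow> 'w \<Rightarrow> 'w::ab_group_add" where
  "fls_times s F B = (\<lambda>m n w. Sum_any (\<lambda>(k, l). s (fls_nth (fls_nth F k) (- l)) (B (m - k) (n - l) w)))"

definition Y_Eo_with :: "(complex \<Rightarrow> 'w \<Rightarrow> 'w) \<Rightarrow> complex poly poly \<Rightarrow> (int \<Rightarrow> 'w \<Rightarrow> 'w)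
    \<Rightarrow> (int \<Rightarrow> 'w \<Rightarrow> 'w) \<Rightarrow> int \<Rightarrow> int \<Rightarrow> 'w \<Rightarrow> 'w::ab_group_add" where
  "Y_Eo_with s p a b = fls_times s (iota (1 / to_fract (shift_poly p)))
     (subst_add s (poly_times (fscale s) p (prod2 a b)))"

text \<open>\<open>Y_Eo s a m b\<close> is the coefficient of \<open>x\<^sub>0^m\<close> in \<open>Y(a(x),x\<^sub>0)b(x)\<close>. It does not depend on the chosen \<open>p\<close>.\<close>

definition Y_Eo :: "(complex \<Rightarrow> 'w \<Rightarrow> 'w) \<Rightarrow> (int \<Rightarrow> 'w \<Rightarrow> 'w) \<Rightarrow> int
    \<Rightarrow> (int \<Rightarrow> 'w \<Rightarrow> 'w) \<Rightarrow> int \<Rightarrow> 'w \<Rightarrow> 'w::ab_group_add" where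
  "Y_Eo s a m b =
     Y_Eo_with s (SOME p. p \<noteq> 0 \<and> poly_times (fscale s) p (prod2 a b) \<in> Hom2 s) a b m"

definition closed_qc_subspace :: "(complex \<Rightarrow> 'w \<Rightarrow> 'w) \<Rightarrow> (int \<Rightarrow> 'w \<Rightarrow> 'w::ab_group_add) set \<Rightarrow> bool" where
  "closed_qc_subspace s K \<longleftrightarrow> module.subspace (fscale (fscale s)) K \<and> quasi_compatible s K \<and>
     (\<forall>a\<in>K. \<forall>b\<in>K. \<forall>m. Y_Eo s a m b \<in> K)"

text \<open>The smallest closed quasi-compatible subspace containing \<open>S\<close> and the identity. (The defining
  intersection is \<^term>\<open>UNIV\<close>, hence not contained in \<open>Eo s\<close> unless \<open>W = 0\<close>, if there is none.)\<close>

definition generated :: "(complex \<Rightarrow> 'w \<Rightarrow> 'w) \<Rightarrow> (int \<Rightarrow> 'w \<Rightarrow> 'w::ab_group_add) set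
    \<Rightarrow> (int \<Rightarrow> 'w \<Rightarrow> 'w) set" where
  "generated s S = closed_qc_subspace s hull (insert one_Eo S)"


subsection \<open>Nonlocal vertex algebras\<close>

text \<open>The series \<open>Y(u, y+z) Y(v, z) w\<close>, expanded in nonnegative powers of \<open>z\<close>, with \<open>y\<close> the first
  variable: the coefficient of \<open>y^m z^k\<close> in \<open>(y+z)^(m+k)\<close> is \<open>(m+k) gchoose k\<close>.
  The sum is finite because \<open>Y v (n - k) w = 0\<close> for large \<open>k\<close>.\<close>

definition Y_shift :: "(complex \<Rightarrow> 'v \<Rightarrow> 'v) \<Rightarrow> ('v \<Rightarrow> int \<Rightarrow> 'v \<Rightarrow> 'v) \<Rightarrow> 'v \<Rightarrow> 'v \<Rightarrow> 'v
    \<Rightarrow> int \<Rightarrow> int \<Rightarrow> 'v::ab_group_add" where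
  "Y_shift s Y u v w = (\<lambda>m n. Sum_any (\<lambda>k::nat.
     s (of_int (m + int k) gchoose k) (Y u (m + int k) (Y v (n - int k) w))))"

locale nonlocal_vertex_algebra = vector_space scale
  for scale :: "complex \<Rightarrow> 'v \<Rightarrow> 'v::ab_group_add" +
  fixes V :: "'v set" and Y :: "'v \<Rightarrow> int \<Rightarrow> 'v \<Rightarrow> 'v" and vac :: 'v
  assumes V_subspace: "subspace V"
    and vac_in: "vac \<in> V"
    and Y_in: "\<lbrakk>u \<in> V; v \<in> V\<rbrakk> \<Longrightarrow> Y u m v \<in> V"
    and Y_linear_left: "v \<in> V \<Longrightarrow> linear_on scale scale V (\<lambda>u. Y u m v)"
    and Y_linear_right: "u \<in> V \<Longrightarrow> linear_on scale scale V (Y u m)"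
    and Y_truncation: "\<lbrakk>u \<in> V; v \<in> V\<rbrakk> \<Longrightarrow> \<exists>N. \<forall>m<N. Y u m v = 0"
    and Y_vac_left: "v \<in> V \<Longrightarrow> Y vac m v = (if m = 0 then v else 0)"
    and Y_vac_right: "\<lbrakk>v \<in> V; m < 0\<rbrakk> \<Longrightarrow> Y v m vac = 0"
    and Y_creation: "v \<in> V \<Longrightarrow> Y v 0 vac = v"
    and weak_associativity: "\<lbrakk>u \<in> V; v \<in> V; w \<in> V\<rbrakk> \<Longrightarrow>
      \<exists>l. poly_times scale ((var_outer + var_inner) ^ l) (Y_shift scale Y u v w) =
          poly_times scale ((var_outer + var_inner) ^ l) (\<lambda>m n. Y (Y u m v) n w)"

locale vertex_algebra = nonlocal_vertex_algebra +
  assumes locality: "\<lbrakk>u \<in> V; v \<in> V\<rbrakk> \<Longrightarrow>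
    \<exists>k. \<forall>w\<in>V. poly_times scale ((var_outer - var_inner) ^ k)
      (\<lambda>m n. Y u m (Y v n w) - Y v n (Y u m w)) = 0"


subsection \<open>Quasi modules-at-infinity\<close>

definition module_assoc_with :: "(complex \<Rightarrow> 'w \<Rightarrow> 'w) \<Rightarrow> ('v \<Rightarrow> int \<Rightarrow> 'v \<Rightarrow> 'v)
    \<Rightarrow> ('v \<Rightarrow> int \<Rightarrow> 'w \<Rightarrow> 'w::ab_group_add) \<Rightarrow> complex poly poly \<Rightarrow> 'v \<Rightarrow> 'v \<Rightarrow> bool" where
  "module_assoc_with s Y YW p u v \<longleftrightarrow>
     poly_times (fscale s) p (prod2 (YW u) (YW v)) \<in> Hom2 s \<and>
     poly_times (fscale s) (shift_poly p) (\<lambda>m n. YW (Y u m v) n) =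
       subst_add s (poly_times (fscale s) p (prod2 (YW u) (YW v)))"

locale quasi_module_at_infinity = nonlocal_vertex_algebra scale V Y vac + W: vector_space sW
  for scale :: "complex \<Rightarrow> 'v \<Rightarrow> 'v::ab_group_add" and V Y vac
    and sW :: "complex \<Rightarrow> 'w \<Rightarrow> 'w::ab_group_add" +
  fixes YW :: "'v \<Rightarrow> int \<Rightarrow> 'w \<Rightarrow> 'w"
  assumes YW_in: "u \<in> V \<Longrightarrow> YW u \<in> Eo sW"
    and YW_linear: "linear_on scale (fscale (fscale sW)) V YW"
    and YW_vac: "YW vac = one_Eo"
    and YW_assoc: "\<lbrakk>u \<in> V; v \<in> V\<rbrakk> \<Longrightarrow> \<exists>p. p \<noteq> 0 \<and> module_assoc_with sW Y YW p u v"

locale module_at_infinity = quasi_module_at_infinity +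
  assumes YW_assoc_local: "\<lbrakk>u \<in> V; v \<in> V\<rbrakk> \<Longrightarrow>
    \<exists>k. module_assoc_with sW Y YW ((var_outer - var_inner) ^ k) u v"


subsection \<open>Existence and uniqueness of \<open>\<iota>\<close>\<close>

lemma poly_map_poly_hom:
  fixes h :: "'a::comm_ring_1 \<Rightarrow> 'b::comm_ring_1"
  assumes hadd: "\<And>x y. h (x + y) = h x + h y" and hmult: "\<And>x y. h (x * y) = h x * h y"
    and h1: "h 1 = 1"
  shows "poly (map_poly h (p + q)) c = poly (map_poly h p) c + poly (map_poly h q) c"
    and "poly (map_poly h (p * q)) c = poly (map_poly h p) c * poly (map_poly h q) c"
    and "poly (map_poly h 1) c = 1"
proof -
  have h0: "h 0 = 0"
    using hadd[of 0 0] by simp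
  have pC: "poly (map_poly h (pCons a p)) c = h a + c * poly (map_poly h p) c" for a p
    by (simp add: map_poly_pCons h0)
  have add: "poly (map_poly h (p + q)) c = poly (map_poly h p) c + poly (map_poly h q) c" for p q
  proof (induction p q rule: poly_induct2)
    case 0
    show ?case by simp
  next
    case (pCons a p b q)
    show ?case
      by (simp add: pC hadd pCons.IH distrib_left add_ac)
  qed
  then show "poly (map_poly h (p + q)) c = poly (map_poly h p) c + poly (map_poly h q) c" .
  have smult: "poly (map_poly h (smult a q)) c = h a * poly (map_poly h q) c" for a q
  proof (induction q)
    case 0
    show ?case by simp
  next
    case (pCons b q)
    show ?case
      by (simp add: pC hmult pCons.IH distrib_left mult_ac)
  qed
  show "poly (map_poly h (p * q)) c = poly (map_poly h p) c * poly (map_poly h q) c"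
  proof (induction p)
    case 0
    show ?case by simp
  next
    case (pCons a p)
    show ?case
      by (simp add: pC add smult h0 pCons.IH distrib_left distrib_right mult_ac)
  qed
  show "poly (map_poly h 1) c = 1"
    by (simp add: one_pCons pC h1)
qed

lemma fls_const_hom:
  "fls_const (x + y) = fls_const x + fls_const y"
  "fls_const (x * y) = fls_const x * fls_const (y :: 'a::comm_ring_1)"
  by (rule fls_eqI, simp) (rule fls_const_mult_const[symmetric])

lemma poly_incl_hom:
  "poly_incl (P + Q) = poly_incl P + poly_incl Q"
  "poly_incl (P * Q) = poly_incl P * poly_incl Q"
  "poly_incl 1 = 1"
proof -
  define g where "g = (\<lambda>q::complex poly. poly (map_poly fls_const q) (fls_X_inv :: complex fls))"
  have g: "g (x + y) = g x + g y" "g (x * y) = g x * g y" "g 1 = 1" for x y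
    unfolding g_def by (rule poly_map_poly_hom fls_const_hom fls_const_1)+
  have h: "fls_const (g (x + y)) = fls_const (g x) + fls_const (g y)"
    "fls_const (g (x * y)) = fls_const (g x) * fls_const (g y)" "fls_const (g 1) = 1" for x y
    by (simp_all only: g fls_const_hom fls_const_1)
  have eq: "poly_incl P = poly (map_poly (\<lambda>q. fls_const (g q)) P) fls_X" for P
    by (simp only: poly_incl_def g_def)
  show "poly_incl (P + Q) = poly_incl P + poly_incl Q"
    "poly_incl (P * Q) = poly_incl P * poly_incl Q" "poly_incl 1 = 1"
    unfolding eq by (rule poly_map_poly_hom[where h = "\<lambda>q. fls_const (g q)", OF h])+
qed

lemma poly_X_inv_nth: "fls_nth (poly (map_poly fls_const q) fls_X_inv) (- int n) = coeff q n"
  for q :: "complex poly"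
proof (induction q arbitrary: n)
  case 0
  show ?case by simp
next
  case (pCons a q)
  have "fls_nth (poly (map_poly fls_const q) fls_X_inv) 1 = 0" for q :: "complex poly"
  proof -
    have "\<forall>n>0. fls_nth (poly (map_poly fls_const q) fls_X_inv) n = 0"
      by (induction q) (simp_all add: map_poly_pCons fls_X_inv_times_conv_shift)
    then show ?thesis by simp
  qed
  then show ?case
    using pCons.IH[of "n - 1"]
    by (cases n) (simp_all add: map_poly_pCons fls_X_inv_times_conv_shift)
qed

lemma poly_incl_nth:
  "fls_nth (poly_incl P) (int n) = poly (map_poly fls_const (coeff P n)) fls_X_inv"
proof (induction P arbitrary: n)
  case 0
  show ?case by (simp add: poly_incl_def)
next
  case (pCons a P)
  have rec: "poly_incl (pCons a P) =
      fls_const (poly (map_poly fls_const a) fls_X_inv) + fls_X * poly_incl P" for a P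
    by (simp add: poly_incl_def map_poly_pCons)
  have "\<forall>n<0. fls_nth (poly_incl P) n = 0"
    by (induction P) (simp add: poly_incl_def, simp add: rec fls_X_times_conv_shift)
  then show ?case
    using pCons.IH[of "n - 1"]
    by (cases n) (simp_all add: rec fls_X_times_conv_shift)
qed

lemma poly_incl_eq_0_iff: "poly_incl P = 0 \<longleftrightarrow> P = 0"
proof
  assume *: "poly_incl P = 0"
  show "P = 0"
  proof (rule poly_eqI)
    fix k
    have "coeff (coeff P k) n = 0" for n
      using poly_incl_nth[of P k] poly_X_inv_nth[of "coeff P k" n] * by simp
    then show "coeff P k = coeff 0 k"
      by (simp add: poly_eq_iff)
  qed
qed (simp add: poly_incl_def)

lemma field_embedding_divide:
  assumes "field_embedding f"
  shows "f (x / y) = f x / f y"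
proof (cases "y = 0")
  case True
  have "f 0 = 0"
    using assms unfolding field_embedding_def by (metis add_cancel_right_right)
  with True show ?thesis by simp
next
  case False
  have "f (x / y) * f y = f x" "f (inverse y) * f y = 1"
    using assms False unfolding field_embedding_def
    by (metis nonzero_eq_divide_eq, metis left_inverse)
  then show ?thesis
    by (metis mult_zero_right nonzero_eq_divide_eq zero_neq_one)
qed

lemma ex1_iota: "\<exists>!f. field_embedding f \<and> (\<forall>P. f (to_fract P) = poly_incl P)"
proof -
  have split: "\<exists>P Q. Q \<noteq> 0 \<and> r = Fract P Q" for r :: "complex poly poly fract"
    by (cases r) auto
  define N D where "N = (\<lambda>r::complex poly poly fract. SOME P. \<exists>Q. Q \<noteq> 0 \<and> r = Fract P Q)"
    and "D = (\<lambda>r. SOME Q. Q \<noteq> 0 \<and> r = Fract (N r) Q)"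
  have ND: "D r \<noteq> 0" "r = Fract (N r) (D r)" for r
  proof -
    have "\<exists>Q. Q \<noteq> 0 \<and> r = Fract (N r) Q"
      unfolding N_def by (rule someI_ex) (rule split)
    then have "D r \<noteq> 0 \<and> r = Fract (N r) (D r)"
      unfolding D_def by (rule someI_ex)
    then show "D r \<noteq> 0" "r = Fract (N r) (D r)" by auto
  qed
  define f where "f = (\<lambda>r. poly_incl (N r) / poly_incl (D r))"
  have f: "f (Fract P Q) = poly_incl P / poly_incl Q" if "Q \<noteq> 0" for P Q
  proof -
    have "Fract P Q = Fract (N (Fract P Q)) (D (Fract P Q))"
      by (rule ND)
    then have "P * D (Fract P Q) = N (Fract P Q) * Q"
      using that ND(1) by (simp add: eq_fract(1))
    then have "poly_incl P * poly_incl (D (Fract P Q)) = poly_incl (N (Fract P Q)) * poly_incl Q"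
      by (metis poly_incl_hom(2))
    then show ?thesis
      using that ND(1)[of "Fract P Q"] by (simp add: f_def poly_incl_eq_0_iff frac_eq_eq)
  qed
  have emb: "field_embedding f"
    unfolding field_embedding_def
  proof (intro conjI allI)
    show "f 1 = 1"
      using f[of 1 1] by (simp add: One_fract_def poly_incl_hom)
  next
    fix x y :: "complex poly poly fract"
    obtain P Q where "Q \<noteq> 0" "x = Fract P Q"
      using split[of x] by blast
    moreover obtain P' Q' where "Q' \<noteq> 0" "y = Fract P' Q'"
      using split[of y] by blast
    ultimately show "f (x + y) = f x + f y" "f (x * y) = f x * f y"
      by (simp_all add: f poly_incl_hom poly_incl_eq_0_iff add_frac_eq)
  qed
  show ?thesis
  proof (intro ex1I conjI allI)
    show "field_embedding f" by (rule emb)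
    show "f (to_fract P) = poly_incl P" for P
      by (simp add: to_fract_def f poly_incl_hom)
  next
    fix f' assume f': "field_embedding f' \<and> (\<forall>P. f' (to_fract P) = poly_incl P)"
    show "f' = f"
    proof
      fix r :: "complex poly poly fract"
      obtain P Q where "Q \<noteq> 0" "r = Fract P Q"
        using split[of r] by blast
      have "f' r = f' (to_fract P / to_fract Q)"
        using \<open>r = Fract P Q\<close> by (simp add: to_fract_def)
      also have "\<dots> = poly_incl P / poly_incl Q"
        using f' field_embedding_divide[of f'] by simp
      also have "\<dots> = f r"
        using f[OF \<open>Q \<noteq> 0\<close>, of P] \<open>r = Fract P Q\<close> by simp
      finally show "f' r = f r" .
    qed
  qed
qed

lemma iota_embedding: "field_embedding iota" and iota_to_fract: "iota (to_fract P) = poly_incl P"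
  using theI'[OF ex1_iota] unfolding iota_def by auto

end

(*
  The coefficients of a(x_1) b(x_2) are a fraction F / p with F bounded above in both variables, and
  Y(a,x_0)b is the value of that fraction at x_1 = x + x_0. So Y comes from a homomorphism T of
  modules over the polynomials, the localization of the substitution x_1 = x + x_0; it kills torsion,
  hence does not see the order of a(x_1) and b(x_2).
  Iterating T on P a(x_1) b(x_2) c(x), where P is a product of polynomials p(x_i,x_j), shows that
  Y(a,y_1)Y(b,y_2)c, Y(b,y_2)Y(a,y_1)c and Y(Y(a,x_0)b,y_2)c become explicit substitutions in one and
  the same series after multiplication by the shifted P. Writing p = (x_1 - x_2)^k p' with p'(x,x)
  nonzero, the shifted p' can be cancelled, because its constant term in y_1, y_2 is a nonzero
  polynomial in x. What remains are powers of y_1 - y_2 (locality), of x_0 + y_2 (weak associativity)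
  and monomials. Dong's lemma follows in the same way and makes all pairs of generated series
  quasi-local.
*)

theory Submission
  imports Defs
begin

section \<open>Formal series as modules over polynomial rings\<close>

text \<open>Torsion is the obstacle. A series unbounded in both directions can be killed by a
  nonzero polynomial, so agreement after multiplication by \<open>p\<close> says nothing in general.
  Apart from monomials, polynomials are therefore cancelled only in spaces where an extreme
  coefficient can be isolated: \<open>Eo\<close>, \<open>LEo\<close> and \<open>DF\<close>. The last
  is needed because Y(a,y_1)Y(b,y_2)c and Y(b,y_2)Y(a,y_1)c are Laurent series with the variables in
  opposite order, and their difference in general lies in neither of the two iterated Laurent
  spaces. The exponents in the axioms come from keeping two polynomials apart, \<open>p\<close> for
  the pair (a,b) and \<open>q\<close> for the pairs with c. At x_1 = y_1 + x, x_2 = y_2 + x the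
  differences x_1 - x_2, x_1 - x, x_2 - x become y_1 - y_2, y_1, y_2. So the power of y_1 - y_2 is
  determined by \<open>p\<close> alone and is the same for all c, as locality demands. At x_1 = x_0
  + y_2 + x they become x_0, x_0 + y_2, y_2, and the power of x_0 + y_2 comes from
  \<open>q\<close>.\<close>

lemma sum_fun_apply: "(\<Sum>i\<in>I. f i) x = (\<Sum>i\<in>I. f i x)"
  by (induction I rule: infinite_finite_induct) auto

text \<open>Kept abstract in the coefficient ring and its module so that it can be iterated: each
  application adds an outer variable, and \<open>module_pact\<close> hands the module laws on to the
  next level.\<close>

definition pact :: "('r \<Rightarrow> 'b \<Rightarrow> 'b) \<Rightarrow> 'r::zero poly \<Rightarrow> (int \<Rightarrow> 'b) \<Rightarrow> int \<Rightarrow> 'b::comm_monoid_add" where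
  "pact \<alpha> p A = (\<lambda>m. \<Sum>k\<le>degree p. \<alpha> (coeff p k) (A (m - int k)))"

lemma module_fscale: "module \<alpha> \<Longrightarrow> module (fscale \<alpha>)"
  unfolding module_def fscale_def by (auto simp: fun_eq_iff)

lemma poly_times_pact: "poly_times \<alpha> = pact (pact \<alpha>)"
  unfolding poly_times_def pact_def by (simp add: fun_eq_iff sum_fun_apply)

context module
begin

lemma pact_bound:
  assumes "degree p \<le> n"
  shows "pact scale p A m = (\<Sum>k\<le>n. scale (coeff p k) (A (m - int k)))"
  unfolding pact_def using assms
  by (intro sum.mono_neutral_left) (auto simp: coeff_eq_0)

lemma pact_0_left: "pact scale 0 A = 0"
  by (simp add: pact_def fun_eq_iff)

lemma pact_pCons: "pact scale (pCons c p) A m = scale c (A m) + pact scale p A (m - 1)"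
proof -
  have "degree (pCons c p) \<le> Suc (degree p)"
    by (rule degree_pCons_le)
  then have "pact scale (pCons c p) A m = (\<Sum>k\<le>Suc (degree p). scale (coeff (pCons c p) k) (A (m - int k)))"
    by (rule pact_bound)
  also have "\<dots> = scale c (A m) + pact scale p A (m - 1)"
    by (simp add: sum.atMost_Suc_shift pact_def algebra_simps del: sum.atMost_Suc)
  finally show ?thesis .
qed

lemma pact_const: "pact scale [:c:] A = (\<lambda>m. scale c (A m))"
  by (simp add: fun_eq_iff pact_pCons pact_0_left)

lemma pact_X: "pact scale [:0, 1:] A = (\<lambda>m. A (m - 1))"
  by (simp add: fun_eq_iff pact_pCons pact_0_left)

lemma pact_add_left: "pact scale (p + q) A = pact scale p A + pact scale q A"
proof
  fix m
  show "pact scale (p + q) A m = (pact scale p A + pact scale q A) m"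
    by (induction p q arbitrary: m rule: poly_induct2)
      (simp_all add: pact_0_left pact_pCons scale_left_distrib algebra_simps)
qed

lemma pact_add_right: "pact scale p (A + B) = pact scale p A + pact scale p B"
  by (simp add: pact_def fun_eq_iff scale_right_distrib sum.distrib)

lemma pact_smult: "pact scale (smult c q) A m = scale c (pact scale q A m)"
  by (induction q arbitrary: m) (simp_all add: pact_0_left pact_pCons scale_right_distrib)

lemma pact_mult: "pact scale (p * q) A = pact scale p (pact scale q A)"
proof
  fix m
  show "pact scale (p * q) A m = pact scale p (pact scale q A) m"
    by (induction p arbitrary: m)
      (simp_all add: pact_0_left pact_pCons pact_add_left pact_smult)
qed

lemma module_pact: "module (pact scale)"
  by unfold_locales
    (simp_all add: pact_add_left pact_add_right pact_mult, simp add: one_pCons pact_const)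

end

section \<open>Evaluation of polynomials, and maps compatible with it\<close>

definition unital_hom :: "('a::semiring_1 \<Rightarrow> 'b::semiring_1) \<Rightarrow> bool" where
  "unital_hom h \<longleftrightarrow> (\<forall>x y. h (x + y) = h x + h y) \<and> (\<forall>x y. h (x * y) = h x * h y) \<and> h 1 = 1"

lemma unital_hom_0: "unital_hom (h :: 'a::ring_1 \<Rightarrow> 'b::ring_1) \<Longrightarrow> h 0 = 0"
  unfolding unital_hom_def by (metis add_cancel_right_right)

lemma unital_hom_power: "unital_hom h \<Longrightarrow> h (x ^ n) = h x ^ n"
  by (induction n) (simp_all add: unital_hom_def)

lemma unital_hom_diff: "unital_hom (h :: 'a::ring_1 \<Rightarrow> 'b::ring_1) \<Longrightarrow> h (x - y) = h x - h y"
  unfolding unital_hom_def by (metis add_diff_cancel diff_add_cancel)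

definition ev :: "('a::comm_ring_1 \<Rightarrow> 'b::comm_ring_1) \<Rightarrow> 'b \<Rightarrow> 'a poly \<Rightarrow> 'b" where
  "ev h y p = poly (map_poly h p) y"

lemma unital_hom_ev:
  assumes "unital_hom h"
  shows "unital_hom (ev h y)"
proof -
  have h: "\<And>x y. h (x + y) = h x + h y" "\<And>x y. h (x * y) = h x * h y" "h 1 = 1"
    using assms by (auto simp: unital_hom_def)
  show ?thesis
    unfolding unital_hom_def ev_def using poly_map_poly_hom[of h, OF h] by blast
qed

lemma ev_0: "ev h y 0 = 0"
  by (simp add: ev_def)

lemma ev_pCons: "unital_hom h \<Longrightarrow> ev h y (pCons c p) = h c + y * ev h y p"
  by (simp add: ev_def map_poly_pCons unital_hom_0)

lemma ev_X: "unital_hom h \<Longrightarrow> ev h y [:0, 1:] = y"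
  by (simp add: ev_pCons ev_0 unital_hom_0) (simp add: unital_hom_def)

lemma ev_const: "unital_hom h \<Longrightarrow> ev h y [:c:] = h c"
  by (simp add: ev_pCons ev_0)

lemma ev_comp:
  assumes "unital_hom h" "unital_hom g"
  shows "g (ev h y p) = ev (\<lambda>c. g (h c)) (g y) p"
proof -
  have gh: "unital_hom (\<lambda>c. g (h c))"
    using assms by (simp add: unital_hom_def)
  have g: "g (u + v) = g u + g v" "g (u * v) = g u * g v" for u v
    using assms(2) by (auto simp: unital_hom_def)
  show ?thesis
    by (induction p) (simp_all add: ev_0 unital_hom_0 assms ev_pCons gh g)
qed

text \<open>Constants and the variable generate the polynomial ring, so a map that respects
  multiplication by these is semilinear along \<open>ev h y\<close>. The set \<open>N\<close> is
  there because the maps of interest, such as \<open>subst_add\<close>, are additive only where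
  their sums are finite. Most compatibilities with polynomials below are instances, which leaves
  shifts of an exponent by one to be checked.\<close>

lemma intertwine:
  fixes \<psi>1 :: "'r::comm_ring_1 poly \<Rightarrow> 'm::ab_group_add \<Rightarrow> 'm"
    and \<psi>2 :: "'q::comm_ring_1 \<Rightarrow> 'n::ab_group_add \<Rightarrow> 'n"
  assumes m1: "module \<psi>1" and m2: "module \<psi>2" and h: "unital_hom h"
    and N_add: "\<And>A B. A \<in> N \<Longrightarrow> B \<in> N \<Longrightarrow> A + B \<in> N"
    and N_const: "\<And>c A. A \<in> N \<Longrightarrow> \<psi>1 [:c:] A \<in> N"
    and N_X: "\<And>A. A \<in> N \<Longrightarrow> \<psi>1 [:0, 1:] A \<in> N"
    and add: "\<And>A B. A \<in> N \<Longrightarrow> B \<in> N \<Longrightarrow> \<Phi> (A + B) = \<Phi> A + \<Phi> B"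
    and const: "\<And>c A. A \<in> N \<Longrightarrow> \<Phi> (\<psi>1 [:c:] A) = \<psi>2 (h c) (\<Phi> A)"
    and X: "\<And>A. A \<in> N \<Longrightarrow> \<Phi> (\<psi>1 [:0, 1:] A) = \<psi>2 y (\<Phi> A)"
    and A: "A \<in> N"
  shows "\<psi>1 p A \<in> N \<and> \<Phi> (\<psi>1 p A) = \<psi>2 (ev h y p) (\<Phi> A)"
proof (induction p)
  case 0
  show ?case
    using N_const[OF A, of 0] const[OF A, of 0] h by (simp add: ev_0 unital_hom_0)
next
  case (pCons c p)
  have "pCons c p = [:c:] + [:0, 1:] * p"
    by simp
  then have "\<psi>1 (pCons c p) A = \<psi>1 ([:c:] + [:0, 1:] * p) A"
    by (rule arg_cong)
  then have "\<psi>1 (pCons c p) A = \<psi>1 [:c:] A + \<psi>1 [:0, 1:] (\<psi>1 p A)"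
    by (simp only: module.scale_left_distrib[OF m1] module.scale_scale[OF m1])
  moreover have "\<psi>2 (h c + y * ev h y p) (\<Phi> A) = \<psi>2 (h c) (\<Phi> A) + \<psi>2 y (\<psi>2 (ev h y p) (\<Phi> A))"
    by (simp only: module.scale_left_distrib[OF m2] module.scale_scale[OF m2])
  ultimately show ?case
    using pCons.IH by (simp add: ev_pCons h N_add N_const N_X A add const X)
qed

lemma module_comp_hom: "module \<psi> \<Longrightarrow> unital_hom h \<Longrightarrow> module (\<lambda>p. \<psi> (h p))"
  unfolding module_def unital_hom_def by auto

lemma unital_hom_const_poly: "unital_hom (\<lambda>c. [:c:])"
  by (simp add: unital_hom_def one_pCons mult.commute)

subsection \<open>Polynomials in two and three variables\<close>

type_synonym poly3 = "complex poly poly poly"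

abbreviation act3 :: "(complex \<Rightarrow> 'b \<Rightarrow> 'b) \<Rightarrow> poly3 \<Rightarrow> (int \<Rightarrow> int \<Rightarrow> int \<Rightarrow> 'b) \<Rightarrow> int \<Rightarrow> int \<Rightarrow> int \<Rightarrow> 'b::ab_group_add"
  where "act3 \<alpha> \<equiv> pact (pact (pact \<alpha>))"

definition v1 :: poly3 where "v1 = [:0, 1:]"
definition v2 :: poly3 where "v2 = [:[:0, 1:]:]"
definition v3 :: poly3 where "v3 = [:[:[:0, 1:]:]:]"
definition c3 :: "complex \<Rightarrow> poly3" where "c3 c = [:[:[:c:]:]:]"

definition ev2 :: "poly3 \<Rightarrow> poly3 \<Rightarrow> complex poly poly \<Rightarrow> poly3" where
  "ev2 y z = ev (ev c3 z) y"

definition ev3 :: "poly3 \<Rightarrow> poly3 \<Rightarrow> poly3 \<Rightarrow> poly3 \<Rightarrow> poly3" where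
  "ev3 x y z = ev (ev (ev c3 z) y) x"

lemma unital_hom_c3: "unital_hom c3"
  by (simp add: unital_hom_def c3_def one_pCons mult.commute)

lemma unital_hom_ev2: "unital_hom (ev2 y z)"
  unfolding ev2_def by (intro unital_hom_ev unital_hom_c3)

lemma unital_hom_ev3: "unital_hom (ev3 x y z)"
  unfolding ev3_def by (intro unital_hom_ev unital_hom_c3)

lemmas hom_ev1 = unital_hom_ev[OF unital_hom_c3]

lemma ev2_simps [simp]:
  "ev2 y z var_outer = y" "ev2 y z var_inner = z" "ev2 y z [:[:c:]:] = c3 c"
  "ev2 y z 0 = 0" "ev2 y z 1 = 1" "ev2 y z (p + q) = ev2 y z p + ev2 y z q"
  "ev2 y z (p * q) = ev2 y z p * ev2 y z q" "ev2 y z (p - q) = ev2 y z p - ev2 y z q"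
  "ev2 y z (p ^ n) = ev2 y z p ^ n"
proof -
  note h = unital_hom_ev2[of y z]
  show "ev2 y z 0 = 0" "ev2 y z (p - q) = ev2 y z p - ev2 y z q" "ev2 y z (p ^ n) = ev2 y z p ^ n"
    by (rule unital_hom_0[OF h] unital_hom_diff[OF h] unital_hom_power[OF h])+
  show "ev2 y z 1 = 1" "ev2 y z (p + q) = ev2 y z p + ev2 y z q"
    "ev2 y z (p * q) = ev2 y z p * ev2 y z q"
    using h unfolding unital_hom_def by blast+
  show "ev2 y z var_outer = y" "ev2 y z var_inner = z" "ev2 y z [:[:c:]:] = c3 c"
    by (simp_all add: ev2_def var_outer_def var_inner_def ev_X ev_const unital_hom_c3 unital_hom_ev)
qed

lemma ev3_simps [simp]:
  "ev3 x y z v1 = x" "ev3 x y z v2 = y" "ev3 x y z v3 = z" "ev3 x y z (c3 c) = c3 c"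
  "ev3 x y z 0 = 0" "ev3 x y z 1 = 1" "ev3 x y z (p + q) = ev3 x y z p + ev3 x y z q"
  "ev3 x y z (p * q) = ev3 x y z p * ev3 x y z q" "ev3 x y z (p - q) = ev3 x y z p - ev3 x y z q"
  "ev3 x y z (p ^ n) = ev3 x y z p ^ n"
proof -
  note h = unital_hom_ev3[of x y z]
  show "ev3 x y z 0 = 0" "ev3 x y z (p - q) = ev3 x y z p - ev3 x y z q"
    "ev3 x y z (p ^ n) = ev3 x y z p ^ n"
    by (rule unital_hom_0[OF h] unital_hom_diff[OF h] unital_hom_power[OF h])+
  show "ev3 x y z 1 = 1" "ev3 x y z (p + q) = ev3 x y z p + ev3 x y z q"
    "ev3 x y z (p * q) = ev3 x y z p * ev3 x y z q"
    using h unfolding unital_hom_def by blast+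
  show "ev3 x y z v1 = x" "ev3 x y z v2 = y" "ev3 x y z v3 = z"
    by (simp_all add: ev3_def v1_def v2_def v3_def ev_X ev_const unital_hom_c3 unital_hom_ev)
  have "ev3 x y z [:[:[:c:]:]:] = c3 c"
    by (simp add: ev3_def ev_const unital_hom_c3 unital_hom_ev)
  then show "ev3 x y z (c3 c) = c3 c"
    by (simp add: c3_def)
qed

lemma hom_ev2:
  assumes "unital_hom g" "\<And>c. g (c3 c) = c3 c"
  shows "g (ev2 y z p) = ev2 (g y) (g z) p"
proof -
  have "g (ev2 y z p) = ev (\<lambda>c. g (ev c3 z c)) (g y) p"
    unfolding ev2_def by (rule ev_comp[OF hom_ev1 assms(1)])
  also have "(\<lambda>c. g (ev c3 z c)) = ev c3 (g z)"
    by (rule ext) (simp add: ev_comp[OF unital_hom_c3 assms(1)] assms(2))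
  finally show ?thesis by (simp add: ev2_def)
qed

lemma hom_ev3:
  assumes "unital_hom g" "\<And>c. g (c3 c) = c3 c"
  shows "g (ev3 x y z p) = ev3 (g x) (g y) (g z) p"
proof -
  have "g (ev3 x y z p) = ev (\<lambda>c. g (ev2 y z c)) (g x) p"
    unfolding ev3_def ev2_def[symmetric] by (rule ev_comp[OF unital_hom_ev2 assms(1)])
  also have "(\<lambda>c. g (ev2 y z c)) = ev2 (g y) (g z)"
    by (rule ext) (rule hom_ev2[OF assms])
  finally show ?thesis by (simp add: ev3_def ev2_def)
qed

lemma ev3_ev2 [simp]: "ev3 x y z (ev2 a b p) = ev2 (ev3 x y z a) (ev3 x y z b) p"
  by (rule hom_ev2) (simp_all add: unital_hom_ev3)

lemma ev3_ev3: "ev3 x y z (ev3 a b c p) = ev3 (ev3 x y z a) (ev3 x y z b) (ev3 x y z c) p"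
  by (rule hom_ev3) (simp_all add: unital_hom_ev3)

lemma intertwine2:
  fixes \<psi>1 :: "complex poly poly \<Rightarrow> 'm::ab_group_add \<Rightarrow> 'm"
    and \<psi>2 :: "'q::comm_ring_1 \<Rightarrow> 'n::ab_group_add \<Rightarrow> 'n"
  assumes m1: "module \<psi>1" and m2: "module \<psi>2" and h: "unital_hom h"
    and N_add: "\<And>A B. A \<in> N \<Longrightarrow> B \<in> N \<Longrightarrow> A + B \<in> N"
    and N_const: "\<And>c A. A \<in> N \<Longrightarrow> \<psi>1 [:[:c:]:] A \<in> N"
    and N_inner: "\<And>A. A \<in> N \<Longrightarrow> \<psi>1 [:[:0, 1:]:] A \<in> N"
    and N_outer: "\<And>A. A \<in> N \<Longrightarrow> \<psi>1 [:0, 1:] A \<in> N"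
    and add: "\<And>A B. A \<in> N \<Longrightarrow> B \<in> N \<Longrightarrow> \<Phi> (A + B) = \<Phi> A + \<Phi> B"
    and const: "\<And>c A. A \<in> N \<Longrightarrow> \<Phi> (\<psi>1 [:[:c:]:] A) = \<psi>2 (h c) (\<Phi> A)"
    and inner: "\<And>A. A \<in> N \<Longrightarrow> \<Phi> (\<psi>1 [:[:0, 1:]:] A) = \<psi>2 z (\<Phi> A)"
    and outer: "\<And>A. A \<in> N \<Longrightarrow> \<Phi> (\<psi>1 [:0, 1:] A) = \<psi>2 y (\<Phi> A)"
    and A: "A \<in> N"
  shows "\<psi>1 p A \<in> N \<and> \<Phi> (\<psi>1 p A) = \<psi>2 (ev (ev h z) y p) (\<Phi> A)"
proof -
  have *: "\<psi>1 [:c:] A \<in> N \<and> \<Phi> (\<psi>1 [:c:] A) = \<psi>2 (ev h z c) (\<Phi> A)" if "A \<in> N" for c A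
    by (rule intertwine[where ?\<psi>1.0 = "\<lambda>c. \<psi>1 [:c:]" and N = N])
      (use that assms module_comp_hom[OF m1 unital_hom_const_poly] in auto)
  show ?thesis
    by (rule intertwine[where N = N]) (use assms * in \<open>auto intro: unital_hom_ev\<close>)
qed

lemma intertwine3:
  fixes \<psi>1 :: "poly3 \<Rightarrow> 'm::ab_group_add \<Rightarrow> 'm"
    and \<psi>2 :: "poly3 \<Rightarrow> 'n::ab_group_add \<Rightarrow> 'n"
  assumes m1: "module \<psi>1" and m2: "module \<psi>2"
    and N_add: "\<And>A B. A \<in> N \<Longrightarrow> B \<in> N \<Longrightarrow> A + B \<in> N"
    and N_const: "\<And>c A. A \<in> N \<Longrightarrow> \<psi>1 (c3 c) A \<in> N"
    and N3: "\<And>A. A \<in> N \<Longrightarrow> \<psi>1 v3 A \<in> N"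
    and N2: "\<And>A. A \<in> N \<Longrightarrow> \<psi>1 v2 A \<in> N"
    and N1: "\<And>A. A \<in> N \<Longrightarrow> \<psi>1 v1 A \<in> N"
    and add: "\<And>A B. A \<in> N \<Longrightarrow> B \<in> N \<Longrightarrow> \<Phi> (A + B) = \<Phi> A + \<Phi> B"
    and const: "\<And>c A. A \<in> N \<Longrightarrow> \<Phi> (\<psi>1 (c3 c) A) = \<psi>2 (c3 c) (\<Phi> A)"
    and \<Phi>3: "\<And>A. A \<in> N \<Longrightarrow> \<Phi> (\<psi>1 v3 A) = \<psi>2 z (\<Phi> A)"
    and \<Phi>2: "\<And>A. A \<in> N \<Longrightarrow> \<Phi> (\<psi>1 v2 A) = \<psi>2 y (\<Phi> A)"
    and \<Phi>1: "\<And>A. A \<in> N \<Longrightarrow> \<Phi> (\<psi>1 v1 A) = \<psi>2 x (\<Phi> A)"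
    and A: "A \<in> N"
  shows "\<psi>1 p A \<in> N \<and> \<Phi> (\<psi>1 p A) = \<psi>2 (ev3 x y z p) (\<Phi> A)"
proof -
  have *: "\<psi>1 [:c:] A \<in> N \<and> \<Phi> (\<psi>1 [:c:] A) = \<psi>2 (ev (ev c3 z) y c) (\<Phi> A)" if "A \<in> N" for c A
    by (rule intertwine2[where ?\<psi>1.0 = "\<lambda>c. \<psi>1 [:c:]" and N = N])
      (use that assms[unfolded v1_def v2_def v3_def] module_comp_hom[OF m1 unital_hom_const_poly]
          unital_hom_c3 in \<open>auto simp flip: c3_def\<close>)
  show ?thesis
    unfolding ev3_def
    by (rule intertwine[where N = N]) (use assms[unfolded v1_def] * in \<open>auto intro: unital_hom_ev unital_hom_c3\<close>)
qed

context module
begin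

lemmas module_pact2 = module.module_pact[OF module_pact]
lemmas module_pact3 = module.module_pact[OF module_pact2]

text \<open>Coefficient \<open>m\<close> of the product is \<open>coeff f 0\<close> applied to
  \<open>D m\<close> plus terms from lower coefficients of \<open>D\<close>. If a power of
  \<open>coeff f 0\<close> kills all lower ones, one more factor kills \<open>D m\<close>. The
  exponent grows with \<open>m\<close>, which is harmless in Dong's lemma, where each coefficient is
  treated separately.\<close>

lemma lowest_term_kills:
  assumes D: "\<And>m. m < M \<Longrightarrow> D m = 0" and f: "pact scale f D = 0"
  shows "\<exists>k. scale (coeff f 0 ^ k) (D m) = 0"
proof -
  define g where "g = coeff f 0"
  have "\<exists>k. \<forall>m<M + int n. scale (g ^ k) (D m) = 0" for n
  proof (induction n)
    case 0
    have "\<forall>m<M + int 0. scale (g ^ 0) (D m) = 0"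
      by (simp add: D)
    then show ?case ..
  next
    case (Suc n)
    then obtain k where k: "\<forall>m<M + int n. scale (g ^ k) (D m) = 0" ..
    define m where "m = M + int n"
    have "pact scale f D m = (\<Sum>i\<le>degree f. scale (coeff f i) (D (m - int i)))"
      by (simp add: pact_def)
    then have "0 = scale (g ^ k) (\<Sum>i\<le>degree f. scale (coeff f i) (D (m - int i)))"
      using f by simp
    also have "\<dots> = (\<Sum>i\<le>degree f. scale (coeff f i) (scale (g ^ k) (D (m - int i))))"
      by (simp only: scale_sum_right scale_left_commute)
    also have "\<dots> = (\<Sum>i\<in>{0}. scale (coeff f i) (scale (g ^ k) (D (m - int i))))"
      using k by (intro sum.mono_neutral_right) (auto simp: m_def)
    finally have "scale (g ^ Suc k) (D m) = 0"
      by (simp add: g_def)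
    moreover have "scale (g ^ Suc k) (D i) = 0" if "i < M + int n" for i
      using k that scale_scale[of g "g ^ k" "D i"] by simp
    ultimately have "\<forall>i<M + int (Suc n). scale (g ^ Suc k) (D i) = 0"
      by (metis m_def add.commute int_Suc zle_add1_eq_le order_le_less add.assoc of_nat_Suc)
    then show ?case ..
  qed
  from this[of "nat (m + 1 - M)"] obtain k where "\<forall>i<M + int (nat (m + 1 - M)). scale (g ^ k) (D i) = 0" ..
  then have "scale (g ^ k) (D m) = 0"
    by simp
  then show ?thesis
    by (auto simp: g_def)
qed

end

lemma pact_gens:
  fixes \<alpha> :: "complex \<Rightarrow> 'b::ab_group_add \<Rightarrow> 'b"
  assumes "module \<alpha>"
  shows "pact (pact \<alpha>) [:[:c:]:] B = (\<lambda>m n. \<alpha> c (B m n))"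
    "pact (pact \<alpha>) [:[:0, 1:]:] B = (\<lambda>m n. B m (n - 1))"
    "pact (pact \<alpha>) [:0, 1:] B = (\<lambda>m n. B (m - 1) n)"
    "act3 \<alpha> (c3 c) A = (\<lambda>i j k. \<alpha> c (A i j k))"
    "act3 \<alpha> v1 A = (\<lambda>i j k. A (i - 1) j k)"
    "act3 \<alpha> v2 A = (\<lambda>i j k. A i (j - 1) k)"
    "act3 \<alpha> v3 A = (\<lambda>i j k. A i j (k - 1))"
proof -
  interpret module \<alpha> by fact
  interpret m1: module "pact \<alpha>" by (rule module_pact)
  interpret m2: module "pact (pact \<alpha>)" by (rule module_pact2)
  show "pact (pact \<alpha>) [:[:c:]:] B = (\<lambda>m n. \<alpha> c (B m n))"
    "pact (pact \<alpha>) [:[:0, 1:]:] B = (\<lambda>m n. B m (n - 1))"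
    "pact (pact \<alpha>) [:0, 1:] B = (\<lambda>m n. B (m - 1) n)"
    by (simp_all add: m1.pact_const pact_const pact_X m1.pact_X)
  show "act3 \<alpha> (c3 c) A = (\<lambda>i j k. \<alpha> c (A i j k))"
    "act3 \<alpha> v1 A = (\<lambda>i j k. A (i - 1) j k)"
    "act3 \<alpha> v2 A = (\<lambda>i j k. A i (j - 1) k)"
    "act3 \<alpha> v3 A = (\<lambda>i j k. A i j (k - 1))"
    unfolding c3_def v1_def v2_def v3_def
    by (simp_all add: m2.pact_const m1.pact_const pact_const pact_X m1.pact_X m2.pact_X)
qed

lemma hom_const2: "unital_hom (\<lambda>c::complex. [:[:c:]:])"
  by (simp add: unital_hom_def one_pCons mult.commute)

lemma ev_const_poly_inner: "ev (\<lambda>c::complex. [:[:c:]:]) var_inner q = [:q:]"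
  by (induction q) (simp_all add: ev_0 ev_pCons unital_hom_def one_pCons mult.commute var_inner_def)

text \<open>Puts \<open>shift_poly\<close> into the form in which \<open>intertwine2\<close>
  delivers its result.\<close>

lemma ev_shift_poly: "ev (ev (\<lambda>c::complex. [:[:c:]:]) var_inner) (var_outer + var_inner) p = shift_poly p"
  by (induction p)
    (simp_all add: ev_0 ev_pCons unital_hom_ev[OF hom_const2] shift_poly_def ev_const_poly_inner pcompose_pCons unital_hom_const_poly)

lemma ev_id_poly: "ev (ev (\<lambda>c::complex. [:[:c:]:]) var_inner) var_outer p = p"
  by (induction p) (simp_all add: ev_0 ev_pCons unital_hom_ev[OF hom_const2] ev_const_poly_inner var_outer_def unital_hom_const_poly)

lemma shift_poly_0_iff: "shift_poly p = 0 \<longleftrightarrow> p = 0"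
  unfolding shift_poly_def
  by (rule pcompose_eq_0_iff) (simp add: var_outer_def var_inner_def)

lemma poly_incl_gens:
  "poly_incl [:[:c:]:] = fls_const (fls_const c)"
  "poly_incl [:[:0, 1:]:] = fls_const fls_X_inv"
  "poly_incl [:0, 1:] = fls_X"
  by (simp_all add: poly_incl_def map_poly_pCons)

text \<open>Taking \<open>coeff f 0\<close> sets \<open>v1\<close> to zero, a ring homomorphism that
  sends \<open>v1 + v2\<close> and \<open>v2\<close> to the same variable. Dong's lemma applies it
  to the shift of q(x_1,x_3) q(x_2,x_3), whose constant term in x_0 is thereby q(x_2,x_3)^2.\<close>

lemma coeff_0_ev2:
  "coeff (ev2 (v1 + v2) v3 q) 0 = q" "coeff (ev2 v2 v3 q) 0 = q"
proof -
  define g where "g = (\<lambda>f :: poly3. coeff f 0)"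
  have g: "unital_hom g"
    by (simp add: unital_hom_def g_def coeff_mult_0)
  have "g (ev2 y z q) = ev (ev (\<lambda>c. g (c3 c)) (g z)) (g y) q" for y z
  proof -
    have "g (ev2 y z q) = ev (\<lambda>p. g (ev c3 z p)) (g y) q"
      unfolding ev2_def by (rule ev_comp[OF hom_ev1 g])
    then show ?thesis
      by (simp only: ev_comp[OF unital_hom_c3 g, abs_def])
  qed
  moreover have "(\<lambda>c. g (c3 c)) = (\<lambda>c. [:[:c:]:])" "g (v1 + v2) = var_outer" "g v2 = var_outer" "g v3 = var_inner"
    by (simp_all add: g_def c3_def v1_def v2_def v3_def var_outer_def var_inner_def)
  ultimately show "coeff (ev2 (v1 + v2) v3 q) 0 = q" "coeff (ev2 v2 v3 q) 0 = q"
    using ev_id_poly by (simp_all add: g_def)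
qed

section \<open>Interchanging the variables, and restriction to the diagonal\<close>

definition swap_poly :: "complex poly poly \<Rightarrow> complex poly poly" where
  "swap_poly p = ev (ev (\<lambda>c. [:[:c:]:]) var_outer) var_inner p"

lemma swap_poly_hom: "unital_hom swap_poly"
  unfolding swap_poly_def[abs_def] by (intro unital_hom_ev hom_const2)

lemma swap_poly_vars:
  "swap_poly var_outer = var_inner" "swap_poly var_inner = var_outer" "swap_poly [:[:c:]:] = [:[:c:]:]"
  by (simp_all add: swap_poly_def var_inner_def var_outer_def ev_X ev_const unital_hom_ev[OF hom_const2] hom_const2)

lemma swap_poly_swap_poly: "swap_poly (swap_poly p) = p"
proof -
  have "swap_poly (swap_poly p) = ev (\<lambda>q. swap_poly (ev (\<lambda>c. [:[:c:]:]) var_outer q)) (swap_poly var_inner) p"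
    by (subst (2) swap_poly_def) (rule ev_comp[OF unital_hom_ev[OF hom_const2] swap_poly_hom])
  also have "(\<lambda>q. swap_poly (ev (\<lambda>c. [:[:c:]:]) var_outer q)) = ev (\<lambda>c. [:[:c:]:]) var_inner"
    by (rule ext) (simp only: ev_comp[OF hom_const2 swap_poly_hom] swap_poly_vars)
  finally show ?thesis
    by (simp only: swap_poly_vars ev_id_poly)
qed

text \<open>The factor x_1 - x_2 is linear in the outer variable with the inner one as root, so
  \<open>k\<close> is the multiplicity of that root, and \<open>poly p' [:0, 1:]\<close> is
  p'(x,x).\<close>

lemma factor_diagonal:
  assumes "p \<noteq> 0"
  obtains k p' where "p = (var_outer - var_inner) ^ k * p'" "poly p' [:0, 1:] \<noteq> 0"
proof -
  obtain p' where p': "p = [:- [:0, 1:], 1:] ^ order [:0, 1:] p * p'" "\<not> [:- [:0, 1:], 1:] dvd p'"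
    using order_decomp[OF assms, of "[:0, 1:]"] by blast
  have "poly p' [:0, 1:] \<noteq> 0"
    using p'(2) by (simp only: poly_eq_0_iff_dvd not_False_eq_True)
  moreover have "[:- [:0, 1:], 1:] = var_outer - var_inner"
    by (simp add: var_outer_def var_inner_def)
  ultimately show thesis
    using p'(1) that by simp
qed

definition const12 :: "poly3 \<Rightarrow> complex poly" where
  "const12 f = coeff (coeff f 0) 0"

lemma const12_hom: "const12 (f * g) = const12 f * const12 g"
  by (simp add: const12_def coeff_mult_0)

text \<open>Setting \<open>v1\<close> and \<open>v2\<close> to zero sends both arguments to the
  remaining variable x, so the shifted polynomial becomes p(x,x). Together with
  \<open>factor_diagonal\<close> this supplies the nonzero constant term that
  \<open>DF_cancel\<close> asks for.\<close>

lemma const12_ev2: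
  assumes "const12 y = [:0, 1:]" "const12 z = [:0, 1:]"
  shows "const12 (ev2 y z p) = poly p [:0, 1:]"
proof -
  have hom: "unital_hom const12"
    by (simp add: unital_hom_def const12_def coeff_mult_0)
  have "const12 (ev2 y z p) = ev (\<lambda>q. const12 (ev c3 z q)) [:0, 1:] p"
    unfolding ev2_def assms(1)[symmetric] by (rule ev_comp[OF hom_ev1 hom])
  also have "(\<lambda>q. const12 (ev c3 z q)) = (\<lambda>q. q)"
  proof
    fix q
    have "const12 (ev c3 z q) = ev (\<lambda>c. const12 (c3 c)) [:0, 1:] q"
      unfolding assms(2)[symmetric] by (rule ev_comp[OF unital_hom_c3 hom])
    also have "(\<lambda>c. const12 (c3 c)) = (\<lambda>c. [:c:])"
      by (simp add: const12_def c3_def)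
    also have "ev (\<lambda>c. [:c:]) [:0, 1:] q = q"
      by (induction q) (simp_all add: ev_0 ev_pCons unital_hom_const_poly)
    finally show "const12 (ev c3 z q) = q" .
  qed
  also have "ev (\<lambda>q. q) [:0, 1:] p = poly p [:0, 1:]"
    by (simp add: ev_def map_poly_id[unfolded id_def])
  finally show ?thesis .
qed

lemma const12_vars: "const12 (v1 + v3) = [:0, 1:]" "const12 (v2 + v3) = [:0, 1:]" "const12 v3 = [:0, 1:]"
  "const12 (v1 + v2 + v3) = [:0, 1:]"
  by (simp_all add: const12_def v1_def v2_def v3_def)

subsection \<open>Binomial coefficients\<close>

lemma gbinomial_zero_of_int: "0 \<le> i \<Longrightarrow> i < int k \<Longrightarrow> (of_int i :: complex) gchoose k = 0"
proof -
  assume "0 \<le> i" "i < int k"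
  then obtain j where "i = int j" "j < k"
    by (metis zero_le_imp_eq_int of_nat_less_iff)
  then show ?thesis
    by (simp add: binomial_gbinomial[symmetric])
qed

text \<open>Trinomial revision followed by Vandermonde. Both sides are the coefficient of t^m z^n in
  (1 + t + z)^x (1 + z)^y: on the left the powers of t + z are expanded last, on the right t is
  split off first.\<close>

lemma gbinomial_chain:
  "(\<Sum>k\<le>n. (of_nat (m + k) gchoose k) * ((x gchoose (m + k)) * (y gchoose (n - k)))) =
    (x gchoose m) * ((x + y - of_nat m :: complex) gchoose n)"
proof -
  have *: "(of_nat (m + k) gchoose k) * (x gchoose (m + k)) = (x gchoose m) * ((x - of_nat m) gchoose k)" for k
  proof -
    have "(of_nat (m + k) gchoose k) = (of_nat (m + k) gchoose m :: complex)"
      by (simp add: binomial_gbinomial[symmetric] binomial_symmetric[of m "m + k"] del: of_nat_add)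
    then show ?thesis
      using gbinomial_trinomial_revision[of m "m + k" x] by (simp add: mult.commute)
  qed
  have "(\<Sum>k\<le>n. (of_nat (m + k) gchoose k) * ((x gchoose (m + k)) * (y gchoose (n - k)))) =
      (\<Sum>k\<in>{0..n}. (x gchoose m) * (((x - of_nat m) gchoose k) * (y gchoose (n - k))))"
    unfolding mult.assoc[symmetric] * atMost_atLeast0 ..
  also have "\<dots> = (x gchoose m) * ((x - of_nat m + y) gchoose n)"
    by (simp only: sum_distrib_left[symmetric] gbinomial_Vandermonde)
  finally show ?thesis
    by (simp add: algebra_simps)
qed

lemma ex_uniform_bound:
  assumes "finite J" and mono: "\<And>j N N' :: int. P j N \<Longrightarrow> N \<le> N' \<Longrightarrow> P j N'" and "\<And>j. j \<in> J \<Longrightarrow> \<exists>N. P j N"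
  shows "\<exists>N. \<forall>j\<in>J. P j N"
  using assms(1,3)
proof (induction J)
  case (insert j J)
  have "\<exists>N. \<forall>j\<in>J. P j N"
    by (rule insert.IH) (rule insert.prems, simp)
  then obtain N where N: "\<forall>j\<in>J. P j N" ..
  have "\<exists>N. P j N"
    by (rule insert.prems) simp
  then obtain N' where N': "P j N'" ..
  show ?case
  proof (intro exI ballI)
    fix i assume "i \<in> insert j J"
    then show "P i (max N N')"
      using N N' mono[of i N "max N N'"] mono[of j N' "max N N'"] by fastforce
  qed
qed simp

section \<open>Operator-valued series\<close>

locale wspace = vector_space s for s :: "complex \<Rightarrow> 'w::ab_group_add \<Rightarrow> 'w"
begin

abbreviation lin :: "('w \<Rightarrow> 'w) \<Rightarrow> bool" where
  "lin \<equiv> Vector_Spaces.linear s s"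

abbreviation sc :: "complex \<Rightarrow> ('w \<Rightarrow> 'w) \<Rightarrow> 'w \<Rightarrow> 'w" where
  "sc \<equiv> fscale s"

abbreviation act1 :: "complex poly \<Rightarrow> (int \<Rightarrow> 'w \<Rightarrow> 'w) \<Rightarrow> int \<Rightarrow> 'w \<Rightarrow> 'w" where
  "act1 \<equiv> pact sc"

abbreviation act2 :: "complex poly poly \<Rightarrow> (int \<Rightarrow> int \<Rightarrow> 'w \<Rightarrow> 'w) \<Rightarrow> int \<Rightarrow> int \<Rightarrow> 'w \<Rightarrow> 'w" where
  "act2 \<equiv> poly_times sc"

lemma module_sc: "module sc"
  by (rule module_fscale) unfold_locales

sublocale m0: module sc
  by (rule module_sc)

sublocale m1: module act1
  by (rule m0.module_pact)

sublocale m2: module act2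
  unfolding poly_times_pact by (rule m0.module_pact2)

sublocale m3: module "act3 sc"
  by (rule m0.module_pact3)

lemma act2_gens:
  "act2 [:[:c:]:] A = (\<lambda>m n. sc c (A m n))"
  "act2 [:[:0, 1:]:] A = (\<lambda>m n. A m (n - 1))"
  "act2 [:0, 1:] A = (\<lambda>m n. A (m - 1) n)"
  unfolding poly_times_pact by (rule pact_gens[OF module_sc])+

lemma act2_vars:
  "act2 var_inner A = (\<lambda>m n. A m (n - 1))"
  "act2 var_outer A = (\<lambda>m n. A (m - 1) n)"
  unfolding var_inner_def var_outer_def by (rule act2_gens)+

lemmas act3_gens = pact_gens(4-7)[OF module_sc]

lemma lin_iff: "lin f \<longleftrightarrow> (\<forall>x y. f (x + y) = f x + f y) \<and> (\<forall>c x. f (s c x) = s c (f x))"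
  using vector_space_axioms by (simp add: Vector_Spaces.linear_iff)

lemma lin_0: "lin f \<Longrightarrow> f 0 = 0"
  unfolding lin_iff by (metis add_cancel_right_right)

lemma lin_sum: "lin f \<Longrightarrow> f (\<Sum>i\<in>I. g i) = (\<Sum>i\<in>I. f (g i))"
  by (induction I rule: infinite_finite_induct) (auto simp: lin_0 lin_iff)

lemma lin_closed:
  "lin 0" "lin id" "lin f \<Longrightarrow> lin g \<Longrightarrow> lin (f + g)" "lin f \<Longrightarrow> lin (sc c f)" "lin f \<Longrightarrow> lin g \<Longrightarrow> lin (f \<circ> g)"
  by (auto simp: lin_iff fscale_def scale_right_distrib scale_left_commute algebra_simps)

lemma lin_sum_closed: "(\<And>i. i \<in> I \<Longrightarrow> lin (f i)) \<Longrightarrow> lin (\<Sum>i\<in>I. f i)"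
  by (induction I rule: infinite_finite_induct) (auto simp: lin_closed)

lemma act2_closed:
  assumes "\<And>A B. A \<in> N \<Longrightarrow> B \<in> N \<Longrightarrow> A + B \<in> N"
    and "\<And>c A. A \<in> N \<Longrightarrow> (\<lambda>m n. sc c (A m n)) \<in> N"
    and "\<And>A. A \<in> N \<Longrightarrow> (\<lambda>m n. A m (n - 1)) \<in> N"
    and "\<And>A. A \<in> N \<Longrightarrow> (\<lambda>m n. A (m - 1) n) \<in> N"
    and "A \<in> N"
  shows "act2 p A \<in> N"
proof -
  have "act2 p A \<in> N \<and> id (act2 p A) = act2 (ev (ev (\<lambda>c. [:[:c:]:]) [:[:0, 1:]:]) [:0, 1:] p) (id A)"
    by (intro intertwine2[OF m2.module_axioms m2.module_axioms hom_const2, where N = N and \<Phi> = id])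
      (use assms in \<open>simp_all only: act2_gens id_apply\<close>)
  then show ?thesis by blast
qed

section \<open>\<open>Hom2\<close> and \<open>Eo\<close> under sums, scalars and shifts;
  torsion-freeness of \<open>Eo\<close>\<close>

definition bounded2 :: "(int \<Rightarrow> int \<Rightarrow> 'w \<Rightarrow> 'w) \<Rightarrow> 'w \<Rightarrow> int \<Rightarrow> bool" where
  "bounded2 A w N \<longleftrightarrow> (\<forall>m n. m > N \<or> n > N \<longrightarrow> A m n w = 0)"

lemma Hom2_iff: "A \<in> Hom2 s \<longleftrightarrow> (\<forall>m n. lin (A m n)) \<and> (\<forall>w. \<exists>N. bounded2 A w N)"
  by (simp add: Hom2_def bounded2_def)

lemma bounded2_mono: "bounded2 A w N \<Longrightarrow> N \<le> N' \<Longrightarrow> bounded2 A w N'"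
  by (auto simp: bounded2_def)

lemma Hom2_add: "A \<in> Hom2 s \<Longrightarrow> B \<in> Hom2 s \<Longrightarrow> A + B \<in> Hom2 s"
proof -
  assume A: "A \<in> Hom2 s" and B: "B \<in> Hom2 s"
  have "\<exists>N. bounded2 (A + B) w N" for w
  proof -
    obtain N N' where "bounded2 A w N" "bounded2 B w N'"
      using A B unfolding Hom2_iff by meson
    then have "bounded2 (A + B) w (max N N')"
      by (auto simp: bounded2_def)
    then show ?thesis ..
  qed
  then show ?thesis
    using A B by (simp add: Hom2_iff lin_closed)
qed

lemma Hom2_scale: "A \<in> Hom2 s \<Longrightarrow> (\<lambda>m n. sc c (A m n)) \<in> Hom2 s"
  by (auto simp: Hom2_iff lin_closed bounded2_def fscale_def intro: lin_closed(4)[unfolded fscale_def])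
    (metis scale_zero_right)

lemma Hom2_inner: "A \<in> Hom2 s \<Longrightarrow> (\<lambda>m n. A m (n - 1)) \<in> Hom2 s"
proof -
  assume A: "A \<in> Hom2 s"
  have "\<exists>N. bounded2 (\<lambda>m n. A m (n - 1)) w N" for w
  proof -
    obtain N where "bounded2 A w N"
      using A unfolding Hom2_iff by meson
    then have "bounded2 (\<lambda>m n. A m (n - 1)) w (N + 1)"
      by (auto simp: bounded2_def)
    then show ?thesis ..
  qed
  then show ?thesis
    using A by (simp add: Hom2_iff)
qed

lemma Hom2_outer: "A \<in> Hom2 s \<Longrightarrow> (\<lambda>m n. A (m - 1) n) \<in> Hom2 s"
proof -
  assume A: "A \<in> Hom2 s"
  have "\<exists>N. bounded2 (\<lambda>m n. A (m - 1) n) w N" for w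
  proof -
    obtain N where "bounded2 A w N"
      using A unfolding Hom2_iff by meson
    then have "bounded2 (\<lambda>m n. A (m - 1) n) w (N + 1)"
      by (auto simp: bounded2_def)
    then show ?thesis ..
  qed
  then show ?thesis
    using A by (simp add: Hom2_iff)
qed

lemma Hom2_act2: "A \<in> Hom2 s \<Longrightarrow> act2 p A \<in> Hom2 s"
  by (rule act2_closed) (auto intro: Hom2_add Hom2_scale Hom2_inner Hom2_outer)

lemma Hom2_0: "0 \<in> Hom2 s"
  by (simp add: Hom2_def lin_closed)

lemma Eo_iff: "a \<in> Eo s \<longleftrightarrow> (\<forall>n. lin (a n)) \<and> (\<forall>w. \<exists>N. \<forall>n>N. a n w = 0)"
  by (simp add: Eo_def)

lemma Eo_add: "a \<in> Eo s \<Longrightarrow> b \<in> Eo s \<Longrightarrow> a + b \<in> Eo s"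
proof -
  assume a: "a \<in> Eo s" and b: "b \<in> Eo s"
  have "\<exists>N. \<forall>n>N. (a + b) n w = 0" for w
  proof -
    obtain N N' where "\<forall>n>N. a n w = 0" "\<forall>n>N'. b n w = 0"
      using a b unfolding Eo_iff by blast
    then have "\<forall>n>max N N'. (a + b) n w = 0"
      by simp
    then show ?thesis ..
  qed
  then show ?thesis
    using a b by (simp add: Eo_iff lin_closed)
qed

lemma Eo_scale: "a \<in> Eo s \<Longrightarrow> fscale sc c a \<in> Eo s"
  by (auto simp: Eo_iff fscale_def intro: lin_closed(4)[unfolded fscale_def]) (metis scale_zero_right)

lemma Eo_0: "0 \<in> Eo s"
  by (simp add: Eo_iff lin_closed)

lemma Eo_diff: "a \<in> Eo s \<Longrightarrow> b \<in> Eo s \<Longrightarrow> a - b \<in> Eo s"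
proof -
  assume "a \<in> Eo s" "b \<in> Eo s"
  then have "a + fscale sc (-1) b \<in> Eo s"
    by (intro Eo_add Eo_scale)
  also have "a + fscale sc (-1) b = a - b"
    by (simp add: fun_eq_iff fscale_def)
  finally show ?thesis .
qed

lemma Eo_shift: "a \<in> Eo s \<Longrightarrow> (\<lambda>n. a (n - 1)) \<in> Eo s"
proof -
  assume a: "a \<in> Eo s"
  have "\<exists>N. \<forall>n>N. a (n - 1) w = 0" for w
  proof -
    obtain N where "\<forall>n>N. a n w = 0"
      using a unfolding Eo_iff by blast
    then have "\<forall>n>N+1. a (n - 1) w = 0"
      by simp
    then show ?thesis ..
  qed
  then show ?thesis
    using a by (simp add: Eo_iff)
qed

text \<open>Compare the coefficients of the highest power of the variable.\<close>

lemma Eo_torsion_free: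
  assumes a: "a \<in> Eo s" and q: "q \<noteq> 0" and 0: "act1 q a = 0"
  shows "a = 0"
proof (intro ext, rule ccontr)
  fix n w
  assume n: "a n w \<noteq> (0 :: int \<Rightarrow> 'w \<Rightarrow> 'w) n w"
  obtain N where N: "\<forall>n>N. a n w = 0"
    using a unfolding Eo_iff by blast
  define k where "k = Max {k \<in> {n..N}. a k w \<noteq> 0}"
  have fin: "finite {k \<in> {n..N}. a k w \<noteq> 0}" "n \<in> {k \<in> {n..N}. a k w \<noteq> 0}"
    using n N by (auto intro: finite_subset[of _ "{n..N}"] simp: not_le[symmetric])
  have k: "k \<in> {k \<in> {n..N}. a k w \<noteq> 0}"
    unfolding k_def using fin by (intro Max_in) auto
  have gt: "a i w = 0" if "i > k" for i
  proof (rule ccontr)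
    assume "a i w \<noteq> 0"
    with that k N have "i \<in> {k \<in> {n..N}. a k w \<noteq> 0}"
      by (auto simp: not_le[symmetric])
    then have "i \<le> k"
      unfolding k_def using fin by (intro Max_ge) auto
    with that show False by simp
  qed
  have "act1 q a (k + int (degree q)) w = (\<Sum>i\<le>degree q. s (coeff q i) (a (k + int (degree q) - int i) w))"
    by (simp add: pact_def sum_fun_apply fscale_def)
  also have "\<dots> = (\<Sum>i\<in>{degree q}. s (coeff q i) (a (k + int (degree q) - int i) w))"
    by (intro sum.mono_neutral_right) (auto simp: gt)
  finally have "s (lead_coeff q) (a k w) = 0"
    using 0 by simp
  then show False
    using k q by simp
qed

subsection \<open>The substitution\<close>

lemma deriv1_power: "(deriv1 sc ^^ k) A i j = sc (pochhammer (of_int i + 1) k) (A (i + int k) j)"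
proof (induction k arbitrary: i)
  case 0
  show ?case by (simp add: fscale_def)
next
  case (Suc k)
  have "(deriv1 sc ^^ Suc k) A i j = sc (of_int (i + 1)) ((deriv1 sc ^^ k) A (i + 1) j)"
    by (simp add: deriv1_def)
  also have "\<dots> = sc (pochhammer (of_int i + 1) (Suc k)) (A (i + int (Suc k)) j)"
    by (simp add: Suc pochhammer_rec algebra_simps fscale_def)
  finally show ?case .
qed

lemma subst_neg: "k < 0 \<Longrightarrow> subst_add s A k = 0"
  by (simp add: subst_add_def)

text \<open>The k-th Taylor coefficient of x_1^i is binom(i,k) x^(i-k). The Pochhammer factor of
  \<open>deriv1_power\<close> divided by k! is binom(i+k,k), indexed by the exponent after
  differentiation; reindexing makes \<open>i\<close> the exponent in \<open>A\<close>
  itself.\<close>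

lemma subst_eq_sum:
  assumes "finite I" and "\<And>i. i \<notin> I \<Longrightarrow> A i (n + int k - i) w = 0"
  shows "subst_add s A (int k) n w = (\<Sum>i\<in>I. s (of_int i gchoose k) (A i (n + int k - i) w))"
proof -
  have coef: "pochhammer (of_int i + 1) k / fact k = ((of_int (i + int k)) gchoose k :: complex)" for i
    by (simp add: gbinomial_pochhammer' algebra_simps)
  have "subst_add s A (int k) n w =
    Sum_any (\<lambda>i. s (1 / fact k) (s (pochhammer (of_int i + 1) k) (A (i + int k) (n - i) w)))"
    by (simp add: subst_add_def diagonal_def deriv1_power fscale_def)
  also have "\<dots> = Sum_any (\<lambda>i. s (of_int (i + int k) gchoose k) (A (i + int k) (n + int k - (i + int k)) w))"
    unfolding coef[symmetric] by simp
  also have "\<dots> = Sum_any (\<lambda>i. s (of_int i gchoose k) (A i (n + int k - i) w))"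
    by (rule Sum_any.reindex_cong[symmetric, of "\<lambda>i. i + int k"])
      (auto simp: fun_eq_iff intro: o_bij[of "\<lambda>i. i - int k"])
  also have "\<dots> = (\<Sum>i\<in>I. s (of_int i gchoose k) (A i (n + int k - i) w))"
    by (rule Sum_any.expand_superset) (use assms in auto)
  finally show ?thesis .
qed

text \<open>The lower end \<open>L\<close> is left free below the sharp value so that sums for
  shifted series can share one index range.\<close>

lemma subst_formula:
  assumes "bounded2 A w N" and "L \<le> n + int k - N"
  shows "subst_add s A (int k) n w = (\<Sum>i\<in>{L..N}. s (of_int i gchoose k) (A i (n + int k - i) w))"
proof (rule subst_eq_sum)
  fix i assume "i \<notin> {L..N}"
  then have "i > N \<or> n + int k - i > N"
    using assms(2) by auto
  then show "A i (n + int k - i) w = 0"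
    using assms(1) unfolding bounded2_def by blast
qed simp

text \<open>The two exponents in \<open>A\<close> add up to n + k, so one of them exceeds
  \<open>N\<close> as soon as n + k > 2N.\<close>

lemma bounded2_subst:
  assumes "bounded2 A w N" "n > 2 * N - k"
  shows "subst_add s A k n w = 0"
proof (cases "k < 0")
  case False
  then obtain k' where k': "k = int k'"
    by (metis not_less zero_le_imp_eq_int)
  have "subst_add s A (int k') n w = (\<Sum>i\<in>{n+k-N..N}. s (of_int i gchoose k') (A i (n + int k' - i) w))"
    by (rule subst_formula) (use assms k' in auto)
  also have "{n+k-N..N} = {}"
    using assms(2) by simp
  finally show ?thesis by (simp add: k')
qed (simp add: subst_neg)

lemma lin_subst:
  assumes "A \<in> Hom2 s"
  shows "lin (subst_add s A k n)"
proof (cases "k < 0")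
  case True
  then show ?thesis by (simp add: subst_neg lin_closed)
next
  case False
  then obtain k' where k': "k = int k'"
    by (metis not_less zero_le_imp_eq_int)
  have lA: "lin (A i j)" for i j
    using assms by (simp add: Hom2_iff)
  show ?thesis
    unfolding lin_iff
  proof (intro conjI allI)
    fix x y
    obtain N1 N2 N3 where N: "bounded2 A x N1" "bounded2 A y N2" "bounded2 A (x + y) N3"
      using assms unfolding Hom2_iff by meson
    define N where "N = max N1 (max N2 N3)"
    have "bounded2 A x N" "bounded2 A y N" "bounded2 A (x + y) N"
      using N by (auto simp: N_def intro: bounded2_mono)
    note f = this[THEN subst_formula, OF order_refl, where n = n and k = k']
    show "subst_add s A k n (x + y) = subst_add s A k n x + subst_add s A k n y"
      unfolding k' f using lA by (simp add: lin_iff scale_right_distrib sum.distrib)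
  next
    fix c x
    obtain N1 N2 where N: "bounded2 A x N1" "bounded2 A (s c x) N2"
      using assms unfolding Hom2_iff by meson
    define N where "N = max N1 N2"
    have "bounded2 A x N" "bounded2 A (s c x) N"
      using N by (auto simp: N_def intro: bounded2_mono)
    note f = this[THEN subst_formula, OF order_refl, where n = n and k = k']
    show "subst_add s A k n (s c x) = s c (subst_add s A k n x)"
      unfolding k' f using lA by (simp add: lin_iff scale_sum_right scale_left_commute mult.commute)
  qed
qed

text \<open>This is Eo((x_0)) with x_0 at the first index: the lower bound \<open>M\<close> does not
  depend on the vector, whereas the upper bounds inside \<open>Eo\<close> do.\<close>

definition LEo :: "(int \<Rightarrow> int \<Rightarrow> 'w \<Rightarrow> 'w) set" where
  "LEo = {B. (\<forall>k. B k \<in> Eo s) \<and> (\<exists>M. \<forall>k<M. B k = 0)}"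

lemma LEo_I: "(\<And>k. B k \<in> Eo s) \<Longrightarrow> (\<And>k. k < M \<Longrightarrow> B k = 0) \<Longrightarrow> B \<in> LEo"
  by (auto simp: LEo_def)

lemma LEo_D: "B \<in> LEo \<Longrightarrow> B k \<in> Eo s" "B \<in> LEo \<Longrightarrow> \<exists>M. \<forall>k<M. B k = 0"
  by (auto simp: LEo_def)

lemma subst_LEo: "A \<in> Hom2 s \<Longrightarrow> subst_add s A \<in> LEo"
proof (rule LEo_I[where M = 0])
  fix k assume A: "A \<in> Hom2 s"
  have "\<exists>N. \<forall>n>N. subst_add s A k n w = 0" for w
    using A bounded2_subst[of A w] unfolding Hom2_iff by meson
  then show "subst_add s A k \<in> Eo s"
    using lin_subst[OF A] by (simp add: Eo_iff)
qed (simp add: subst_neg)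

lemma subst_add_add:
  assumes "A \<in> Hom2 s" "B \<in> Hom2 s"
  shows "subst_add s (A + B) = subst_add s A + subst_add s B"
proof (intro ext)
  fix k n w
  obtain N1 N2 where N: "bounded2 A w N1" "bounded2 B w N2"
    using assms unfolding Hom2_iff by meson
  define N where "N = max N1 N2"
  have A: "bounded2 A w N" and B: "bounded2 B w N"
    using N by (auto simp: N_def intro: bounded2_mono)
  then have AB: "bounded2 (A + B) w N"
    by (auto simp: bounded2_def)
  show "subst_add s (A + B) k n w = (subst_add s A + subst_add s B) k n w"
  proof (cases "k < 0")
    case False
    then obtain k' where k': "k = int k'"
      by (metis not_less zero_le_imp_eq_int)
    show ?thesis
      using subst_formula[OF A order_refl, where n = n and k = k'] subst_formula[OF B order_refl, where n = n and k = k']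
        subst_formula[OF AB order_refl, where n = n and k = k'] k'
      by (simp add: scale_right_distrib sum.distrib)
  qed (simp add: subst_neg)
qed

lemma subst_scale:
  assumes "A \<in> Hom2 s"
  shows "subst_add s (\<lambda>m n. sc c (A m n)) = (\<lambda>m n. sc c (subst_add s A m n))"
proof (intro ext)
  fix k n w
  obtain N where A: "bounded2 A w N"
    using assms unfolding Hom2_iff by meson
  then have AB: "bounded2 (\<lambda>m n. sc c (A m n)) w N"
    by (auto simp: bounded2_def fscale_def)
  show "subst_add s (\<lambda>m n. sc c (A m n)) k n w = sc c (subst_add s A k n) w"
  proof (cases "k < 0")
    case False
    then obtain k' where k': "k = int k'"
      by (metis not_less zero_le_imp_eq_int)
    show ?thesis
      using subst_formula[OF A order_refl, where n = n and k = k'] subst_formula[OF AB order_refl, where n = n and k = k'] k'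
      by (simp add: fscale_def scale_sum_right mult.commute)
  qed (simp add: subst_neg fscale_def)
qed

lemma subst_inner:
  assumes "A \<in> Hom2 s"
  shows "subst_add s (\<lambda>m n. A m (n - 1)) = (\<lambda>m n. subst_add s A m (n - 1))"
proof (intro ext)
  fix k n w
  obtain N where N: "bounded2 A w N"
    using assms unfolding Hom2_iff by meson
  have A: "bounded2 A w (N + 1)" and AB: "bounded2 (\<lambda>m n. A m (n - 1)) w (N + 1)"
    using N by (auto simp: bounded2_def)
  show "subst_add s (\<lambda>m n. A m (n - 1)) k n w = subst_add s A k (n - 1) w"
  proof (cases "k < 0")
    case False
    then obtain k' where k': "k = int k'"
      by (metis not_less zero_le_imp_eq_int)
    show ?thesis
      using subst_formula[OF A, where L = "n + k - (N + 1) - 1" and n = "n - 1" and k = k']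
        subst_formula[OF AB, where L = "n + k - (N + 1) - 1" and n = n and k = k'] k'
      by (simp add: algebra_simps)
  qed (simp add: subst_neg)
qed

text \<open>Pascal's rule for binom(i+1,k) splits the factor x_1 into x_0 + x.\<close>

lemma subst_outer:
  assumes "A \<in> Hom2 s"
  shows "subst_add s (\<lambda>m n. A (m - 1) n) =
    (\<lambda>m n. subst_add s A (m - 1) n) + (\<lambda>m n. subst_add s A m (n - 1))"
proof (intro ext)
  fix k n w
  obtain N where N: "bounded2 A w N"
    using assms unfolding Hom2_iff by meson
  have A: "bounded2 A w N" and AB: "bounded2 (\<lambda>m n. A (m - 1) n) w (N + 1)"
    using N by (auto simp: bounded2_def)
  show "subst_add s (\<lambda>m n. A (m - 1) n) k n w =
      ((\<lambda>m n. subst_add s A (m - 1) n) + (\<lambda>m n. subst_add s A m (n - 1))) k n w"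
  proof (cases "k < 0")
    case False
    then obtain k' where k': "k = int k'"
      by (metis not_less zero_le_imp_eq_int)
    \<comment> \<open>The largest lower end that \<open>subst_formula\<close> accepts for all three
      sums, whose ranges differ by shifts of one.\<close>
    define L where "L = n + k - N - 2"
    have "subst_add s (\<lambda>m n. A (m - 1) n) k n w =
        (\<Sum>i\<in>{L+1..N+1}. s (of_int i gchoose k') (A (i - 1) (n + int k' - i) w))"
      unfolding k' by (rule subst_formula[OF AB]) (simp add: L_def k')
    also have "\<dots> = (\<Sum>i\<in>{L..N}. s (of_int (i + 1) gchoose k') (A i (n + int k' - 1 - i) w))"
      by (rule sum.reindex_bij_witness[where j = "\<lambda>i. i - 1" and i = "\<lambda>i. i + 1"]) (auto simp: algebra_simps)
    finally have 1: "subst_add s (\<lambda>m n. A (m - 1) n) k n w = \<dots>" .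
    have 2: "subst_add s A k (n - 1) w = (\<Sum>i\<in>{L..N}. s (of_int i gchoose k') (A i (n - 1 + int k' - i) w))"
      unfolding k' by (rule subst_formula[OF A]) (simp add: L_def k')
    show ?thesis
    proof (cases k')
      case 0
      with 1 2 show ?thesis by (simp add: k' subst_neg algebra_simps)
    next
      case (Suc j)
      have "k - 1 = int j"
        by (simp add: k' Suc)
      then have 3: "subst_add s A (k - 1) n w = (\<Sum>i\<in>{L..N}. s (of_int i gchoose j) (A i (n + int j - i) w))"
        by (simp, intro subst_formula[OF A]) (simp add: L_def k')
      have 4: "n + int j - i = n - 1 + int k' - i" "n + int k' - 1 - i = n - 1 + int k' - i" for i
        by (simp_all add: Suc)
      show ?thesis
        unfolding plus_fun_apply 1 2 3 4 sum.distrib[symmetric]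
        by (simp add: Suc gbinomial_Suc_Suc scale_left_distrib)
    qed
  qed (simp add: subst_neg)
qed

lemma subst_act2:
  assumes "A \<in> Hom2 s"
  shows "subst_add s (act2 p A) = act2 (shift_poly p) (subst_add s A)"
proof -
  have "act2 p A \<in> Hom2 s \<and> subst_add s (act2 p A) =
      act2 (ev (ev (\<lambda>c. [:[:c:]:]) var_inner) (var_outer + var_inner) p) (subst_add s A)"
    by (intro intertwine2[OF m2.module_axioms m2.module_axioms hom_const2, where N = "Hom2 s" and \<Phi> = "subst_add s"])
      (use assms in \<open>simp_all only: act2_gens act2_vars m2.scale_left_distrib Hom2_add Hom2_scale
        Hom2_inner Hom2_outer subst_add_add subst_scale subst_inner subst_outer add.commute\<close>)
  then show ?thesis
    by (simp add: ev_shift_poly)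
qed

subsection \<open>The action of \<open>\<complex>((x\<^sup>-\<^sup>1))((x\<^sub>0))\<close>\<close>

abbreviation fterm :: "complex fls fls \<Rightarrow> (int \<Rightarrow> int \<Rightarrow> 'w \<Rightarrow> 'w) \<Rightarrow> int \<Rightarrow> int \<Rightarrow> 'w \<Rightarrow> int \<times> int \<Rightarrow> 'w" where
  "fterm F B m n w \<equiv> (\<lambda>(k, l). s (fls_nth (fls_nth F k) (- l)) (B (m - k) (n - l) w))"

text \<open>Only \<open>k\<close> between the subdegree of \<open>F\<close> and m - M matter,
  finitely many; for each of them \<open>l\<close> is bounded above by the pole order of the inner
  Laurent series, and n - l by the bound of \<open>B (m - k)\<close> at \<open>w\<close>. The
  resulting \<open>N\<close> is uniform in \<open>n\<close>, which is what puts the product back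
  into \<open>Eo\<close>.\<close>

lemma fterm_support:
  assumes "B \<in> LEo"
  shows "\<exists>N. \<forall>n k l. fterm F B m n w (k, l) \<noteq> 0 \<longrightarrow> n - N \<le> l \<and> l \<le> N"
    and "finite {x. fterm F B m n w x \<noteq> 0}"
proof -
  obtain M where M: "\<forall>k<M. B k = 0"
    using LEo_D(2)[OF assms] by blast
  define K where "K = {fls_subdegree F..m - M}"
  have "\<exists>N. \<forall>k\<in>K. (\<forall>n>N. B (m - k) n w = 0) \<and> (\<forall>i. i < - N \<longrightarrow> fls_nth (fls_nth F k) i = 0)"
  proof (rule ex_uniform_bound)
    fix k
    obtain N where N: "\<forall>n>N. B (m - k) n w = 0"
      using LEo_D(1)[OF assms, of "m - k"] unfolding Eo_iff by blast
    then have "(\<forall>n>max N (- fls_subdegree (fls_nth F k)). B (m - k) n w = 0) \<and>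
        (\<forall>i. i < - max N (- fls_subdegree (fls_nth F k)) \<longrightarrow> fls_nth (fls_nth F k) i = 0)"
      by (auto intro: fls_eq0_below_subdegree)
    then show "\<exists>N. (\<forall>n>N. B (m - k) n w = 0) \<and> (\<forall>i. i < - N \<longrightarrow> fls_nth (fls_nth F k) i = 0)" ..
  qed (auto simp: K_def)
  then obtain N where N: "\<And>k n. k \<in> K \<Longrightarrow> n > N \<Longrightarrow> B (m - k) n w = 0"
    "\<And>k i. k \<in> K \<Longrightarrow> i < - N \<Longrightarrow> fls_nth (fls_nth F k) i = 0"
    by blast
  have *: "k \<in> K \<and> n - N \<le> l \<and> l \<le> N" if "fterm F B m n w (k, l) \<noteq> 0" for n k l
  proof -
    have nz: "fls_nth (fls_nth F k) (- l) \<noteq> 0" "B (m - k) (n - l) w \<noteq> 0"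
      using that by auto
    then have "fls_nth F k \<noteq> 0" "B (m - k) \<noteq> 0"
      by auto
    then have K: "k \<in> K"
    proof -
      have "fls_subdegree F \<le> k"
        using \<open>fls_nth F k \<noteq> 0\<close> by (rule fls_subdegree_leI)
      moreover have "\<not> m - k < M"
        using M \<open>B (m - k) \<noteq> 0\<close> by blast
      ultimately show ?thesis
        by (simp add: K_def)
    qed
    show ?thesis
      using nz N(1)[OF K, of "n - l"] N(2)[OF K, of "- l"] K by force
  qed
  have "finite {x. fterm F B m n w x \<noteq> 0}" for n
  proof (rule finite_subset)
    show "{x. fterm F B m n w x \<noteq> 0} \<subseteq> K \<times> {n - N..N}"
    proof
      fix x assume x: "x \<in> {x. fterm F B m n w x \<noteq> 0}"
      obtain k l where "x = (k, l)" by fastforce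
      with x *[of n k l] show "x \<in> K \<times> {n - N..N}" by simp
    qed
  qed (simp add: K_def)
  then show "finite {x. fterm F B m n w x \<noteq> 0}" .
  from * show "\<exists>N. \<forall>n k l. fterm F B m n w (k, l) \<noteq> 0 \<longrightarrow> n - N \<le> l \<and> l \<le> N"
    by blast
qed

lemmas fterm_finite = fterm_support(2)

lemma fls_times_LEo:
  assumes "B \<in> LEo"
  shows "fls_times s F B \<in> LEo"
proof -
  obtain M where M: "\<forall>k<M. B k = 0"
    using LEo_D(2)[OF assms] by blast
  have lB: "lin (B k n)" for k n
    using LEo_D(1)[OF assms] by (simp add: Eo_iff)
  note fin = fterm_finite[OF assms]
  show ?thesis
  proof (rule LEo_I)
    fix m
    have "lin (fls_times s F B m n)" for n
      unfolding lin_iff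
    proof (intro conjI allI)
      fix x y
      have "fterm F B m n (x + y) = (\<lambda>p. fterm F B m n x p + fterm F B m n y p)"
        using lB by (auto simp: lin_iff scale_right_distrib)
      then show "fls_times s F B m n (x + y) = fls_times s F B m n x + fls_times s F B m n y"
        unfolding fls_times_def by (simp only: Sum_any.distrib[OF fin fin])
    next
      fix c x
      have "fterm F B m n (s c x) = (\<lambda>p. s c (fterm F B m n x p))"
        using lB by (auto simp: lin_iff mult.commute)
      moreover have "Sum_any (\<lambda>p. s c (fterm F B m n x p)) = s c (Sum_any (fterm F B m n x))"
      proof -
        have "Sum_any (\<lambda>p. s c (fterm F B m n x p)) = (\<Sum>p | fterm F B m n x p \<noteq> 0. s c (fterm F B m n x p))"
          by (rule Sum_any.expand_superset[OF fin[of F m n x]]) auto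
        then show ?thesis
          by (simp only: scale_sum_right[symmetric] Sum_any.expand_set)
      qed
      ultimately show "fls_times s F B m n (s c x) = s c (fls_times s F B m n x)"
        unfolding fls_times_def by (simp only:)
    qed
    moreover have "\<exists>N. \<forall>n>N. fls_times s F B m n w = 0" for w
    proof -
      obtain N where N: "\<forall>n k l. fterm F B m n w (k, l) \<noteq> 0 \<longrightarrow> n - N \<le> l \<and> l \<le> N"
        using fterm_support(1)[OF assms, of F m w] ..
      have "fls_times s F B m n w = 0" if "n > 2 * N" for n
      proof -
        have "fterm F B m n w = (\<lambda>x. 0)"
        proof
          fix x :: "int \<times> int"
          obtain k l where x: "x = (k, l)" by fastforce
          show "fterm F B m n w x = 0"
          proof (rule ccontr)
            assume "fterm F B m n w x \<noteq> 0"
            then have "n - N \<le> l \<and> l \<le> N"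
              using N unfolding x by blast
            with that show False by simp
          qed
        qed
        then show ?thesis
          unfolding fls_times_def by (simp only: Sum_any.neutral)
      qed
      then show ?thesis by blast
    qed
    ultimately show "fls_times s F B m \<in> Eo s"
      by (simp add: Eo_iff)
  next
    fix m assume m: "m < fls_subdegree F + M"
    show "fls_times s F B m = 0"
    proof (intro ext)
      fix n w
      have "fterm F B m n w = (\<lambda>x. 0)"
      proof
        fix x :: "int \<times> int"
        obtain k l where x: "x = (k, l)" by fastforce
        show "fterm F B m n w x = 0"
        proof (cases "k < fls_subdegree F")
          case True
          then show ?thesis by (simp add: x fls_eq0_below_subdegree)
        next
          case False
          then have "B (m - k) = 0"
            using M m by simp
          then show ?thesis by (simp add: x)
        qed
      qed
      then show "fls_times s F B m n w = (0 :: int \<Rightarrow> 'w \<Rightarrow> 'w) n w"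
        unfolding fls_times_def by (simp only: Sum_any.neutral zero_fun_apply)
    qed
  qed
qed

lemma fls_times_1: "fls_times s 1 B = B"
proof (intro ext)
  fix m n w
  have "fterm 1 B m n w = (\<lambda>x. if x = (0, 0) then B m n w else 0)"
    by (auto simp: fun_eq_iff)
  then show "fls_times s 1 B m n w = B m n w"
    unfolding fls_times_def by (simp only: Sum_any.delta)
qed

lemma fls_times_add:
  assumes "B \<in> LEo"
  shows "fls_times s (F + G) B = fls_times s F B + fls_times s G B"
proof (intro ext)
  fix m n w
  have "fterm (F + G) B m n w = (\<lambda>x. fterm F B m n w x + fterm G B m n w x)"
    by (auto simp: fun_eq_iff scale_left_distrib)
  then show "fls_times s (F + G) B m n w = (fls_times s F B + fls_times s G B) m n w"
    unfolding fls_times_def plus_fun_apply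
    by (simp only: Sum_any.distrib[OF fterm_finite[OF assms] fterm_finite[OF assms]])
qed

lemma fls_times_const:
  assumes "B \<in> LEo"
  shows "fls_times s (fls_const (fls_const c) * F) B = (\<lambda>m n. sc c (fls_times s F B m n))"
proof (intro ext)
  fix m n w
  note fin = fterm_finite[OF assms, of F m n w]
  have 1: "fterm (fls_const (fls_const c) * F) B m n w = (\<lambda>x. s c (fterm F B m n w x))"
    by (auto simp: fun_eq_iff)
  have "Sum_any (\<lambda>p. s c (fterm F B m n w p)) = (\<Sum>p | fterm F B m n w p \<noteq> 0. s c (fterm F B m n w p))"
    by (rule Sum_any.expand_superset[OF fin]) auto
  also have "\<dots> = s c (Sum_any (fterm F B m n w))"
    by (simp only: scale_sum_right[symmetric] Sum_any.expand_set)
  finally show "fls_times s (fls_const (fls_const c) * F) B m n w = sc c (fls_times s F B m n) w"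
    unfolding fls_times_def 1 fscale_def .
qed

lemma fls_times_inner: "fls_times s (fls_const fls_X_inv * F) B = (\<lambda>m n. fls_times s F B m (n - 1))"
proof (intro ext)
  fix m n w
  have "bij (\<lambda>(k :: int, l :: int). (k, l + 1))"
    by (rule o_bij[of "\<lambda>(k, l). (k, l - 1)"]) (auto simp: fun_eq_iff)
  moreover have "fterm (fls_const fls_X_inv * F) B m n w \<circ> (\<lambda>(k, l). (k, l + 1)) = fterm F B m (n - 1) w"
    by (auto simp: fun_eq_iff fls_X_inv_times_conv_shift algebra_simps)
  ultimately show "fls_times s (fls_const fls_X_inv * F) B m n w = fls_times s F B m (n - 1) w"
    unfolding fls_times_def by (rule Sum_any.reindex_cong)
qed

lemma fls_times_outer: "fls_times s (fls_X * F) B = (\<lambda>m n. fls_times s F B (m - 1) n)"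
proof (intro ext)
  fix m n w
  have "bij (\<lambda>(k :: int, l :: int). (k + 1, l))"
    by (rule o_bij[of "\<lambda>(k, l). (k - 1, l)"]) (auto simp: fun_eq_iff)
  moreover have "fterm (fls_X * F) B m n w \<circ> (\<lambda>(k, l). (k + 1, l)) = fterm F B (m - 1) n w"
    by (auto simp: fun_eq_iff fls_X_times_conv_shift algebra_simps)
  ultimately show "fls_times s (fls_X * F) B m n w = fls_times s F B (m - 1) n w"
    unfolding fls_times_def by (rule Sum_any.reindex_cong)
qed

text \<open>Here \<open>B\<close> is fixed and \<open>F\<close> varies, with polynomials acting on
  \<open>F\<close> through \<open>poly_incl\<close>. Checking generators then avoids expanding the
  product of two double series into a quadruple sum.\<close>

lemma act2_fls_times:
  assumes "B \<in> LEo"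
  shows "act2 p (fls_times s F B) = fls_times s (poly_incl p * F) B"
proof -
  have "module (\<lambda>p F. poly_incl p * F)"
    by unfold_locales (simp_all add: poly_incl_hom algebra_simps)
  then have "poly_incl p * F \<in> UNIV \<and> fls_times s (poly_incl p * F) B =
      act2 (ev (ev (\<lambda>c. [:[:c:]:]) var_inner) var_outer p) (fls_times s F B)"
    by (intro intertwine2[where N = UNIV and \<Phi> = "\<lambda>F. fls_times s F B" and ?\<psi>1.0 = "\<lambda>p F. poly_incl p * F"])
      (simp_all only: assms m2.module_axioms hom_const2 poly_incl_gens act2_gens act2_vars
        fls_times_add fls_times_const fls_times_inner fls_times_outer UNIV_I)
  then show ?thesis
    by (simp add: ev_id_poly)
qed

subsection \<open>The extension of the substitution to fractions\<close>

text \<open>Compare the coefficients of the lowest power of the first variable.\<close>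

lemma LEo_cancel:
  assumes B: "B \<in> LEo" and p: "p \<noteq> 0" and 0: "act2 p B = 0"
  shows "B = 0"
proof (rule ccontr)
  assume "B \<noteq> 0"
  then obtain m0 where m0: "B m0 \<noteq> 0"
    by (auto simp: fun_eq_iff)
  obtain M where M: "\<forall>k<M. B k = 0"
    using LEo_D(2)[OF B] by blast
  define m where "m = Min {m \<in> {M..m0}. B m \<noteq> 0}"
  have fin: "finite {m \<in> {M..m0}. B m \<noteq> 0}" "m0 \<in> {m \<in> {M..m0}. B m \<noteq> 0}"
    using m0 M by (auto intro: finite_subset[of _ "{M..m0}"] simp: not_le[symmetric])
  have m: "m \<in> {m \<in> {M..m0}. B m \<noteq> 0}"
    unfolding m_def using fin by (intro Min_in) auto
  have lt: "B i = 0" if "i < m" for i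
  proof (rule ccontr)
    assume "B i \<noteq> 0"
    with that m M have "i \<in> {m \<in> {M..m0}. B m \<noteq> 0}"
      by (auto simp: not_le[symmetric])
    then have "m \<le> i"
      unfolding m_def using fin by (intro Min_le) auto
    with that show False by simp
  qed
  define k where "k = (LEAST k. coeff p k \<noteq> 0)"
  have k: "coeff p k \<noteq> 0"
    unfolding k_def by (rule LeastI[of _ "degree p"]) (use p in simp)
  have k_le: "coeff p i = 0" if "i < k" for i
    using that not_less_Least[of i "\<lambda>k. coeff p k \<noteq> 0"] by (auto simp: k_def)
  have "act2 p B (m + int k) = (\<Sum>i\<le>degree p. act1 (coeff p i) (B (m + int k - int i)))"
    by (simp add: poly_times_pact pact_def fun_eq_iff)
  also have "\<dots> = (\<Sum>i\<in>{k}. act1 (coeff p i) (B (m + int k - int i)))"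
  proof (rule sum.mono_neutral_right)
    show "\<forall>i\<in>{..degree p} - {k}. act1 (coeff p i) (B (m + int k - int i)) = 0"
    proof
      fix i assume "i \<in> {..degree p} - {k}"
      then show "act1 (coeff p i) (B (m + int k - int i)) = 0"
        by (cases "i < k") (simp_all only: k_le m0.pact_0_left, simp add: lt m1.scale_zero_right)
    qed
  qed (use k le_degree in auto)
  finally have "act1 (coeff p k) (B m) = 0"
    using 0 by simp
  then have "B m = 0"
    using Eo_torsion_free[OF LEo_D(1)[OF B] k] by blast
  with m show False by simp
qed

lemma LEo_add: "A \<in> LEo \<Longrightarrow> B \<in> LEo \<Longrightarrow> A + B \<in> LEo"
proof -
  assume A: "A \<in> LEo" and B: "B \<in> LEo"
  obtain M M' where M: "\<forall>k<M. A k = 0" "\<forall>k<M'. B k = 0"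
    using LEo_D(2) A B by metis
  show ?thesis
    by (rule LEo_I[where M = "min M M'"]) (use A B M in \<open>simp_all only: plus_fun_apply LEo_D Eo_add, simp\<close>)
qed

lemma LEo_scale: "A \<in> LEo \<Longrightarrow> (\<lambda>m n. sc c (A m n)) \<in> LEo"
proof -
  assume A: "A \<in> LEo"
  obtain M where M: "\<forall>k<M. A k = 0"
    using LEo_D(2) A by metis
  have *: "(\<lambda>n. sc c (a n)) = fscale sc c a" for a :: "int \<Rightarrow> 'w \<Rightarrow> 'w"
    by (simp add: fscale_def)
  show ?thesis
  proof (rule LEo_I[where M = M])
    fix k
    show "(\<lambda>n. sc c (A k n)) \<in> Eo s"
      unfolding * by (intro Eo_scale LEo_D(1)[OF A])
    show "(\<lambda>n. sc c (A k n)) = 0" if "k < M"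
      using M that by (simp add: fscale_def fun_eq_iff)
  qed
qed

lemma LEo_act2: "A \<in> LEo \<Longrightarrow> act2 p A \<in> LEo"
proof (rule act2_closed[where N = LEo])
  fix A assume A: "A \<in> LEo"
  obtain M where M: "\<forall>k<M. A k = 0"
    using LEo_D(2) A by metis
  show "(\<lambda>m n. A m (n - 1)) \<in> LEo"
    by (rule LEo_I[where M = M]) (use M LEo_D(1)[OF A] in \<open>auto intro: Eo_shift simp: fun_eq_iff\<close>)
  have "(\<lambda>m. A (m - 1)) \<in> LEo"
    by (rule LEo_I[where M = "M + 1"]) (use M LEo_D(1)[OF A] in auto)
  then show "(\<lambda>m n. A (m - 1) n) \<in> LEo" .
qed (auto intro: LEo_add LEo_scale)

lemma LEo_diff: "A \<in> LEo \<Longrightarrow> B \<in> LEo \<Longrightarrow> A - B \<in> LEo"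
proof -
  assume "A \<in> LEo" "B \<in> LEo"
  then have "A + (\<lambda>m n. sc (-1) (B m n)) \<in> LEo"
    by (intro LEo_add LEo_scale)
  also have "A + (\<lambda>m n. sc (-1) (B m n)) = A - B"
    by (simp add: fun_eq_iff fscale_def)
  finally show ?thesis .
qed

definition QH :: "(int \<Rightarrow> int \<Rightarrow> 'w \<Rightarrow> 'w) set" where
  "QH = {A. \<exists>p. p \<noteq> 0 \<and> act2 p A \<in> Hom2 s}"

text \<open>For \<open>p A \<in> Hom2 s\<close> the series \<open>T A\<close> is \<open>(pA)(x + x\<^sub>0, x) / p(x + x\<^sub>0, x)\<close>. As a map
  of modules over the polynomials, \<open>T\<close> is the localization of the substitution.\<close>

definition T :: "(int \<Rightarrow> int \<Rightarrow> 'w \<Rightarrow> 'w) \<Rightarrow> int \<Rightarrow> int \<Rightarrow> 'w \<Rightarrow> 'w" where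
  "T A = (let p = SOME p. p \<noteq> 0 \<and> act2 p A \<in> Hom2 s in
     fls_times s (iota (1 / to_fract (shift_poly p))) (subst_add s (act2 p A)))"

lemma Y_Eo_T: "Y_Eo s a m b = T (prod2 a b) m"
  by (simp add: Y_Eo_def Y_Eo_with_def T_def Let_def)

lemma QH_I: "p \<noteq> 0 \<Longrightarrow> act2 p A \<in> Hom2 s \<Longrightarrow> A \<in> QH"
  by (auto simp: QH_def)

text \<open>The shifted \<open>p\<close> and its embedded inverse cancel because \<open>iota\<close>
  is a field embedding that extends \<open>poly_incl\<close>. This is the only place where
  \<open>iota\<close> is evaluated; from here on \<open>T\<close> is known through the equation it
  satisfies.\<close>

lemma T_basic:
  assumes "A \<in> QH"
  shows "T A \<in> LEo \<and> (\<exists>p. p \<noteq> 0 \<and> act2 p A \<in> Hom2 s \<and> act2 (shift_poly p) (T A) = subst_add s (act2 p A))"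
proof -
  define p where "p = (SOME p. p \<noteq> 0 \<and> act2 p A \<in> Hom2 s)"
  have p: "p \<noteq> 0 \<and> act2 p A \<in> Hom2 s"
    unfolding p_def by (rule someI_ex) (use assms in \<open>simp add: QH_def\<close>)
  have TA: "T A = fls_times s (iota (1 / to_fract (shift_poly p))) (subst_add s (act2 p A))"
    by (simp add: T_def p_def Let_def)
  have S: "subst_add s (act2 p A) \<in> LEo"
    using p by (intro subst_LEo) simp
  have "to_fract (shift_poly p) \<noteq> 0"
    using p by (simp add: shift_poly_0_iff)
  then have "poly_incl (shift_poly p) * iota (1 / to_fract (shift_poly p)) = 1"
    using iota_embedding unfolding iota_to_fract[symmetric] field_embedding_def
    by (metis nonzero_mult_div_cancel_left times_divide_eq_right mult.right_neutral)
  then have "act2 (shift_poly p) (T A) = subst_add s (act2 p A)"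
    unfolding TA act2_fls_times[OF S] by (simp only: fls_times_1)
  with p S show ?thesis
    unfolding TA by (auto intro: fls_times_LEo)
qed

lemma T_LEo: "A \<in> QH \<Longrightarrow> T A \<in> LEo"
  using T_basic by blast

text \<open>Independence of the chosen polynomial: both sides agree after multiplication by the
  shift of the chosen \<open>p\<close>, because \<open>p\<close> and \<open>q\<close> commute, and
  \<open>LEo\<close> is torsion-free.\<close>

lemma T_spec:
  assumes A: "A \<in> QH" and q: "act2 q A \<in> Hom2 s"
  shows "act2 (shift_poly q) (T A) = subst_add s (act2 q A)"
proof -
  obtain p where p: "p \<noteq> 0" "act2 p A \<in> Hom2 s" "act2 (shift_poly p) (T A) = subst_add s (act2 p A)"
    using T_basic[OF A] by blast
  define D where "D = act2 (shift_poly q) (T A) - subst_add s (act2 q A)"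
  have "act2 (shift_poly p) (act2 (shift_poly q) (T A)) = act2 (shift_poly q) (subst_add s (act2 p A))"
    by (metis p(3) m2.scale_left_commute)
  also have "\<dots> = subst_add s (act2 q (act2 p A))"
    by (rule subst_act2[OF p(2), symmetric])
  also have "\<dots> = subst_add s (act2 p (act2 q A))"
    by (simp only: m2.scale_left_commute)
  also have "\<dots> = act2 (shift_poly p) (subst_add s (act2 q A))"
    by (rule subst_act2[OF q])
  finally have "act2 (shift_poly p) D = 0"
    unfolding D_def by (simp only: m2.scale_right_diff_distrib diff_self)
  moreover have "D \<in> LEo"
    unfolding D_def by (intro LEo_diff LEo_act2 T_LEo A subst_LEo q)
  ultimately have "D = 0"
    using p(1) by (intro LEo_cancel[of D "shift_poly p"]) (simp_all add: shift_poly_0_iff)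
  then show ?thesis
    unfolding D_def by (simp only: right_minus_eq)
qed

text \<open>Characterizes \<open>T\<close>. Additivity, compatibility with polynomials and constant
  operators, and vanishing on torsion are all proved by exhibiting a solution.\<close>

lemma T_unique:
  assumes q: "q \<noteq> 0" "act2 q A \<in> Hom2 s" and B: "B \<in> LEo" "act2 (shift_poly q) B = subst_add s (act2 q A)"
  shows "T A = B"
proof -
  have A: "A \<in> QH"
    using q by (rule QH_I)
  have "act2 (shift_poly q) (T A - B) = 0"
    using T_spec[OF A q(2)] B(2) by (simp only: m2.scale_right_diff_distrib diff_self)
  then have "T A - B = 0"
    using q(1) LEo_cancel[OF LEo_diff[OF T_LEo[OF A] B(1)], of "shift_poly q"] shift_poly_0_iff by blast
  then show ?thesis
    by (simp only: right_minus_eq)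
qed

lemma QH_act2:
  assumes "A \<in> QH"
  shows "act2 f A \<in> QH"
proof -
  obtain p where p: "p \<noteq> 0" "act2 p A \<in> Hom2 s"
    using assms by (auto simp: QH_def)
  have "act2 p (act2 f A) = act2 f (act2 p A)"
    by (rule m2.scale_left_commute)
  then show ?thesis
    using p by (metis QH_I Hom2_act2)
qed

lemma T_act2:
  assumes "A \<in> QH"
  shows "T (act2 f A) = act2 (shift_poly f) (T A)"
proof -
  obtain p where p: "p \<noteq> 0" "act2 p A \<in> Hom2 s"
    using assms by (auto simp: QH_def)
  have *: "act2 p (act2 f A) = act2 f (act2 p A)"
    by (rule m2.scale_left_commute)
  show ?thesis
  proof (rule T_unique[OF p(1)])
    show "act2 p (act2 f A) \<in> Hom2 s"
      unfolding * by (rule Hom2_act2[OF p(2)])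
    show "act2 (shift_poly f) (T A) \<in> LEo"
      by (intro LEo_act2 T_LEo assms)
    show "act2 (shift_poly p) (act2 (shift_poly f) (T A)) = subst_add s (act2 p (act2 f A))"
      unfolding * subst_act2[OF p(2)] T_spec[OF assms p(2), symmetric] by (rule m2.scale_left_commute)
  qed
qed

lemma QH_common:
  assumes "A \<in> QH" "B \<in> QH"
  obtains p where "p \<noteq> 0" "act2 p A \<in> Hom2 s" "act2 p B \<in> Hom2 s"
proof -
  obtain p q where p: "p \<noteq> 0" "act2 p A \<in> Hom2 s" and q: "q \<noteq> 0" "act2 q B \<in> Hom2 s"
    using assms by (auto simp: QH_def)
  have "act2 (p * q) A = act2 q (act2 p A)" "act2 (p * q) B = act2 p (act2 q B)"
    by (simp_all only: m2.scale_scale mult.commute)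
  with p q that[of "p * q"] show ?thesis
    by (simp only: Hom2_act2 mult_eq_0_iff simp_thms)
qed

lemma QH_add: "A \<in> QH \<Longrightarrow> B \<in> QH \<Longrightarrow> A + B \<in> QH"
  by (erule (1) QH_common, rule QH_I, assumption) (metis m2.scale_right_distrib Hom2_add)

lemma T_add:
  assumes "A \<in> QH" "B \<in> QH"
  shows "T (A + B) = T A + T B"
proof -
  obtain p where p: "p \<noteq> 0" "act2 p A \<in> Hom2 s" "act2 p B \<in> Hom2 s"
    using QH_common[OF assms] .
  show ?thesis
    by (rule T_unique[OF p(1)])
      (simp_all only: m2.scale_right_distrib Hom2_add p LEo_add T_LEo assms T_spec subst_add_add)
qed

lemma T_scale: "A \<in> QH \<Longrightarrow> T (\<lambda>m n. sc c (A m n)) = (\<lambda>m n. sc c (T A m n))"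
  using T_act2[of A "[:[:c:]:]"] by (simp add: act2_gens shift_poly_def)

lemma QH_scale: "A \<in> QH \<Longrightarrow> (\<lambda>m n. sc c (A m n)) \<in> QH"
  using QH_act2[of A "[:[:c:]:]"] by (simp add: act2_gens)

lemma T_Hom2: "A \<in> Hom2 s \<Longrightarrow> T A = subst_add s A"
  by (rule T_unique[of 1]) (simp_all add: m2.scale_one subst_LEo shift_poly_def pcompose_1)

lemma subst_0: "subst_add s 0 = 0"
  using subst_add_add[OF Hom2_0 Hom2_0] by (simp only: add_0_right add_cancel_right_right)

lemma LEo_0: "0 \<in> LEo"
  by (rule LEo_I[where M = 0]) (simp_all only: zero_fun_apply Eo_0)

lemma T_torsion: "p \<noteq> 0 \<Longrightarrow> act2 p A = 0 \<Longrightarrow> T A = 0"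
  by (rule T_unique[of p]) (simp_all only: Hom2_0 LEo_0 m2.scale_zero_right subst_0 not_False_eq_True)

lemma act2_comp_right: "act2 p (\<lambda>m n. A m n \<circ> c) = (\<lambda>m n. act2 p A m n \<circ> c)"
  by (simp add: poly_times_def fun_eq_iff sum_fun_apply fscale_def)

lemma act2_comp_left: "lin c \<Longrightarrow> act2 p (\<lambda>m n. c \<circ> A m n) = (\<lambda>m n. c \<circ> act2 p A m n)"
  by (simp add: poly_times_def fun_eq_iff sum_fun_apply fscale_def lin_sum) (simp add: lin_iff)

lemma Hom2_comp_right:
  assumes A: "A \<in> Hom2 s" and c: "lin c"
  shows "(\<lambda>m n. A m n \<circ> c) \<in> Hom2 s"
  using A c unfolding Hom2_def by (auto intro: lin_closed)

lemma Hom2_comp_left: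
  assumes A: "A \<in> Hom2 s" and c: "lin c"
  shows "(\<lambda>m n. c \<circ> A m n) \<in> Hom2 s"
proof -
  have "\<exists>N. bounded2 (\<lambda>m n. c \<circ> A m n) w N" for w
  proof -
    obtain N where "bounded2 A w N"
      using A unfolding Hom2_iff by meson
    then have "bounded2 (\<lambda>m n. c \<circ> A m n) w N"
      by (auto simp: bounded2_def lin_0[OF c])
    then show ?thesis ..
  qed
  then show ?thesis
    using A c by (simp add: Hom2_iff lin_closed)
qed

lemma Eo_comp_right: "a \<in> Eo s \<Longrightarrow> lin c \<Longrightarrow> (\<lambda>n. a n \<circ> c) \<in> Eo s"
  unfolding Eo_def by (auto intro: lin_closed)

lemma Eo_comp_left: "a \<in> Eo s \<Longrightarrow> lin c \<Longrightarrow> (\<lambda>n. c \<circ> a n) \<in> Eo s"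
  unfolding Eo_iff by (auto intro: lin_closed) (metis lin_0)

lemma LEo_comp:
  assumes A: "A \<in> LEo" and c: "lin c"
  shows "(\<lambda>m n. A m n \<circ> c) \<in> LEo" "(\<lambda>m n. c \<circ> A m n) \<in> LEo"
proof -
  obtain M where M: "\<forall>k<M. A k = 0"
    using LEo_D(2) A by metis
  show "(\<lambda>m n. A m n \<circ> c) \<in> LEo"
    by (rule LEo_I[where M = M])
      (use M c LEo_D(1)[OF A] in \<open>auto intro: Eo_comp_right simp: fun_eq_iff\<close>)
  show "(\<lambda>m n. c \<circ> A m n) \<in> LEo"
    by (rule LEo_I[where M = M])
      (use M c LEo_D(1)[OF A] in \<open>auto intro: Eo_comp_left simp: fun_eq_iff lin_0\<close>)
qed

lemma subst_comp_right: "subst_add s (\<lambda>m n. A m n \<circ> c) = (\<lambda>m n. subst_add s A m n \<circ> c)"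
proof (intro ext)
  fix k n w
  show "subst_add s (\<lambda>m n. A m n \<circ> c) k n w = (subst_add s A k n \<circ> c) w"
    by (cases "k < 0") (simp_all add: subst_add_def diagonal_def deriv1_power fscale_def)
qed

lemma subst_comp_left:
  assumes "A \<in> Hom2 s" "lin c"
  shows "subst_add s (\<lambda>m n. c \<circ> A m n) = (\<lambda>m n. c \<circ> subst_add s A m n)"
proof (intro ext)
  fix k n w
  obtain N where A: "bounded2 A w N"
    using assms unfolding Hom2_iff by meson
  then have AB: "bounded2 (\<lambda>m n. c \<circ> A m n) w N"
    by (auto simp: bounded2_def lin_0[OF assms(2)])
  show "subst_add s (\<lambda>m n. c \<circ> A m n) k n w = (c \<circ> subst_add s A k n) w"
  proof (cases "k < 0")
    case False
    then obtain k' where k': "k = int k'"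
      by (metis not_less zero_le_imp_eq_int)
    show ?thesis
      using subst_formula[OF A order_refl, where n = n and k = k']
        subst_formula[OF AB order_refl, where n = n and k = k'] k' assms(2)
      by (simp add: lin_sum) (simp add: lin_iff)
  qed (simp add: subst_neg lin_0[OF assms(2)])
qed

lemma QH_comp:
  assumes "A \<in> QH" "lin c"
  shows "(\<lambda>m n. A m n \<circ> c) \<in> QH" "(\<lambda>m n. c \<circ> A m n) \<in> QH"
proof -
  obtain p where p: "p \<noteq> 0" "act2 p A \<in> Hom2 s"
    using assms by (auto simp: QH_def)
  show "(\<lambda>m n. A m n \<circ> c) \<in> QH" "(\<lambda>m n. c \<circ> A m n) \<in> QH"
    by (rule QH_I[OF p(1)], simp only: act2_comp_right act2_comp_left assms Hom2_comp_right Hom2_comp_left p)+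
qed

text \<open>In a triple product the coefficients of the remaining factor are constant operators, so
  this lets \<open>T\<close> act on two adjacent factors.\<close>

lemma T_comp:
  assumes "A \<in> QH" "lin c"
  shows "T (\<lambda>m n. A m n \<circ> c) = (\<lambda>m n. T A m n \<circ> c)" "T (\<lambda>m n. c \<circ> A m n) = (\<lambda>m n. c \<circ> T A m n)"
proof -
  obtain p where p: "p \<noteq> 0" "act2 p A \<in> Hom2 s"
    using assms by (auto simp: QH_def)
  show "T (\<lambda>m n. A m n \<circ> c) = (\<lambda>m n. T A m n \<circ> c)" "T (\<lambda>m n. c \<circ> A m n) = (\<lambda>m n. c \<circ> T A m n)"
    by (rule T_unique[OF p(1)], simp_all only: act2_comp_right act2_comp_left assms Hom2_comp_right
      Hom2_comp_left p LEo_comp T_LEo T_spec subst_comp_right subst_comp_left)+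
qed

subsection \<open>Series in three variables\<close>

lemma act3_slice12: "act3 sc (ev2 v1 v2 p) A = (\<lambda>i j k. act2 p (\<lambda>i j. A i j k) i j)"
proof -
  have "(\<lambda>i j. act3 sc (ev2 v1 v2 p) A i j k) = act2 p (\<lambda>i j. A i j k)" for k
  proof -
    have "act3 sc (ev2 v1 v2 p) A \<in> UNIV \<and> (\<lambda>A i j. A i j k) (act3 sc (ev2 v1 v2 p) A) =
        act2 (ev (ev (\<lambda>c. [:[:c:]:]) var_inner) var_outer p) ((\<lambda>A i j. A i j k) A)"
      by (rule intertwine2[OF module_comp_hom[OF m3.module_axioms unital_hom_ev2[of v1 v2]]
            m2.module_axioms hom_const2, where N = UNIV])
        (simp_all only: var_outer_def[symmetric] var_inner_def[symmetric] ev2_simps act3_gens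
          act2_gens act2_vars UNIV_I plus_fun_def)
    then show ?thesis
      by (simp add: ev_id_poly)
  qed
  then show ?thesis
    by (simp add: fun_eq_iff)
qed

lemma act3_slice13: "act3 sc (ev2 v1 v3 p) A = (\<lambda>i j k. act2 p (\<lambda>i k. A i j k) i k)"
proof -
  have "(\<lambda>i k. act3 sc (ev2 v1 v3 p) A i j k) = act2 p (\<lambda>i k. A i j k)" for j
  proof -
    have "act3 sc (ev2 v1 v3 p) A \<in> UNIV \<and> (\<lambda>A i k. A i j k) (act3 sc (ev2 v1 v3 p) A) =
        act2 (ev (ev (\<lambda>c. [:[:c:]:]) var_inner) var_outer p) ((\<lambda>A i k. A i j k) A)"
      by (rule intertwine2[OF module_comp_hom[OF m3.module_axioms unital_hom_ev2[of v1 v3]]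
            m2.module_axioms hom_const2, where N = UNIV])
        (simp_all only: var_outer_def[symmetric] var_inner_def[symmetric] ev2_simps act3_gens
          act2_gens act2_vars UNIV_I plus_fun_def)
    then show ?thesis
      by (simp add: ev_id_poly)
  qed
  then show ?thesis
    by (simp add: fun_eq_iff)
qed

lemma act3_slice23: "act3 sc (ev2 v2 v3 p) A = (\<lambda>i. act2 p (A i))"
proof -
  have "act3 sc (ev2 v2 v3 p) A i = act2 p (A i)" for i
  proof -
    have "act3 sc (ev2 v2 v3 p) A \<in> UNIV \<and> (\<lambda>A. A i) (act3 sc (ev2 v2 v3 p) A) =
        act2 (ev (ev (\<lambda>c. [:[:c:]:]) var_inner) var_outer p) ((\<lambda>A. A i) A)"
      by (rule intertwine2[OF module_comp_hom[OF m3.module_axioms unital_hom_ev2[of v2 v3]]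
            m2.module_axioms hom_const2, where N = UNIV])
        (simp_all only: var_outer_def[symmetric] var_inner_def[symmetric] ev2_simps act3_gens
          act2_gens act2_vars UNIV_I plus_fun_def)
    then show ?thesis
      by (simp add: ev_id_poly)
  qed
  then show ?thesis
    by (simp add: fun_eq_iff)
qed

lemma act3_closed:
  assumes "\<And>A B. A \<in> N \<Longrightarrow> B \<in> N \<Longrightarrow> A + B \<in> N"
    and "\<And>c A. A \<in> N \<Longrightarrow> (\<lambda>i j k. sc c (A i j k)) \<in> N"
    and "\<And>A. A \<in> N \<Longrightarrow> (\<lambda>i j k. A (i - 1) j k) \<in> N"
    and "\<And>A. A \<in> N \<Longrightarrow> (\<lambda>i j k. A i (j - 1) k) \<in> N"
    and "\<And>A. A \<in> N \<Longrightarrow> (\<lambda>i j k. A i j (k - 1)) \<in> N"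
    and "A \<in> N"
  shows "act3 sc f A \<in> N"
proof -
  have "act3 sc f A \<in> N \<and> id (act3 sc f A) = act3 sc (ev3 v1 v2 v3 f) (id A)"
    by (intro intertwine3[OF m3.module_axioms m3.module_axioms, where N = N and \<Phi> = id])
      (use assms in \<open>simp_all only: act3_gens id_apply\<close>)
  then show ?thesis by blast
qed

text \<open>A polynomial changes exponents by a bounded amount, so a bound on \<open>\<pi>\<close>
  survives. One degree function is treated at a time because the bounds on the three exponents come
  from three different orderings of the same product.\<close>

lemma bounded_act3:
  fixes \<pi> :: "int \<Rightarrow> int \<Rightarrow> int \<Rightarrow> int"
  assumes \<pi>: "\<And>i j k. \<pi> i j k \<le> \<pi> (i - 1) j k + 1" "\<And>i j k. \<pi> i j k \<le> \<pi> i (j - 1) k + 1"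
      "\<And>i j k. \<pi> i j k \<le> \<pi> i j (k - 1) + 1"
    and A: "\<And>w. \<exists>N. \<forall>i j k. \<pi> i j k > N \<longrightarrow> A i j k w = 0"
  shows "\<exists>N. \<forall>i j k. \<pi> i j k > N \<longrightarrow> act3 sc f A i j k w = 0"
proof -
  define B where "B = {A :: int \<Rightarrow> int \<Rightarrow> int \<Rightarrow> 'w \<Rightarrow> 'w. \<forall>w. \<exists>N. \<forall>i j k. \<pi> i j k > N \<longrightarrow> A i j k w = 0}"
  have shift: "A' \<in> B" if A: "A \<in> B" and A': "\<And>i j k. \<exists>i' j' k'. A' i j k = A i' j' k' \<and> \<pi> i j k \<le> \<pi> i' j' k' + 1" for A A'
    unfolding B_def mem_Collect_eq
  proof
    fix w
    obtain N where N: "\<forall>i j k. \<pi> i j k > N \<longrightarrow> A i j k w = 0"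
      using A unfolding B_def by blast
    have "A' i j k w = 0" if "\<pi> i j k > N + 1" for i j k
      using A'[of i j k] N that by force
    then show "\<exists>N. \<forall>i j k. \<pi> i j k > N \<longrightarrow> A' i j k w = 0" by blast
  qed
  have "act3 sc f A \<in> B"
  proof (rule act3_closed)
    fix A1 A2 assume A: "A1 \<in> B" "A2 \<in> B"
    show "A1 + A2 \<in> B"
      unfolding B_def mem_Collect_eq
    proof
      fix w
      obtain N1 N2 where "\<forall>i j k. \<pi> i j k > N1 \<longrightarrow> A1 i j k w = 0" "\<forall>i j k. \<pi> i j k > N2 \<longrightarrow> A2 i j k w = 0"
        using A unfolding B_def by blast
      then have "\<forall>i j k. \<pi> i j k > max N1 N2 \<longrightarrow> (A1 + A2) i j k w = 0"
        by simp
      then show "\<exists>N. \<forall>i j k. \<pi> i j k > N \<longrightarrow> (A1 + A2) i j k w = 0" ..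
    qed
  next
    fix A c assume "A \<in> B"
    then show "(\<lambda>i j k. sc c (A i j k)) \<in> B"
      unfolding B_def mem_Collect_eq by (metis fscale_def scale_zero_right)
  next
    fix A assume "A \<in> B"
    then show "(\<lambda>i j k. A (i - 1) j k) \<in> B" "(\<lambda>i j k. A i (j - 1) k) \<in> B" "(\<lambda>i j k. A i j (k - 1)) \<in> B"
      by (rule shift, use \<pi> in blast)+
  qed (use A in \<open>simp_all add: B_def\<close>)
  then show ?thesis
    by (simp add: B_def)
qed

lemma lin_act3:
  assumes "\<And>i j k. lin (A i j k)"
  shows "lin (act3 sc f A i j k)"
proof -
  define B where "B = {A :: int \<Rightarrow> int \<Rightarrow> int \<Rightarrow> 'w \<Rightarrow> 'w. \<forall>i j k. lin (A i j k)}"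
  have "act3 sc f A \<in> B"
    by (rule act3_closed) (use assms in \<open>simp_all add: B_def lin_closed\<close>)
  then show ?thesis
    by (simp add: B_def)
qed

section \<open>Permuting three variables, and applying \<open>T\<close> to two of them\<close>

definition swap12 :: "(int \<Rightarrow> int \<Rightarrow> int \<Rightarrow> 'w \<Rightarrow> 'w) \<Rightarrow> int \<Rightarrow> int \<Rightarrow> int \<Rightarrow> 'w \<Rightarrow> 'w" where
  "swap12 A = (\<lambda>i j k. A j i k)"

definition rot :: "(int \<Rightarrow> int \<Rightarrow> int \<Rightarrow> 'w \<Rightarrow> 'w) \<Rightarrow> int \<Rightarrow> int \<Rightarrow> int \<Rightarrow> 'w \<Rightarrow> 'w" where
  "rot A = (\<lambda>k i j. A i j k)"

definition unrot :: "(int \<Rightarrow> int \<Rightarrow> int \<Rightarrow> 'w \<Rightarrow> 'w) \<Rightarrow> int \<Rightarrow> int \<Rightarrow> int \<Rightarrow> 'w \<Rightarrow> 'w" where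
  "unrot A = (\<lambda>i j k. A k i j)"

lemma act3_permute:
  "swap12 (act3 sc f A) = act3 sc (ev3 v2 v1 v3 f) (swap12 A)"
  "rot (act3 sc f A) = act3 sc (ev3 v2 v3 v1 f) (rot A)"
  "unrot (act3 sc f A) = act3 sc (ev3 v3 v1 v2 f) (unrot A)"
proof -
  note I = intertwine3[OF m3.module_axioms m3.module_axioms, where N = UNIV]
  have "act3 sc f A \<in> UNIV \<and> swap12 (act3 sc f A) = act3 sc (ev3 v2 v1 v3 f) (swap12 A)"
    by (rule I) (simp_all add: act3_gens swap12_def fun_eq_iff)
  moreover have "act3 sc f A \<in> UNIV \<and> rot (act3 sc f A) = act3 sc (ev3 v2 v3 v1 f) (rot A)"
    by (rule I) (simp_all add: act3_gens rot_def fun_eq_iff)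
  moreover have "act3 sc f A \<in> UNIV \<and> unrot (act3 sc f A) = act3 sc (ev3 v3 v1 v2 f) (unrot A)"
    by (rule I) (simp_all add: act3_gens unrot_def fun_eq_iff)
  ultimately show "swap12 (act3 sc f A) = act3 sc (ev3 v2 v1 v3 f) (swap12 A)"
    "rot (act3 sc f A) = act3 sc (ev3 v2 v3 v1 f) (rot A)"
    "unrot (act3 sc f A) = act3 sc (ev3 v3 v1 v2 f) (unrot A)"
    by blast+
qed

text \<open>\<open>swap12\<close>, \<open>rot\<close> and \<open>unrot\<close> bring the wanted pair
  of variables to the last two places, and \<open>ev3\<close> records what happens to the
  polynomial.\<close>

definition T23 :: "(int \<Rightarrow> int \<Rightarrow> int \<Rightarrow> 'w \<Rightarrow> 'w) \<Rightarrow> int \<Rightarrow> int \<Rightarrow> int \<Rightarrow> 'w \<Rightarrow> 'w" where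
  "T23 A = (\<lambda>i. T (A i))"

lemma T_gens:
  assumes "A \<in> QH"
  shows "T (\<lambda>m n. A m (n - 1)) = (\<lambda>m n. T A m (n - 1))"
    and "T (\<lambda>m n. A (m - 1) n) = (\<lambda>m n. T A (m - 1) n) + (\<lambda>m n. T A m (n - 1))"
    and "(\<lambda>m n. A m (n - 1)) \<in> QH" and "(\<lambda>m n. A (m - 1) n) \<in> QH"
proof -
  have *: "shift_poly var_inner = var_inner" "shift_poly var_outer = var_outer + var_inner"
    by (simp_all add: shift_poly_def) (simp_all add: var_inner_def var_outer_def pcompose_pCons)
  show "T (\<lambda>m n. A m (n - 1)) = (\<lambda>m n. T A m (n - 1))"
    using T_act2[OF assms, of var_inner] by (simp only: * act2_vars)
  show "T (\<lambda>m n. A (m - 1) n) = (\<lambda>m n. T A (m - 1) n) + (\<lambda>m n. T A m (n - 1))"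
    using T_act2[OF assms, of var_outer] by (simp only: * act2_vars m2.scale_left_distrib)
  show "(\<lambda>m n. A m (n - 1)) \<in> QH" "(\<lambda>m n. A (m - 1) n) \<in> QH"
    using QH_act2[OF assms, of var_inner] QH_act2[OF assms, of var_outer] by (simp_all only: act2_vars)
qed

lemma T23_act3:
  assumes "\<And>i. A i \<in> QH"
  shows "(\<forall>i. act3 sc f A i \<in> QH) \<and> T23 (act3 sc f A) = act3 sc (ev3 v1 (v2 + v3) v3 f) (T23 A)"
proof -
  define N where "N = {A. \<forall>i :: int. A i \<in> QH}"
  have A: "A i \<in> QH" if "A \<in> N" for A i
    using that by (simp add: N_def)
  have "act3 sc f A \<in> N \<and> T23 (act3 sc f A) = act3 sc (ev3 v1 (v2 + v3) v3 f) (T23 A)"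
  proof (rule intertwine3[OF m3.module_axioms m3.module_axioms])
    fix A B assume "A \<in> N" "B \<in> N"
    then show "A + B \<in> N" "T23 (A + B) = T23 A + T23 B"
      unfolding N_def T23_def by (simp_all only: mem_Collect_eq plus_fun_apply QH_add T_add simp_thms)
        (simp only: plus_fun_def)
  next
    fix A c assume "A \<in> N"
    then show "act3 sc (c3 c) A \<in> N" "T23 (act3 sc (c3 c) A) = act3 sc (c3 c) (T23 A)"
      unfolding N_def T23_def act3_gens by (simp_all only: mem_Collect_eq QH_scale T_scale simp_thms)
  next
    fix A assume "A \<in> N"
    then show "act3 sc v3 A \<in> N" "T23 (act3 sc v3 A) = act3 sc v3 (T23 A)"
      unfolding N_def T23_def act3_gens by (simp_all only: mem_Collect_eq T_gens simp_thms)
  next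
    fix A assume "A \<in> N"
    then show "act3 sc v2 A \<in> N" "T23 (act3 sc v2 A) = act3 sc (v2 + v3) (T23 A)"
      unfolding N_def T23_def act3_gens m3.scale_left_distrib
      by (simp_all only: mem_Collect_eq T_gens simp_thms) (simp only: plus_fun_def)
  next
    fix A assume "A \<in> N"
    then show "act3 sc v1 A \<in> N" "T23 (act3 sc v1 A) = act3 sc v1 (T23 A)"
      unfolding N_def T23_def act3_gens by (simp_all only: mem_Collect_eq simp_thms)
  qed (use assms in \<open>simp add: N_def\<close>)
  then show ?thesis
    by (simp add: N_def)
qed

definition bounded3 :: "(int \<Rightarrow> int \<Rightarrow> int \<Rightarrow> 'w \<Rightarrow> 'w) \<Rightarrow> 'w \<Rightarrow> int \<Rightarrow> bool" where
  "bounded3 A w N \<longleftrightarrow> (\<forall>i j k. i > N \<or> j > N \<or> k > N \<longrightarrow> A i j k w = 0)"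

definition Hom3 :: "(int \<Rightarrow> int \<Rightarrow> int \<Rightarrow> 'w \<Rightarrow> 'w) set" where
  "Hom3 = {A. (\<forall>i j k. lin (A i j k)) \<and> (\<forall>w. \<exists>N. bounded3 A w N)}"

lemma Hom3_bounded: "F \<in> Hom3 \<Longrightarrow> \<exists>N. bounded3 F w N"
  by (simp add: Hom3_def)

lemma Hom3_slices:
  assumes F: "F \<in> Hom3"
  shows "F i \<in> Hom2 s" "(\<lambda>i j. F i j k) \<in> Hom2 s"
proof -
  have "\<exists>N. bounded2 (F i) w N" "\<exists>N. bounded2 (\<lambda>i j. F i j k) w N" for w
    using Hom3_bounded[OF F, of w] unfolding bounded3_def bounded2_def by meson+
  then show "F i \<in> Hom2 s" "(\<lambda>i j. F i j k) \<in> Hom2 s"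
    using F by (simp_all add: Hom2_iff Hom3_def)
qed

lemma Hom3_subst:
  assumes F: "F \<in> Hom3"
  shows "(\<lambda>i n. subst_add s (F i) m n) \<in> Hom2 s"
    and "(\<lambda>j k. subst_add s (\<lambda>i j. F i j k) m j) \<in> Hom2 s"
proof -
  have "\<exists>M. bounded2 (\<lambda>i n. subst_add s (F i) m n) w M" for w
  proof -
    obtain N where N: "bounded3 F w N"
      using Hom3_bounded[OF F] by blast
    have "bounded2 (F i) w N" for i
      using N by (auto simp: bounded2_def bounded3_def)
    \<comment> \<open>The whole slice vanishes at \<open>w\<close>, so every integer is a bound for
      it; the one given is low enough for \<open>bounded2_subst\<close>.\<close>
    moreover have "subst_add s (F i) m n w = 0" if "i > N" for i n
      by (rule bounded2_subst[of _ w "- \<bar>m\<bar> - \<bar>n\<bar> - 1"])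
        (use N that in \<open>auto simp: bounded2_def bounded3_def\<close>)
    ultimately have "bounded2 (\<lambda>i n. subst_add s (F i) m n) w (max N (2 * N - m))"
      unfolding bounded2_def[of "\<lambda>i n. subst_add s (F i) m n"] by (auto intro: bounded2_subst)
    then show ?thesis ..
  qed
  then show "(\<lambda>i n. subst_add s (F i) m n) \<in> Hom2 s"
    using lin_subst[OF Hom3_slices(1)[OF F]] by (simp add: Hom2_iff)
  have "\<exists>M. bounded2 (\<lambda>j k. subst_add s (\<lambda>i j. F i j k) m j) w M" for w
  proof -
    obtain N where N: "bounded3 F w N"
      using Hom3_bounded[OF F] by blast
    have "bounded2 (\<lambda>i j. F i j k) w N" for k
      using N by (auto simp: bounded2_def bounded3_def)
    moreover have "subst_add s (\<lambda>i j. F i j k) m n w = 0" if "k > N" for k n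
      by (rule bounded2_subst[of _ w "- \<bar>m\<bar> - \<bar>n\<bar> - 1"])
        (use N that in \<open>auto simp: bounded2_def bounded3_def\<close>)
    ultimately have "bounded2 (\<lambda>j k. subst_add s (\<lambda>i j. F i j k) m j) w (max N (2 * N - m))"
      unfolding bounded2_def[of "\<lambda>j k. subst_add s (\<lambda>i j. F i j k) m j"] by (auto intro: bounded2_subst)
    then show ?thesis ..
  qed
  then show "(\<lambda>j k. subst_add s (\<lambda>i j. F i j k) m j) \<in> Hom2 s"
    using lin_subst[OF Hom3_slices(2)[OF F]] by (simp add: Hom2_iff)
qed

text \<open>\<open>F(x\<^sub>1,x\<^sub>2,x)\<close> at \<open>x\<^sub>1 = y\<^sub>1 + x\<close>, \<open>x\<^sub>2 = y\<^sub>2 + x\<close>, as a series in \<open>y\<^sub>1, y\<^sub>2, x\<close>.\<close>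

definition subst_both :: "(int \<Rightarrow> int \<Rightarrow> int \<Rightarrow> 'w \<Rightarrow> 'w) \<Rightarrow> int \<Rightarrow> int \<Rightarrow> int \<Rightarrow> 'w \<Rightarrow> 'w" where
  "subst_both F = (\<lambda>k m n. subst_add s (\<lambda>i n. subst_add s (F i) m n) k n)"

text \<open>\<open>F(x\<^sub>1,x\<^sub>2,x)\<close> at \<open>x\<^sub>1 = x\<^sub>0 + x\<^sub>2\<close> and then \<open>x\<^sub>2 = y\<^sub>2 + x\<close>, as a series in \<open>x\<^sub>0, y\<^sub>2, x\<close>.\<close>

definition subst_chain :: "(int \<Rightarrow> int \<Rightarrow> int \<Rightarrow> 'w \<Rightarrow> 'w) \<Rightarrow> int \<Rightarrow> int \<Rightarrow> int \<Rightarrow> 'w \<Rightarrow> 'w" where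
  "subst_chain F = (\<lambda>m. subst_add s (\<lambda>j k. subst_add s (\<lambda>i j. F i j k) m j))"

definition prod3 :: "(int \<Rightarrow> 'w \<Rightarrow> 'w) \<Rightarrow> (int \<Rightarrow> 'w \<Rightarrow> 'w) \<Rightarrow> (int \<Rightarrow> 'w \<Rightarrow> 'w) \<Rightarrow> int \<Rightarrow> int \<Rightarrow> int \<Rightarrow> 'w \<Rightarrow> 'w" where
  "prod3 a b c = (\<lambda>i j k. a i \<circ> b j \<circ> c k)"

abbreviation Y :: "(int \<Rightarrow> 'w \<Rightarrow> 'w) \<Rightarrow> int \<Rightarrow> (int \<Rightarrow> 'w \<Rightarrow> 'w) \<Rightarrow> int \<Rightarrow> 'w \<Rightarrow> 'w" where
  "Y \<equiv> Y_Eo s"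

lemma Eo_lin: "a \<in> Eo s \<Longrightarrow> lin (a n)"
  by (simp add: Eo_iff)

text \<open>\<open>T\<close> is applied first to x_2, x, with the coefficients of \<open>a\<close>
  as constant operators, then to x_1, x for each power of y_2. On the product itself this produces
  the iterated \<open>Y\<close>; on its multiple in \<open>Hom3\<close> it is plain substitution.
  The polynomial is carried along as f(y_1 + x, y_2 + x, x).\<close>

lemma iterated_left:
  assumes a: "a \<in> Eo s" and bc: "prod2 b c \<in> QH" and aD: "\<And>m. prod2 a (Y b m c) \<in> QH"
    and F: "act3 sc f (prod3 a b c) \<in> Hom3"
  shows "act3 sc (ev3 (v1 + v3) (v2 + v3) v3 f) (\<lambda>k m. Y a k (Y b m c)) =
    subst_both (act3 sc f (prod3 a b c))"
proof -
  define F' where "F' = act3 sc f (prod3 a b c)"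
  have slice: "prod3 a b c i = (\<lambda>m n. a i \<circ> prod2 b c m n)" for i
    by (simp add: prod3_def prod2_def comp_assoc)
  have "\<And>i. prod3 a b c i \<in> QH"
    unfolding slice by (intro QH_comp bc Eo_lin a)
  from T23_act3[of "prod3 a b c", OF this, of f]
  have 1: "T23 F' = act3 sc (ev3 v1 (v2 + v3) v3 f) (T23 (prod3 a b c))"
    unfolding F'_def by blast
  define E where "E = (\<lambda>m. prod2 a (Y b m c))"
  have "T (prod3 a b c i) = (\<lambda>m n. a i \<circ> Y b m c n)" for i
    unfolding slice Y_Eo_T by (rule T_comp(2)[OF bc Eo_lin[OF a]])
  \<comment> \<open>The variables are now x_1, y_2, x; the swap puts y_2 in front, so that x_1, x
    are last.\<close>
  then have 2: "T23 (prod3 a b c) = swap12 E"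
    by (simp add: T23_def swap12_def E_def prod2_def)
  have 3: "T23 F' = (\<lambda>i. subst_add s (F' i))"
    using F by (simp add: T23_def T_Hom2 Hom3_slices F'_def)
  have "swap12 (\<lambda>i. subst_add s (F' i)) = swap12 (act3 sc (ev3 v1 (v2 + v3) v3 f) (swap12 E))"
    using 1 unfolding 2 3 by simp
  also have "\<dots> = act3 sc (ev3 v2 (v1 + v3) v3 f) E"
    by (simp add: act3_permute ev3_ev3) (simp add: swap12_def)
  finally have 4: "act3 sc (ev3 v2 (v1 + v3) v3 f) E = swap12 (\<lambda>i. subst_add s (F' i))" ..
  have "\<And>m. E m \<in> QH"
    unfolding E_def by (rule aD)
  from T23_act3[of E, OF this, of "ev3 v2 (v1 + v3) v3 f"]
  have 5: "T23 (swap12 (\<lambda>i. subst_add s (F' i))) = act3 sc (ev3 (v2 + v3) (v1 + v3) v3 f) (T23 E)"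
    by (simp add: 4 ev3_ev3)
  have "T23 (swap12 (\<lambda>i. subst_add s (F' i))) = (\<lambda>m. subst_add s (\<lambda>i n. subst_add s (F' i) m n))"
    using F by (simp add: T23_def swap12_def T_Hom2 Hom3_subst F'_def)
  then have "swap12 (\<lambda>m. subst_add s (\<lambda>i n. subst_add s (F' i) m n)) =
      swap12 (act3 sc (ev3 (v2 + v3) (v1 + v3) v3 f) (T23 E))"
    using 5 by simp
  also have "\<dots> = act3 sc (ev3 (v1 + v3) (v2 + v3) v3 f) (swap12 (T23 E))"
    by (simp add: act3_permute ev3_ev3)
  also have "swap12 (T23 E) = (\<lambda>k m. Y a k (Y b m c))"
    by (simp add: swap12_def T23_def E_def Y_Eo_T)
  finally show ?thesis
    by (simp add: swap12_def subst_both_def F'_def)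
qed

text \<open>Now x_1, x_2 come first, with the coefficients of \<open>c\<close> as constant
  operators, which gives Y(a,x_0)b; then x_2, x. The two steps compose to x_1 = x_0 + y_2 + x, hence
  the argument \<open>v1 + v2 + v3\<close>.\<close>

lemma iterated_right:
  assumes ab: "prod2 a b \<in> QH" and c: "c \<in> Eo s" and Dc: "\<And>m. prod2 (Y a m b) c \<in> QH"
    and F: "act3 sc f (prod3 a b c) \<in> Hom3"
  shows "act3 sc (ev3 (v1 + v2 + v3) (v2 + v3) v3 f) (\<lambda>m n. Y (Y a m b) n c) =
    subst_chain (act3 sc f (prod3 a b c))"
proof -
  define F' where "F' = act3 sc f (prod3 a b c)"
  have slice: "rot (prod3 a b c) k = (\<lambda>m n. prod2 a b m n \<circ> c k)" for k
    by (simp add: rot_def prod3_def prod2_def)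
  have "\<And>k. rot (prod3 a b c) k \<in> QH"
    unfolding slice by (intro QH_comp ab Eo_lin c)
  from T23_act3[of "rot (prod3 a b c)", OF this, of "ev3 v2 v3 v1 f"]
  have 1: "T23 (rot F') = act3 sc (ev3 (v2 + v3) v3 v1 f) (T23 (rot (prod3 a b c)))"
    unfolding F'_def by (simp add: act3_permute ev3_ev3)
  define E where "E = (\<lambda>m. prod2 (Y a m b) c)"
  have "T (rot (prod3 a b c) k) = (\<lambda>m n. Y a m b n \<circ> c k)" for k
    unfolding slice Y_Eo_T by (rule T_comp(1)[OF ab Eo_lin[OF c]])
  then have 2: "T23 (rot (prod3 a b c)) = rot E"
    by (simp add: T23_def E_def prod2_def) (simp add: rot_def)
  have 3: "T23 (rot F') = (\<lambda>k. subst_add s (\<lambda>i j. F' i j k))"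
    using F by (simp add: T23_def T_Hom2 Hom3_slices F'_def rot_def)
  have "unrot (\<lambda>k. subst_add s (\<lambda>i j. F' i j k)) = unrot (act3 sc (ev3 (v2 + v3) v3 v1 f) (rot E))"
    using 1 unfolding 2 3 by simp
  also have "\<dots> = act3 sc (ev3 (v1 + v2) v2 v3 f) E"
    by (simp add: act3_permute ev3_ev3) (simp add: rot_def unrot_def)
  finally have 4: "act3 sc (ev3 (v1 + v2) v2 v3 f) E = unrot (\<lambda>k. subst_add s (\<lambda>i j. F' i j k))" ..
  have "\<And>m. E m \<in> QH"
    unfolding E_def by (rule Dc)
  from T23_act3[of E, OF this, of "ev3 (v1 + v2) v2 v3 f"]
  have 5: "T23 (unrot (\<lambda>k. subst_add s (\<lambda>i j. F' i j k))) =
      act3 sc (ev3 (v1 + v2 + v3) (v2 + v3) v3 f) (T23 E)"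
    by (simp add: 4 ev3_ev3 add.assoc)
  have "T23 (unrot (\<lambda>k. subst_add s (\<lambda>i j. F' i j k))) = subst_chain F'"
    using F by (simp add: T23_def unrot_def T_Hom2 Hom3_subst F'_def subst_chain_def)
  moreover have "T23 E = (\<lambda>m n. Y (Y a m b) n c)"
    by (simp add: T23_def E_def Y_Eo_T)
  ultimately show ?thesis
    using 5 by (simp add: F'_def)
qed

subsection \<open>Locality with the coefficients of \<open>Y(a,x\<^sub>0)b\<close>\<close>

definition comm_by :: "complex poly poly \<Rightarrow> (int \<Rightarrow> 'w \<Rightarrow> 'w) \<Rightarrow> (int \<Rightarrow> 'w \<Rightarrow> 'w) \<Rightarrow> bool" where
  "comm_by p a b \<longleftrightarrow> act2 p (prod2 a b) = act2 p (\<lambda>m n. b n \<circ> a m)"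

lemma comm_by_mult: "comm_by p a b \<Longrightarrow> comm_by (p * q) a b" "comm_by p a b \<Longrightarrow> comm_by (q * p) a b"
  unfolding comm_by_def by (metis m2.scale_scale mult.commute)+

lemma act3_comm13:
  assumes "comm_by q a c"
  shows "act3 sc (ev2 v1 v3 q) (\<lambda>i j k. a i \<circ> c k \<circ> b j) = act3 sc (ev2 v1 v3 q) (\<lambda>i j k. c k \<circ> a i \<circ> b j)"
  using assms unfolding act3_slice13 act2_comp_right comm_by_def prod2_def by simp

lemma act3_comm23:
  assumes "comm_by q b c" and a: "\<And>i. lin (a i)"
  shows "act3 sc (ev2 v2 v3 q) (prod3 a b c) = act3 sc (ev2 v2 v3 q) (\<lambda>i j k. a i \<circ> c k \<circ> b j)"
proof -
  have "act2 q (prod3 a b c i) = act2 q (\<lambda>j k. a i \<circ> (c k \<circ> b j))" for i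
    using assms unfolding comm_by_def prod3_def comp_assoc
    by (simp add: act2_comp_left[OF a] prod2_def)
  then show ?thesis
    by (simp add: act3_slice23 comp_assoc)
qed

text \<open>Two readings of one series: a(x_1)b(x_2) bounds the exponents of x_2, and b(x_2)a(x_1)
  those of x_1.\<close>

lemma comm_by_Hom2:
  assumes a: "a \<in> Eo s" and b: "b \<in> Eo s" and p: "comm_by p a b"
  shows "act2 p (prod2 a b) \<in> Hom2 s"
proof -
  \<comment> \<open>A dummy third variable makes \<open>lin_act3\<close> and
    \<open>bounded_act3\<close> available in two variables.\<close>
  have flat: "act2 p A = (\<lambda>i j. act3 sc (ev2 v1 v2 p) (\<lambda>i j k. A i j) i j 0)" for A
    by (simp add: act3_slice12)
  have lin: "lin (act2 p (prod2 a b) m n)" for m n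
    unfolding flat by (rule lin_act3) (simp add: prod2_def lin_closed Eo_lin a b)
  have "\<exists>N. bounded2 (act2 p (prod2 a b)) w N" for w
  proof -
    have "\<exists>N. \<forall>i j k :: int. j > N \<longrightarrow> act3 sc (ev2 v1 v2 p) (\<lambda>i j k. prod2 a b i j) i j k w = 0"
    proof (rule bounded_act3[where \<pi> = "\<lambda>i j k. j"])
      fix w
      obtain N where "\<forall>n>N. b n w = 0"
        using b unfolding Eo_iff by blast
      then have "\<forall>i j k :: int. j > N \<longrightarrow> prod2 a b i j w = 0"
        by (simp add: prod2_def lin_0 Eo_lin[OF a])
      then show "\<exists>N. \<forall>i j k :: int. j > N \<longrightarrow> prod2 a b i j w = 0" ..
    qed auto
    then obtain N where N: "\<forall>m n. n > N \<longrightarrow> act2 p (prod2 a b) m n w = 0"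
      unfolding flat by blast
    have "\<exists>N. \<forall>i j k :: int. i > N \<longrightarrow> act3 sc (ev2 v1 v2 p) (\<lambda>i j k. b j \<circ> a i) i j k w = 0"
    proof (rule bounded_act3[where \<pi> = "\<lambda>i j k. i"])
      fix w
      obtain N where "\<forall>n>N. a n w = 0"
        using a unfolding Eo_iff by blast
      then have "\<forall>i j k :: int. i > N \<longrightarrow> (b j \<circ> a i) w = 0"
        by (simp add: lin_0 Eo_lin[OF b])
      then show "\<exists>N. \<forall>i j k :: int. i > N \<longrightarrow> (b j \<circ> a i) w = 0" ..
    qed auto
    then obtain N' where N': "\<forall>m n. m > N' \<longrightarrow> act2 p (prod2 a b) m n w = 0"
      using p unfolding comm_by_def flat[of "\<lambda>m n. b n \<circ> a m"] by (metis (no_types))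
    have "bounded2 (act2 p (prod2 a b)) w (max N N')"
      using N N' by (simp add: bounded2_def)
    then show ?thesis ..
  qed
  with lin show ?thesis
    unfolding Hom2_iff by blast
qed

lemma comm_by_QH: "a \<in> Eo s \<Longrightarrow> b \<in> Eo s \<Longrightarrow> p \<noteq> 0 \<Longrightarrow> comm_by p a b \<Longrightarrow> prod2 a b \<in> QH"
  by (rule QH_I[of p]) (auto intro: comm_by_Hom2)

lemma T_0: "T 0 = 0"
  by (rule T_torsion[of 1]) (simp_all add: m2.scale_zero_right)

text \<open>Moving c(x_3) past b and then past a shows that q(x_1,x_3) q(x_2,x_3) kills abc - cab.
  Applying \<open>T\<close> in x_1, x_2 turns this into q(x_0+x_2,x_3) q(x_2,x_3) killing the
  commutator of Y(a,x_0)b with c(x_3). In x_0 that commutator is bounded below, so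
  \<open>lowest_term_kills\<close> yields a power of q(x_2,x_3)^2 for each coefficient.\<close>

lemma dong:
  assumes a: "a \<in> Eo s" and b: "b \<in> Eo s" and c: "c \<in> Eo s" and ab: "prod2 a b \<in> QH"
    and ac: "comm_by q a c" and bc: "comm_by q b c"
  shows "\<exists>k. comm_by ((q * q) ^ k) (Y a m b) c"
proof -
  define G where "G = prod3 a b c - (\<lambda>i j k. c k \<circ> a i \<circ> b j)"
  define Q where "Q = ev2 v1 v3 q * ev2 v2 v3 q"
  have "act3 sc Q (prod3 a b c) = act3 sc Q (\<lambda>i j k. c k \<circ> a i \<circ> b j)"
    unfolding Q_def m3.scale_scale[symmetric] act3_comm23[OF bc Eo_lin[OF a]]
    by (simp only: m3.scale_left_commute[of "ev2 v1 v3 q"] act3_comm13[OF ac])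
  then have QG: "act3 sc Q G = 0"
    by (simp only: G_def m3.scale_right_diff_distrib diff_self)
  have slice: "rot G k = (\<lambda>m n. prod2 a b m n \<circ> c k) + (\<lambda>m n. sc (-1) (c k \<circ> prod2 a b m n))" for k
    by (simp add: G_def rot_def prod3_def prod2_def fun_eq_iff fscale_def)
  have GQ: "rot G k \<in> QH" for k
    unfolding slice by (intro QH_add QH_scale QH_comp ab Eo_lin c)
  define d where "d = T (prod2 a b)"
  define D where "D = (\<lambda>m j k. (d m j \<circ> c k) - (c k \<circ> d m j))"
  have TG: "T23 (rot G) = rot D"
  proof -
    have "T (rot G k) = (\<lambda>m n. T (prod2 a b) m n \<circ> c k) + (\<lambda>m n. sc (-1) (c k \<circ> T (prod2 a b) m n))" for k
      unfolding slice
      by (simp only: T_add QH_comp QH_scale ab Eo_lin[OF c] T_comp T_scale)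
    note TG = this
    have "T23 (rot G) k = rot D k" for k
      unfolding T23_def TG by (simp add: rot_def D_def d_def fun_eq_iff fscale_def)
    then show ?thesis ..
  qed
  have "act3 sc (ev3 v2 v3 v1 Q) (rot G) = 0"
    using QG act3_permute(2)[of Q G] by (simp add: rot_def fun_eq_iff)
  moreover have "T23 (act3 sc (ev3 v2 v3 v1 Q) (rot G)) = act3 sc (ev3 v1 (v2 + v3) v3 (ev3 v2 v3 v1 Q)) (rot D)"
    using T23_act3[of "rot G", OF GQ] unfolding TG by blast
  moreover have "T23 0 = 0"
    unfolding T23_def zero_fun_apply T_0 by (simp only: zero_fun_def)
  ultimately have "act3 sc (ev3 v1 (v2 + v3) v3 (ev3 v2 v3 v1 Q)) (rot D) = 0"
    by simp
  then have "act3 sc (ev3 v3 v1 v2 (ev3 v1 (v2 + v3) v3 (ev3 v2 v3 v1 Q))) (unrot (rot D)) = 0"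
    using act3_permute(3)[of "ev3 v1 (v2 + v3) v3 (ev3 v2 v3 v1 Q)" "rot D"]
    by (simp add: unrot_def fun_eq_iff)
  moreover have "ev3 v3 v1 v2 (ev3 v1 (v2 + v3) v3 (ev3 v2 v3 v1 Q)) = ev2 (v1 + v2) v3 q * ev2 v2 v3 q"
    by (simp add: Q_def)
  moreover have "unrot (rot D) = D"
    by (simp add: rot_def unrot_def)
  ultimately have "act3 sc (ev2 (v1 + v2) v3 q * ev2 v2 v3 q) D = 0"
    by simp
  \<comment> \<open>The same action, read as that of a polynomial in x_0 whose coefficients act on
    series in x_2, x_3.\<close>
  then have *: "pact act2 (ev2 (v1 + v2) v3 q * ev2 v2 v3 q) D = 0"
    unfolding poly_times_pact .
  obtain M where M: "\<forall>k<M. d k = 0"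
    using LEo_D(2)[OF T_LEo[OF ab]] unfolding d_def by blast
  have "D m = 0" if "m < M" for m
    using M that by (simp add: D_def fun_eq_iff lin_0 Eo_lin[OF c])
  then obtain k where "act2 (coeff (ev2 (v1 + v2) v3 q * ev2 v2 v3 q) 0 ^ k) (D m) = 0"
    using m2.lowest_term_kills[OF _ *] by blast
  then have "act2 ((q * q) ^ k) (prod2 (d m) c - (\<lambda>j k. c k \<circ> d m j)) = 0"
    by (simp add: coeff_mult_0 coeff_0_ev2 D_def prod2_def fun_diff_def)
  then have "comm_by ((q * q) ^ k) (d m) c"
    unfolding comm_by_def by (simp only: m2.scale_right_diff_distrib right_minus_eq)
  then show ?thesis
    by (auto simp: d_def Y_Eo_T)
qed

subsection \<open>Comparison of the two substitutions\<close>

lemma subst_both_formula: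
  assumes N: "bounded3 F w N" and L: "L \<le> n + int k + int m - 2 * N"
  shows "subst_both F (int k) (int m) n w = (\<Sum>i\<in>{L..N}. \<Sum>j\<in>{L..N}.
    s ((of_int i gchoose k) * (of_int j gchoose m)) (F i j (n + int k + int m - i - j) w))"
proof -
  have b: "bounded2 (F i) w N" for i
    using N by (auto simp: bounded2_def bounded3_def)
  have 0: "subst_add s (F i) m' n w = 0" if "i > N" for i m' n
    by (rule bounded2_subst[of _ w "- \<bar>m'\<bar> - \<bar>n\<bar> - 1"])
      (use N that in \<open>auto simp: bounded2_def bounded3_def\<close>)
  have "subst_both F (int k) (int m) n w =
      (\<Sum>i\<in>{L..N}. s (of_int i gchoose k) (subst_add s (F i) (int m) (n + int k - i) w))"
    unfolding subst_both_def
  proof (rule subst_eq_sum)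
    fix i assume "i \<notin> {L..N}"
    then consider "i > N" | "i < L" by fastforce
    then show "subst_add s (F i) (int m) (n + int k - i) w = 0"
    proof cases
      case 2
      then show ?thesis
        using L by (intro bounded2_subst[OF b]) simp
    qed (rule 0)
  qed simp
  also have "\<dots> = (\<Sum>i\<in>{L..N}. \<Sum>j\<in>{L..N}.
    s ((of_int i gchoose k) * (of_int j gchoose m)) (F i j (n + int k + int m - i - j) w))"
  proof (rule sum.cong[OF refl])
    fix i assume i: "i \<in> {L..N}"
    have "subst_add s (F i) (int m) (n + int k - i) w =
        (\<Sum>j\<in>{L..N}. s (of_int j gchoose m) (F i j (n + int k - i + int m - j) w))"
      using i L by (intro subst_formula[OF b]) auto
    then show "s (of_int i gchoose k) (subst_add s (F i) (int m) (n + int k - i) w) =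
        (\<Sum>j\<in>{L..N}. s ((of_int i gchoose k) * (of_int j gchoose m)) (F i j (n + int k + int m - i - j) w))"
      by (simp add: scale_sum_right algebra_simps)
  qed
  finally show ?thesis .
qed

lemma subst_both_neg: "k < 0 \<or> m < 0 \<Longrightarrow> subst_both F k m n = 0"
  unfolding subst_both_def using subst_add_add[OF Hom2_0 Hom2_0]
  by (auto simp: subst_neg fun_eq_iff)
    (simp add: subst_add_def diagonal_def deriv1_power fscale_def zero_fun_def)

lemma subst_both_swap:
  assumes "F \<in> Hom3"
  shows "subst_both (swap12 F) = swap12 (subst_both F)"
proof (intro ext)
  fix k m n w
  obtain N where N: "bounded3 F w N"
    using Hom3_bounded[OF assms] by blast
  then have N': "bounded3 (swap12 F) w N"
    by (auto simp: bounded3_def swap12_def)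
  show "subst_both (swap12 F) k m n w = swap12 (subst_both F) k m n w"
  proof (cases "k < 0 \<or> m < 0")
    case True
    then show ?thesis
      by (auto simp: subst_both_neg swap12_def)
  next
    case False
    then obtain k' m' where "k = int k'" "m = int m'"
      by (metis not_less zero_le_imp_eq_int)
    then show ?thesis
      unfolding swap12_def[of "subst_both F"]
      using subst_both_formula[OF N order_refl, where n = n and k = m' and m = k']
        subst_both_formula[OF N' order_refl, where n = n and k = k' and m = m']
      by (simp add: swap12_def algebra_simps) (subst sum.swap, simp add: algebra_simps)
  qed
qed

lemma subst_chain_formula:
  assumes N: "bounded3 F w N" and L: "L = l + int m + int n - 2 * N"
  shows "subst_chain F (int m) (int n) l w = (\<Sum>i\<in>{L..N}. \<Sum>j\<in>{L..N}.
    s ((of_int i gchoose m) * (of_int (i + j - int m) gchoose n)) (F i j (l + int m + int n - i - j) w))"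
proof -
  have b: "bounded2 (\<lambda>i j. F i j k) w N" for k
    using N by (auto simp: bounded2_def bounded3_def)
  have 0: "subst_add s (\<lambda>i j. F i j k) m' n w = 0" if "k > N" for k m' n
    by (rule bounded2_subst[of _ w "- \<bar>m'\<bar> - \<bar>n\<bar> - 1"])
      (use N that in \<open>auto simp: bounded2_def bounded3_def\<close>)
  \<comment> \<open>The range of the intermediate exponent of x_2 after the first substitution.
    Above it \<open>bounded2_subst\<close> gives zero; below it the exponent of the third variable
    exceeds \<open>N\<close>.\<close>
  define J where "J = {l + int n - N..2 * N - int m}"
  define h where "h = (\<lambda>i j. s ((of_int j gchoose n) * (of_int i gchoose m)) (F i (j + int m - i) (l + int n - j) w))"
  have "subst_chain F (int m) (int n) l w =
      (\<Sum>j\<in>J. s (of_int j gchoose n) (subst_add s (\<lambda>i j'. F i j' (l + int n - j)) (int m) j w))"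
    unfolding subst_chain_def
  proof (rule subst_eq_sum)
    fix j assume "j \<notin> J"
    then consider "j > 2 * N - int m" | "l + int n - j > N" unfolding J_def by fastforce
    then show "subst_add s (\<lambda>i j'. F i j' (l + int n - j)) (int m) j w = 0"
    proof cases
      case 1
      then show ?thesis
        by (intro bounded2_subst[OF b]) simp
    qed (rule 0)
  qed (simp add: J_def)
  also have "\<dots> = (\<Sum>j\<in>J. \<Sum>i\<in>{L..N}. h i j)"
  proof (rule sum.cong[OF refl])
    fix j assume j: "j \<in> J"
    have "subst_add s (\<lambda>i j'. F i j' (l + int n - j)) (int m) j w =
        (\<Sum>i\<in>{L..N}. s (of_int i gchoose m) (F i (j + int m - i) (l + int n - j) w))"
      using j L by (intro subst_formula[OF b]) (auto simp: J_def)
    then show "s (of_int j gchoose n) (subst_add s (\<lambda>i j'. F i j' (l + int n - j)) (int m) j w) =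
        (\<Sum>i\<in>{L..N}. h i j)"
      by (simp add: scale_sum_right h_def)
  qed
  also have "\<dots> = (\<Sum>i\<in>{L..N}. \<Sum>j\<in>J. h i j)"
    by (rule sum.swap)
  also have "\<dots> = (\<Sum>i\<in>{L..N}. \<Sum>j\<in>{L..N}.
    s ((of_int i gchoose m) * (of_int (i + j - int m) gchoose n)) (F i j (l + int m + int n - i - j) w))"
  proof (rule sum.cong[OF refl])
    fix i assume i: "i \<in> {L..N}"
    have nz: "j + int m - i \<le> N \<and> l + int n - j \<le> N" if "h i j \<noteq> 0" for j
    proof -
      have "F i (j + int m - i) (l + int n - j) w \<noteq> 0"
        using that by (auto simp: h_def)
      then show ?thesis
        using N unfolding bounded3_def by (meson not_le)
    qed
    have "(\<Sum>j\<in>J. h i j) = Sum_any (h i)"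
    proof (rule Sum_any.expand_superset[symmetric])
      show "{j. h i j \<noteq> 0} \<subseteq> J"
      proof
        fix j assume "j \<in> {j. h i j \<noteq> 0}"
        then show "j \<in> J"
          using nz[of j] i by (simp add: J_def)
      qed
    qed (simp add: J_def)
    \<comment> \<open>From the intermediate exponent of x_2 back to the exponent of x_2 in
      \<open>F\<close>.\<close>
    also have "\<dots> = Sum_any (\<lambda>j. h i (j + i - int m))"
    proof (rule Sum_any.reindex_cong)
      show "bij (\<lambda>j. j + i - int m)"
        by (rule o_bij[of "\<lambda>j. j - i + int m"]) (auto simp: fun_eq_iff)
    qed (simp add: fun_eq_iff)
    also have "\<dots> = (\<Sum>j\<in>{L..N}. h i (j + i - int m))"
    proof (rule Sum_any.expand_superset)
      show "{j. h i (j + i - int m) \<noteq> 0} \<subseteq> {L..N}"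
        using nz[of "_ + i - int m"] i L by fastforce
    qed simp
    finally show "(\<Sum>j\<in>J. h i j) = (\<Sum>j\<in>{L..N}.
        s ((of_int i gchoose m) * (of_int (i + j - int m) gchoose n)) (F i j (l + int m + int n - i - j) w))"
      by (simp add: h_def algebra_simps)
  qed
  finally show ?thesis .
qed

lemma subst_chain_neg: "m < 0 \<or> n < 0 \<Longrightarrow> subst_chain F m n l = 0"
  unfolding subst_chain_def
  by (auto simp: subst_neg fun_eq_iff)
    (simp add: subst_add_def diagonal_def deriv1_power fscale_def zero_fun_def)

text \<open>The substitution \<open>y\<^sub>1 = x\<^sub>0 + y\<^sub>2\<close>, expanded in nonnegative powers of \<open>y\<^sub>2\<close>.\<close>

definition merge :: "(int \<Rightarrow> int \<Rightarrow> int \<Rightarrow> 'w \<Rightarrow> 'w) \<Rightarrow> int \<Rightarrow> int \<Rightarrow> int \<Rightarrow> 'w \<Rightarrow> 'w" where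
  "merge X = (\<lambda>m n. Sum_any (\<lambda>k::nat.
     fscale sc (of_int (m + int k) gchoose k) (X (m + int k) (n - int k))))"

lemma Y_shift_merge: "Y_shift (fscale sc) Y a b c = merge (\<lambda>m n. Y a m (Y b n c))"
  by (simp add: Y_shift_def merge_def)

lemma merge_formula:
  assumes M: "\<And>m n. n < M \<Longrightarrow> X m n = 0" and K: "n - M \<le> int K"
  shows "merge X m n l = (\<Sum>k\<le>K. sc (of_int (m + int k) gchoose k) (X (m + int k) (n - int k) l))"
proof -
  have "merge X m n = (\<Sum>k\<le>K. fscale sc (of_int (m + int k) gchoose k) (X (m + int k) (n - int k)))"
    unfolding merge_def
  proof (rule Sum_any.expand_superset)
    show "{k. fscale sc (of_int (m + int k) gchoose k) (X (m + int k) (n - int k)) \<noteq> 0} \<subseteq> {..K}"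
    proof
      fix k assume k: "k \<in> {k. fscale sc (of_int (m + int k) gchoose k) (X (m + int k) (n - int k)) \<noteq> 0}"
      have "\<not> n - int k < M"
      proof
        assume "n - int k < M"
        then have "X (m + int k) (n - int k) = 0"
          by (rule M)
        with k show False by (simp add: fscale_def fun_eq_iff)
      qed
      with K show "k \<in> {..K}" by simp
    qed
  qed simp
  then show ?thesis
    by (simp add: sum_fun_apply fscale_def)
qed

text \<open>Putting y_1 = x_0 + y_2 into (y_1 + x)^i (y_2 + x)^j gives (x_0 + y_2 + x)^i (y_2 +
  x)^j, and so does the chain; coefficientwise this is \<open>gbinomial_chain\<close>.\<close>

lemma merge_subst_both:
  assumes "F \<in> Hom3"
  shows "merge (subst_both F) = subst_chain F"
proof (intro ext)
  fix m n l w
  have M: "subst_both F m n = 0" if "n < 0" for m n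
    using that subst_both_neg[of m n F] by (simp add: fun_eq_iff)
  have merge: "merge (subst_both F) m n l w =
      (\<Sum>k\<le>nat n. s (of_int (m + int k) gchoose k) (subst_both F (m + int k) (n - int k) l w))"
    using merge_formula[where X = "subst_both F" and M = 0 and n = n and K = "nat n", OF M]
    by (simp add: sum_fun_apply fscale_def)
  show "merge (subst_both F) m n l w = subst_chain F m n l w"
  proof (cases "m < 0 \<or> n < 0")
    case True
    \<comment> \<open>If neither index of \<open>subst_both\<close> is negative, then m is, so 0 <=
      m + k < k and the binomial coefficient vanishes.\<close>
    have "s (of_int (m + int k) gchoose k) (subst_both F (m + int k) (n - int k) l w) = 0" for k
    proof (cases "m + int k < 0 \<or> n - int k < 0")
      case True
      then show ?thesis by (simp add: subst_both_neg)
    next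
      case False
      with True have "0 \<le> m + int k" "m + int k < int k" by auto
      then show ?thesis by (simp only: gbinomial_zero_of_int scale_zero_left)
    qed
    then have "merge (subst_both F) m n l w = 0"
      unfolding merge by (intro sum.neutral ballI)
    with True show ?thesis
      by (simp add: subst_chain_neg)
  next
    case False
    then obtain m' n' where mn: "m = int m'" "n = int n'"
      by (metis not_less zero_le_imp_eq_int)
    obtain N where N: "bounded3 F w N"
      using Hom3_bounded[OF assms] by blast
    define L where "L = l + int m' + int n' - 2 * N"
    define G where "G = (\<lambda>i j. F i j (l + int m' + int n' - i - j) w)"
    have "merge (subst_both F) m n l w = (\<Sum>k\<le>n'. \<Sum>i\<in>{L..N}. \<Sum>j\<in>{L..N}.
        s ((of_nat (m' + k) gchoose k) * ((of_int i gchoose (m' + k)) * (of_int j gchoose (n' - k)))) (G i j))"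
      unfolding merge unfolding mn nat_int
    proof (rule sum.cong[OF refl])
      fix k assume "k \<in> {..n'}"
      then have k: "int n' - int k = int (n' - k)" "int m' + int k = int (m' + k)"
        by auto
      have "subst_both F (int (m' + k)) (int (n' - k)) l w = (\<Sum>i\<in>{L..N}. \<Sum>j\<in>{L..N}.
          s ((of_int i gchoose (m' + k)) * (of_int j gchoose (n' - k))) (F i j (l + int (m' + k) + int (n' - k) - i - j) w))"
        by (rule subst_both_formula[OF N]) (simp add: L_def k[symmetric])
      also have "\<dots> = (\<Sum>i\<in>{L..N}. \<Sum>j\<in>{L..N}.
          s ((of_int i gchoose (m' + k)) * (of_int j gchoose (n' - k))) (G i j))"
        unfolding G_def k[symmetric] by (simp add: algebra_simps)
      finally show "s (of_int (int m' + int k) gchoose k) (subst_both F (int m' + int k) (int n' - int k) l w) =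
          (\<Sum>i\<in>{L..N}. \<Sum>j\<in>{L..N}.
          s ((of_nat (m' + k) gchoose k) * ((of_int i gchoose (m' + k)) * (of_int j gchoose (n' - k)))) (G i j))"
        unfolding k by (simp only: scale_sum_right scale_scale of_int_of_nat_eq)
    qed
    also have "\<dots> = (\<Sum>i\<in>{L..N}. \<Sum>j\<in>{L..N}. \<Sum>k\<le>n'.
        s ((of_nat (m' + k) gchoose k) * ((of_int i gchoose (m' + k)) * (of_int j gchoose (n' - k)))) (G i j))"
      by (subst sum.swap, rule sum.cong[OF refl], rule sum.swap)
    also have "\<dots> = (\<Sum>i\<in>{L..N}. \<Sum>j\<in>{L..N}.
        s ((of_int i gchoose m') * (of_int (i + j - int m') gchoose n')) (G i j))"
      unfolding scale_sum_left[symmetric] gbinomial_chain by simp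
    also have "\<dots> = subst_chain F (int m') (int n') l w"
      unfolding G_def by (rule subst_chain_formula[OF N L_def, symmetric])
    finally show ?thesis by (simp add: mn)
  qed
qed

definition lower2 :: "(int \<Rightarrow> int \<Rightarrow> int \<Rightarrow> 'w \<Rightarrow> 'w) set" where
  "lower2 = {X. \<exists>M. \<forall>m n. n < M \<longrightarrow> X m n = 0}"

text \<open>On \<open>lower2\<close> only finitely many \<open>k\<close> contribute. The case with
  content is multiplication by y_1, which becomes x_0 + y_2 by Pascal's rule.\<close>

lemma merge_act3:
  assumes "X \<in> lower2"
  shows "merge (act3 sc f X) = act3 sc (ev3 (v1 + v2) v2 v3 f) (merge X)"
proof -
  have "act3 sc f X \<in> lower2 \<and> merge (act3 sc f X) = act3 sc (ev3 (v1 + v2) v2 v3 f) (merge X)"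
  proof (rule intertwine3[OF m3.module_axioms m3.module_axioms])
    fix A B assume A: "A \<in> lower2" and B: "B \<in> lower2"
    obtain M1 M2 where "\<forall>m n. n < M1 \<longrightarrow> A m n = 0" "\<forall>m n. n < M2 \<longrightarrow> B m n = 0"
      using A B unfolding lower2_def by blast
    then have *: "A m n = 0" "B m n = 0" "(A + B) m n = 0" if "n < min M1 M2" for m n
      using that by simp_all
    then show "A + B \<in> lower2"
      unfolding lower2_def by blast
    show "merge (A + B) = merge A + merge B"
    proof (intro ext)
      fix m n l w
      define K where "K = nat (n - min M1 M2)"
      have K: "n - min M1 M2 \<le> int K"
        unfolding K_def by linarith
      have 1: "merge A m n l = (\<Sum>k\<le>K. sc (of_int (m + int k) gchoose k) (A (m + int k) (n - int k) l))"
        by (rule merge_formula[OF *(1) K])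
      have 2: "merge B m n l = (\<Sum>k\<le>K. sc (of_int (m + int k) gchoose k) (B (m + int k) (n - int k) l))"
        by (rule merge_formula[OF *(2) K])
      have "merge (A + B) m n l = (\<Sum>k\<le>K. sc (of_int (m + int k) gchoose k) ((A + B) (m + int k) (n - int k) l))"
        by (rule merge_formula[OF *(3) K])
      then have "merge (A + B) m n l = merge A m n l + merge B m n l"
        unfolding 1 2 by (simp add: m0.scale_right_distrib sum.distrib)
      then show "merge (A + B) m n l w = (merge A + merge B) m n l w"
        by (simp only: plus_fun_apply)
    qed
  next
    fix A c assume A: "A \<in> lower2"
    obtain M where M: "\<And>m n. n < M \<Longrightarrow> A m n = 0"
      using A unfolding lower2_def by blast
    have *: "(\<lambda>l. sc c (A m n l)) = 0" if "n < M" for m n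
      using M[OF that] by (simp add: fun_eq_iff fscale_def)
    then show "act3 sc (c3 c) A \<in> lower2"
      unfolding lower2_def act3_gens by blast
    show "merge (act3 sc (c3 c) A) = act3 sc (c3 c) (merge A)"
      unfolding act3_gens
    proof (intro ext)
      fix m n l w
      show "merge (\<lambda>i j k. sc c (A i j k)) m n l w = sc c (merge A m n l) w"
        using merge_formula[where X = A and n = n and K = "nat (n - M)", OF M, where m = m and l = l]
          merge_formula[where X = "\<lambda>i j k. sc c (A i j k)" and n = n and K = "nat (n - M)", OF *, where m = m and l = l]
        by (simp add: m0.scale_sum_right m0.scale_left_commute mult.commute)
    qed
  next
    fix A assume A: "A \<in> lower2"
    obtain M where M: "\<And>m n. n < M \<Longrightarrow> A m n = 0"
      using A unfolding lower2_def by blast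
    have *: "(\<lambda>l. A m n (l - 1)) = 0" if "n < M" for m n
      using M[OF that] by (simp add: fun_eq_iff)
    then show "act3 sc v3 A \<in> lower2"
      unfolding lower2_def act3_gens by blast
    show "merge (act3 sc v3 A) = act3 sc v3 (merge A)"
      unfolding act3_gens
    proof (intro ext)
      fix m n l w
      show "merge (\<lambda>i j k. A i j (k - 1)) m n l w = merge A m n (l - 1) w"
        using merge_formula[where X = A and n = n and K = "nat (n - M)", OF M, where m = m and l = "l - 1"]
          merge_formula[where X = "\<lambda>i j k. A i j (k - 1)" and n = n and K = "nat (n - M)", OF *, where m = m and l = l]
        by simp
    qed
  next
    fix A assume A: "A \<in> lower2"
    obtain M where M: "\<And>m n. n < M \<Longrightarrow> A m n = 0"
      using A unfolding lower2_def by blast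
    have *: "A m (n - 1) = 0" if "n < M" for m n
      using M that by simp
    then show "act3 sc v2 A \<in> lower2"
      unfolding lower2_def act3_gens by blast
    show "merge (act3 sc v2 A) = act3 sc v2 (merge A)"
      unfolding act3_gens
    proof (intro ext)
      fix m n l w
      show "merge (\<lambda>i j k. A i (j - 1) k) m n l w = merge A m (n - 1) l w"
        using merge_formula[where X = A and n = "n - 1" and K = "nat (n - M)", OF M, where m = m and l = l]
          merge_formula[where X = "\<lambda>i j k. A i (j - 1) k" and n = n and K = "nat (n - M)", OF *, where m = m and l = l]
        by (simp add: algebra_simps)
    qed
  next
    fix A assume A: "A \<in> lower2"
    obtain M where M: "\<And>m n. n < M \<Longrightarrow> A m n = 0"
      using A unfolding lower2_def by blast
    have *: "A (m - 1) n = 0" if "n < M" for m n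
      using M that by simp
    then show "act3 sc v1 A \<in> lower2"
      unfolding lower2_def act3_gens by blast
    show "merge (act3 sc v1 A) = act3 sc (v1 + v2) (merge A)"
      unfolding act3_gens m3.scale_left_distrib
    proof (intro ext)
      fix m n l w
      define K where "K = nat (n - M)"
      \<comment> \<open>The sums at y_2-exponent n get one term more than the sum at n - 1;
        splitting off k = 0 then aligns them.\<close>
      have K: "n - M \<le> int K" "n - M \<le> int (Suc K)" "n - 1 - M \<le> int K"
        by (simp_all add: K_def)
      have 1: "merge (\<lambda>i j k. A (i - 1) j k) m n l = (\<Sum>k\<le>Suc K. sc (of_int (m + int k) gchoose k) (A (m + int k - 1) (n - int k) l))"
        by (rule merge_formula[OF * K(2)])
      have 2: "merge A (m - 1) n l = (\<Sum>k\<le>Suc K. sc (of_int (m - 1 + int k) gchoose k) (A (m - 1 + int k) (n - int k) l))"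
        by (rule merge_formula[OF M K(2)])
      have 3: "merge A m (n - 1) l = (\<Sum>k\<le>K. sc (of_int (m + int k) gchoose k) (A (m + int k) (n - 1 - int k) l))"
        by (rule merge_formula[OF M K(3)])
      have "1 + (of_int m + of_nat i) gchoose Suc i =
          ((of_int m + of_nat i) gchoose i) + ((of_int m + of_nat i :: complex) gchoose Suc i)" for i
        using gbinomial_Suc_Suc[of "of_int m + of_nat i" i] by (simp only: add.commute)
      then have "merge (\<lambda>i j k. A (i - 1) j k) m n l = merge A (m - 1) n l + merge A m (n - 1) l"
        unfolding 1 2 3 sum.atMost_Suc_shift
        by (simp add: algebra_simps m0.scale_left_distrib sum.distrib[symmetric] del: sum.atMost_Suc)
      then show "merge (\<lambda>i j k. A (i - 1) j k) m n l w =
          ((\<lambda>i j k. merge A (i - 1) j k) + (\<lambda>i j k. merge A i (j - 1) k)) m n l w"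
        by simp
    qed
  qed (use assms in simp)
  then show ?thesis by blast
qed

subsection \<open>Cancellation\<close>

text \<open>This space contains both \<open>Eo((y\<^sub>1))((y\<^sub>2))\<close> and \<open>Eo((y\<^sub>2))((y\<^sub>1))\<close>. A polynomial in
  \<open>y\<^sub>1, y\<^sub>2, x\<close> whose constant term in \<open>y\<^sub>1, y\<^sub>2\<close> is nonzero acts injectively on it: look at
  a nonzero coefficient that is minimal for the product order.\<close>

definition DF :: "(int \<Rightarrow> int \<Rightarrow> int \<Rightarrow> 'w \<Rightarrow> 'w) set" where
  "DF = {D. (\<forall>i j. D i j \<in> Eo s) \<and> (\<forall>i j. finite {(i', j'). i' \<le> i \<and> j' \<le> j \<and> D i' j' \<noteq> 0})}"

lemma DF_finite: "D \<in> DF \<Longrightarrow> finite {(i', j'). i' \<le> i \<and> j' \<le> j \<and> D i' j' \<noteq> 0}"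
  by (simp add: DF_def)

lemma DF_cancel:
  assumes D: "D \<in> DF" and u: "coeff (coeff u 0) 0 \<noteq> 0" and 0: "act3 sc u D = 0"
  shows "D = 0"
proof (rule ccontr)
  assume "D \<noteq> 0"
  then have "\<exists>i0 j0. D i0 j0 \<noteq> 0"
    by (metis ext zero_fun_apply)
  then obtain i0 j0 where ij0: "D i0 j0 \<noteq> 0"
    by blast
  define S where "S = {(i', j'). i' \<le> i0 \<and> j' \<le> j0 \<and> D i' j' \<noteq> 0}"
  have "finite S" "(i0, j0) \<in> S"
    using D ij0 by (simp_all add: S_def DF_finite)
  \<comment> \<open>A pair with least i + j is minimal for the product order, so only the constant
    term of \<open>u\<close> contributes to the coefficient of the product at (i,j).\<close>
  then obtain x where x: "x \<in> S" "\<And>y. y \<in> S \<Longrightarrow> fst x + snd x \<le> fst y + snd y"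
    using ex_is_arg_min_if_finite[of S "\<lambda>x. fst x + snd x"] unfolding is_arg_min_linorder by blast
  obtain i j where ij: "x = (i, j)"
    by fastforce
  have min: "D i' j' = 0" if "i' \<le> i" "j' \<le> j" "(i', j') \<noteq> (i, j)" for i' j'
  proof (rule ccontr)
    assume "D i' j' \<noteq> 0"
    then have "(i', j') \<in> S"
      using that x(1) by (simp add: ij S_def)
    from x(2)[OF this] that show False
      by (auto simp: ij)
  qed
  have "act3 sc u D i j = (\<Sum>k\<le>degree u. \<Sum>l\<le>degree (coeff u k). act1 (coeff (coeff u k) l) (D (i - int k) (j - int l)))"
    by (simp add: pact_def[of "pact act1"] pact_def[of act1] sum_fun_apply)
  also have "\<dots> = (\<Sum>k\<in>{0}. \<Sum>l\<le>degree (coeff u k). act1 (coeff (coeff u k) l) (D (i - int k) (j - int l)))"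
  proof (rule sum.mono_neutral_right)
    show "\<forall>k\<in>{..degree u} - {0}. (\<Sum>l\<le>degree (coeff u k). act1 (coeff (coeff u k) l) (D (i - int k) (j - int l))) = 0"
      by (intro ballI sum.neutral) (simp add: min m1.scale_zero_right)
  qed auto
  also have "\<dots> = (\<Sum>l\<le>degree (coeff u 0). act1 (coeff (coeff u 0) l) (D i (j - int l)))"
    by simp
  also have "\<dots> = (\<Sum>l\<in>{0}. act1 (coeff (coeff u 0) l) (D i (j - int l)))"
    by (rule sum.mono_neutral_right) (auto simp: min m1.scale_zero_right)
  finally have "act1 (coeff (coeff u 0) 0) (D i j) = 0"
    using 0 by simp
  moreover have "D i j \<in> Eo s"
    using D by (simp add: DF_def)
  ultimately have "D i j = 0"
    using u by (intro Eo_torsion_free[of "D i j"])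
  with x(1) show False
    by (simp add: ij S_def)
qed

lemma DF_act3:
  assumes "D \<in> DF"
  shows "act3 sc f D \<in> DF"
proof -
  have sub: "finite S \<Longrightarrow> T \<subseteq> S \<Longrightarrow> finite T" for S T :: "(int \<times> int) set"
    by (rule finite_subset)
  show ?thesis
  proof (rule act3_closed)
    fix A B assume A: "A \<in> DF" and B: "B \<in> DF"
    have "finite {(i', j'). i' \<le> i \<and> j' \<le> j \<and> (A + B) i' j' \<noteq> 0}" for i j
      by (rule sub[OF finite_UnI[OF DF_finite[OF A, of i j] DF_finite[OF B, of i j]]]) auto
    with A B show "A + B \<in> DF"
      unfolding DF_def mem_Collect_eq by (simp only: plus_fun_apply Eo_add simp_thms)
  next
    fix A c assume A: "A \<in> DF"
    have "finite {(i', j'). i' \<le> i \<and> j' \<le> j \<and> (\<lambda>k. sc c (A i' j' k)) \<noteq> 0}" for i j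
      by (rule sub[OF DF_finite[OF A, of i j]]) (auto simp: fscale_def fun_eq_iff)
    with A show "(\<lambda>i j k. sc c (A i j k)) \<in> DF"
      unfolding DF_def using Eo_scale[of _ c] by (simp add: fscale_def[of sc])
  next
    fix A assume A: "A \<in> DF"
    have "(\<lambda>k. A i j (k - 1)) \<noteq> 0 \<Longrightarrow> A i j \<noteq> 0" for i j
      by (auto simp: fun_eq_iff)
    then have "finite {(i', j'). i' \<le> i \<and> j' \<le> j \<and> (\<lambda>k. A i' j' (k - 1)) \<noteq> 0}" for i j
      by (intro sub[OF DF_finite[OF A, of i j]]) blast
    with A show "(\<lambda>i j k. A i j (k - 1)) \<in> DF"
      unfolding DF_def by (simp add: Eo_shift)
  next
    fix A assume A: "A \<in> DF"
    have "finite {(i', j'). i' \<le> i \<and> j' \<le> j \<and> A i' (j' - 1) \<noteq> 0}" for i j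
    proof (rule sub[OF finite_imageI[OF DF_finite[OF A, of i "j - 1"], of "\<lambda>(i, j). (i, j + 1)"]])
      show "{(i', j'). i' \<le> i \<and> j' \<le> j \<and> A i' (j' - 1) \<noteq> 0} \<subseteq>
          (\<lambda>(i, j). (i, j + 1)) ` {(i', j'). i' \<le> i \<and> j' \<le> j - 1 \<and> A i' j' \<noteq> 0}"
        by (force simp: image_iff)
    qed
    with A show "(\<lambda>i j k. A i (j - 1) k) \<in> DF"
      unfolding DF_def by simp
  next
    fix A assume A: "A \<in> DF"
    have "finite {(i', j'). i' \<le> i \<and> j' \<le> j \<and> A (i' - 1) j' \<noteq> 0}" for i j
    proof (rule sub[OF finite_imageI[OF DF_finite[OF A, of "i - 1" j], of "\<lambda>(i, j). (i + 1, j)"]])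
      show "{(i', j'). i' \<le> i \<and> j' \<le> j \<and> A (i' - 1) j' \<noteq> 0} \<subseteq>
          (\<lambda>(i, j). (i + 1, j)) ` {(i', j'). i' \<le> i - 1 \<and> j' \<le> j \<and> A i' j' \<noteq> 0}"
        by (force simp: image_iff)
    qed
    with A show "(\<lambda>i j k. A (i - 1) j k) \<in> DF"
      unfolding DF_def by simp
  qed (rule assms)
qed

lemma DF_diff:
  assumes A: "A \<in> DF" and B: "B \<in> DF"
  shows "A - B \<in> DF"
proof -
  have "finite {(i', j'). i' \<le> i \<and> j' \<le> j \<and> (A - B) i' j' \<noteq> 0}" for i j
    by (rule finite_subset[OF _ finite_UnI[OF DF_finite[OF A, of i j] DF_finite[OF B, of i j]]]) auto
  with A B show "A - B \<in> DF"
    unfolding DF_def mem_Collect_eq by (simp only: fun_diff_def Eo_diff[unfolded fun_diff_def] simp_thms)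
qed

text \<open>The hypotheses describe Eo((y_1))((y_2)): a lower-left quadrant meets finitely many
  relevant rows j, and each row is bounded below.\<close>

lemma DF_I:
  assumes "\<And>i j. D i j \<in> Eo s" and "\<And>i j. j < N \<Longrightarrow> D i j = 0" and "\<And>j. \<exists>M. \<forall>i<M. D i j = 0"
  shows "D \<in> DF"
proof -
  have "finite {(i', j'). i' \<le> i \<and> j' \<le> j \<and> D i' j' \<noteq> 0}" for i j
  proof -
    have "\<exists>M. \<forall>j'\<in>{N..j}. \<forall>i. i < - M \<longrightarrow> D i j' = 0"
    proof (rule ex_uniform_bound)
      fix j' show "\<exists>M. \<forall>i. i < - M \<longrightarrow> D i j' = 0"
        using assms(3)[of j'] by (metis minus_minus)
    qed auto
    then obtain M where M: "\<forall>j'\<in>{N..j}. \<forall>i. i < - M \<longrightarrow> D i j' = 0" ..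
    show ?thesis
    proof (rule finite_subset)
      show "{(i', j'). i' \<le> i \<and> j' \<le> j \<and> D i' j' \<noteq> 0} \<subseteq> {- M..i} \<times> {N..j}"
        using assms(2) M by (fastforce simp: not_le[symmetric])
    qed simp
  qed
  with assms(1) show ?thesis
    by (simp add: DF_def)
qed

lemma DF_swap:
  assumes D: "D \<in> DF"
  shows "swap12 D \<in> DF"
proof -
  have "finite {(i', j'). i' \<le> i \<and> j' \<le> j \<and> swap12 D i' j' \<noteq> 0}" for i j
  proof (rule finite_subset[OF _ finite_imageI[OF DF_finite[OF D, of j i], of prod.swap]])
    show "{(i', j'). i' \<le> i \<and> j' \<le> j \<and> swap12 D i' j' \<noteq> 0} \<subseteq>
        prod.swap ` {(i', j'). i' \<le> j \<and> j' \<le> i \<and> D i' j' \<noteq> 0}"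
      by (force simp: swap12_def image_iff)
  qed
  with D show ?thesis
    by (simp add: DF_def swap12_def)
qed

lemma act3_v1_power_0: "act3 sc (v1 ^ k) A = 0 \<Longrightarrow> A = 0"
proof (induction k)
  case (Suc k)
  then have "act3 sc v1 (act3 sc (v1 ^ k) A) = 0"
    by (simp only: m3.scale_scale power_Suc)
  then have "act3 sc (v1 ^ k) A (i - 1) = 0" for i
    by (metis act3_gens(2) zero_fun_apply)
  from this[of "_ + 1"] have "act3 sc (v1 ^ k) A = 0"
    by (simp add: fun_eq_iff)
  then show ?case by (rule Suc.IH)
qed (simp add: m3.scale_one)

lemma act3_v2_power_0: "act3 sc (v2 ^ k) A = 0 \<Longrightarrow> A = 0"
proof (induction k)
  case (Suc k)
  then have "act3 sc v2 (act3 sc (v2 ^ k) A) = 0"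
    by (simp only: m3.scale_scale power_Suc)
  then have "act3 sc (v2 ^ k) A i (j - 1) = 0" for i j
    by (metis act3_gens(3) zero_fun_apply)
  from this[of _ "_ + 1"] have "act3 sc (v2 ^ k) A = 0"
    by (simp add: fun_eq_iff)
  then show ?case by (rule Suc.IH)
qed (simp add: m3.scale_one)

subsection \<open>Locality and weak associativity\<close>

text \<open>The pair (a,b) has its own \<open>p\<close>, apart from the \<open>q\<close> shared by
  the pairs with c, so that the power of x_1 - x_2 in the product does not depend on c.\<close>

definition triple_poly :: "complex poly poly \<Rightarrow> complex poly poly \<Rightarrow> poly3" where
  "triple_poly p q = ev2 v1 v2 p * (ev2 v1 v3 q * ev2 v2 v3 q)"

lemma act3_comm12:
  assumes "comm_by p a b"
  shows "act3 sc (ev2 v1 v2 p) (prod3 a b c) = act3 sc (ev2 v1 v2 p) (\<lambda>i j k. b j \<circ> a i \<circ> c k)"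
  using assms unfolding act3_slice12 act2_comp_right comm_by_def prod2_def prod3_def by simp

text \<open>The rightmost factor bounds the exponents of its own variable. After multiplication by
  \<open>triple_poly\<close> each of the three factors can be moved to the right end, and the three
  bounds combine.\<close>

lemma triple_Hom3:
  assumes a: "a \<in> Eo s" and b: "b \<in> Eo s" and c: "c \<in> Eo s"
    and ab: "comm_by p a b" and ac: "comm_by q a c" and bc: "comm_by q b c"
  shows "act3 sc (triple_poly p q) (prod3 a b c) \<in> Hom3"
proof -
  note lin = Eo_lin[OF a] Eo_lin[OF b] Eo_lin[OF c]
  have last: "\<exists>N. \<forall>n>N. d n w = 0" if "d \<in> Eo s" for d w
    using that by (simp add: Eo_iff)
  have F: "act3 sc (triple_poly p q) (prod3 a b c) = act3 sc (triple_poly p q) (\<lambda>i j k. a i \<circ> c k \<circ> b j)"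
    "act3 sc (triple_poly p q) (prod3 a b c) = act3 sc (triple_poly p q) (\<lambda>i j k. b j \<circ> c k \<circ> a i)"
  proof -
    show 1: "act3 sc (triple_poly p q) (prod3 a b c) = act3 sc (triple_poly p q) (\<lambda>i j k. a i \<circ> c k \<circ> b j)"
      unfolding triple_poly_def m3.scale_scale[symmetric] act3_comm23[OF bc lin(1)] ..
    have "act3 sc (ev2 v1 v3 q) (\<lambda>i j k. b j \<circ> a i \<circ> c k) = act3 sc (ev2 v1 v3 q) (\<lambda>i j k. b j \<circ> c k \<circ> a i)"
    proof -
      have "act2 q (\<lambda>i k. b j \<circ> (a i \<circ> c k)) = act2 q (\<lambda>i k. b j \<circ> (c k \<circ> a i))" for j
        using ac unfolding comm_by_def by (simp add: act2_comp_left[OF lin(2)] prod2_def)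
      then show ?thesis
        by (simp add: act3_slice13 comp_assoc)
    qed
    moreover have "act3 sc (triple_poly p q) A = act3 sc (ev2 v1 v3 q * ev2 v2 v3 q) (act3 sc (ev2 v1 v2 p) A)"
      "act3 sc (triple_poly p q) A = act3 sc (ev2 v1 v2 p * ev2 v2 v3 q) (act3 sc (ev2 v1 v3 q) A)" for A
      unfolding triple_poly_def m3.scale_scale by (simp_all add: mult_ac)
    ultimately show "act3 sc (triple_poly p q) (prod3 a b c) = act3 sc (triple_poly p q) (\<lambda>i j k. b j \<circ> c k \<circ> a i)"
      by (metis act3_comm12[OF ab])
  qed
  have b3: "\<exists>N. \<forall>i j k. k > N \<longrightarrow> act3 sc (triple_poly p q) (prod3 a b c) i j k w = 0" for w
  proof (rule bounded_act3[where \<pi> = "\<lambda>i j k. k"])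
    fix w
    obtain N where "\<forall>n>N. c n w = 0"
      using last[OF c] by blast
    then have "\<forall>i j k. k > N \<longrightarrow> prod3 a b c i j k w = 0"
      by (simp add: prod3_def lin_0 lin)
    then show "\<exists>N. \<forall>i j k. k > N \<longrightarrow> prod3 a b c i j k w = 0" ..
  qed auto
  have b2: "\<exists>N. \<forall>i j k. j > N \<longrightarrow> act3 sc (triple_poly p q) (prod3 a b c) i j k w = 0" for w
    unfolding F(1)
  proof (rule bounded_act3[where \<pi> = "\<lambda>i j k. j"])
    fix w
    obtain N where "\<forall>n>N. b n w = 0"
      using last[OF b] by blast
    then have "\<forall>i j k. j > N \<longrightarrow> (a i \<circ> c k \<circ> b j) w = 0"
      by (simp add: lin_0 lin)
    then show "\<exists>N. \<forall>i j k. j > N \<longrightarrow> (a i \<circ> c k \<circ> b j) w = 0" ..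
  qed auto
  have b1: "\<exists>N. \<forall>i j k. i > N \<longrightarrow> act3 sc (triple_poly p q) (prod3 a b c) i j k w = 0" for w
    unfolding F(2)
  proof (rule bounded_act3[where \<pi> = "\<lambda>i j k. i"])
    fix w
    obtain N where "\<forall>n>N. a n w = 0"
      using last[OF a] by blast
    then have "\<forall>i j k. i > N \<longrightarrow> (b j \<circ> c k \<circ> a i) w = 0"
      by (simp add: lin_0 lin)
    then show "\<exists>N. \<forall>i j k. i > N \<longrightarrow> (b j \<circ> c k \<circ> a i) w = 0" ..
  qed auto
  have "\<exists>N. bounded3 (act3 sc (triple_poly p q) (prod3 a b c)) w N" for w
  proof -
    obtain N1 N2 N3 where N: "\<forall>i j k. k > N1 \<longrightarrow> act3 sc (triple_poly p q) (prod3 a b c) i j k w = 0"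
      "\<forall>i j k. j > N2 \<longrightarrow> act3 sc (triple_poly p q) (prod3 a b c) i j k w = 0"
      "\<forall>i j k. i > N3 \<longrightarrow> act3 sc (triple_poly p q) (prod3 a b c) i j k w = 0"
      using b3[of w] b2[of w] b1[of w] by blast
    have "bounded3 (act3 sc (triple_poly p q) (prod3 a b c)) w (max N1 (max N2 N3))"
      unfolding bounded3_def using N by simp
    then show ?thesis ..
  qed
  moreover have "lin (act3 sc (triple_poly p q) (prod3 a b c) i j k)" for i j k
    by (rule lin_act3) (simp add: prod3_def lin lin_closed)
  ultimately show ?thesis
    by (simp add: Hom3_def)
qed

lemma Y_LEo: "prod2 a b \<in> QH \<Longrightarrow> (\<lambda>m. Y a m b) \<in> LEo"
  using T_LEo[of "prod2 a b"] by (simp add: Y_Eo_T[abs_def])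

lemma Y_0: "(\<And>n. lin (a n)) \<Longrightarrow> Y a m 0 = 0" "Y 0 m b = 0"
proof -
  assume "\<And>n. lin (a n)"
  then have "prod2 a 0 = 0"
    by (simp add: prod2_def fun_eq_iff lin_0)
  then show "Y a m 0 = 0"
    by (simp add: Y_Eo_T T_0)
next
  have "prod2 0 b = 0"
    by (simp add: prod2_def fun_eq_iff)
  then show "Y 0 m b = 0"
    by (simp add: Y_Eo_T T_0)
qed

lemma iterated_left_DF:
  assumes a: "a \<in> Eo s" and bc: "prod2 b c \<in> QH" and aD: "\<And>n. prod2 a (Y b n c) \<in> QH"
  shows "(\<lambda>m n. Y a m (Y b n c)) \<in> DF" and "(\<lambda>m n. Y a m (Y b n c)) \<in> lower2"
proof -
  obtain N where "\<forall>n<N. Y b n c = 0"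
    using LEo_D(2)[OF Y_LEo[OF bc]] by blast
  then have N: "Y a m (Y b n c) = 0" if "n < N" for m n
    using that by (simp add: Y_0 Eo_lin[OF a])
  then show "(\<lambda>m n. Y a m (Y b n c)) \<in> lower2"
    unfolding lower2_def by blast
  show "(\<lambda>m n. Y a m (Y b n c)) \<in> DF"
    by (rule DF_I[OF _ N]) (use LEo_D[OF Y_LEo[OF aD]] in blast)+
qed

text \<open>Both orders of the product become the same substitution, and the multiplier shifts to
  \<open>u\<close> times y_1^l y_2^l (y_1 - y_2)^k. The factor \<open>u\<close> is cancelled through
  its constant term, the monomials by shifting exponents back.\<close>

lemma Y_locality:
  assumes a: "a \<in> Eo s" and b: "b \<in> Eo s" and c: "c \<in> Eo s"
    and ab: "comm_by ((var_outer - var_inner) ^ k * p') a b" and p': "poly p' [:0, 1:] \<noteq> 0"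
    and q: "q \<noteq> 0" and ac: "comm_by q a c" and bc: "comm_by q b c"
    and aD: "\<And>n. prod2 a (Y b n c) \<in> QH" and bD: "\<And>n. prod2 b (Y a n c) \<in> QH"
  shows "act3 sc ((v1 - v2) ^ k) (\<lambda>m n. Y a m (Y b n c)) = act3 sc ((v1 - v2) ^ k) (\<lambda>m n. Y b n (Y a m c))"
proof -
  define p where "p = (var_outer - var_inner) ^ k * p'"
  define f where "f = triple_poly p q"
  define F where "F = act3 sc f (prod3 a b c)"
  have F: "F \<in> Hom3"
    unfolding F_def f_def by (rule triple_Hom3[OF a b c _ ac bc]) (use ab in \<open>simp add: p_def\<close>)
  have "prod2 b c \<in> QH" "prod2 a c \<in> QH"
    using comm_by_QH a b c q ac bc by blast+
  note bcQ = this
  define X X' where "X = (\<lambda>m n. Y a m (Y b n c))" and "X' = (\<lambda>m n. Y b m (Y a n c))"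
  have 1: "act3 sc (ev3 (v1 + v3) (v2 + v3) v3 f) X = subst_both F"
    unfolding X_def F_def by (rule iterated_left[OF a bcQ(1) aD]) (use F in \<open>simp add: F_def\<close>)
  \<comment> \<open>For the opposite order the same series is read off from bac with x_1 and x_2
    interchanged, since \<open>p\<close> makes a and b commute.\<close>
  have F': "act3 sc (ev3 v2 v1 v3 f) (prod3 b a c) = swap12 F"
  proof -
    have "F = act3 sc f (\<lambda>i j k. b j \<circ> a i \<circ> c k)"
      unfolding F_def f_def triple_poly_def mult.commute[of "ev2 v1 v2 p"] m3.scale_scale[symmetric]
        act3_comm12[OF ab[folded p_def]] ..
    also have "(\<lambda>i j k. b j \<circ> a i \<circ> c k) = swap12 (prod3 b a c)"
      by (simp add: swap12_def prod3_def)
    finally have "swap12 F = act3 sc (ev3 v2 v1 v3 f) (swap12 (swap12 (prod3 b a c)))"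
      by (simp only: act3_permute)
    moreover have "swap12 (swap12 (prod3 b a c)) = prod3 b a c"
      by (simp add: swap12_def)
    ultimately show ?thesis by simp
  qed
  have "swap12 F \<in> Hom3"
  proof -
    have "\<exists>N. bounded3 (swap12 F) w N" for w
    proof -
      obtain N where "bounded3 F w N"
        using Hom3_bounded[OF F] by blast
      then have "bounded3 (swap12 F) w N"
        by (auto simp: bounded3_def swap12_def)
      then show ?thesis ..
    qed
    moreover have "\<forall>i j k. lin (F i j k)"
      using F unfolding Hom3_def by blast
    ultimately show ?thesis
      by (simp add: Hom3_def) (simp add: swap12_def)
  qed
  then have "act3 sc (ev3 (v1 + v3) (v2 + v3) v3 (ev3 v2 v1 v3 f)) X' = subst_both (swap12 F)"
    unfolding X'_def F'[symmetric] by (intro iterated_left[OF b bcQ(2) bD])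
  then have "swap12 (act3 sc (ev3 (v1 + v3) (v2 + v3) v3 (ev3 v2 v1 v3 f)) X') = swap12 (swap12 (subst_both F))"
    by (simp only: subst_both_swap[OF F])
  then have 2: "act3 sc (ev3 (v1 + v3) (v2 + v3) v3 f) (swap12 X') = subst_both F"
    by (simp add: act3_permute ev3_ev3) (simp add: swap12_def)
  obtain l q' where q': "q = (var_outer - var_inner) ^ l * q'" "poly q' [:0, 1:] \<noteq> 0"
    using factor_diagonal[OF q] .
  define u where "u = ev2 (v1 + v3) (v2 + v3) p' * (ev2 (v1 + v3) v3 q' * ev2 (v2 + v3) v3 q')"
  define D where "D = act3 sc ((v1 - v2) ^ k) (X - swap12 X')"
  define D' where "D' = act3 sc (v2 ^ l) (act3 sc (v1 ^ l) D)"
  have "ev3 (v1 + v3) (v2 + v3) v3 f = u * (v2 ^ l * (v1 ^ l * (v1 - v2) ^ k))"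
    by (simp add: f_def triple_poly_def p_def q' u_def)
  moreover have "act3 sc (ev3 (v1 + v3) (v2 + v3) v3 f) (X - swap12 X') = 0"
    by (simp only: m3.scale_right_diff_distrib 1 2 diff_self)
  ultimately have "act3 sc u D' = 0"
    by (simp only: D'_def D_def m3.scale_scale)
  moreover have "coeff (coeff u 0) 0 \<noteq> 0"
    using p' q' unfolding const12_def[symmetric] u_def const12_hom
    by (simp add: const12_ev2 const12_vars)
  moreover have "D' \<in> DF"
    unfolding D'_def D_def X_def X'_def
    by (intro DF_act3 DF_diff DF_swap iterated_left_DF a b bcQ aD bD)
  ultimately have "D' = 0"
    by (intro DF_cancel[of D' u])
  then have "D = 0"
    unfolding D'_def by (blast dest: act3_v1_power_0 act3_v2_power_0)
  moreover have "swap12 X' = (\<lambda>m n. Y b n (Y a m c))"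
    by (simp add: swap12_def X'_def)
  ultimately show ?thesis
    unfolding D_def X_def by (simp only: m3.scale_right_diff_distrib right_minus_eq)
qed

text \<open>The coefficient of x_0^i y_2^j collects terms in y_1^(i+k) with k at most j - M, so for
  fixed j the bounds for finitely many powers of y_2 in \<open>D\<close> bound i from below.\<close>

lemma merge_DF:
  assumes D: "D \<in> DF" and X: "D \<in> lower2" and col: "\<And>n. \<exists>M. \<forall>m<M. D m n = 0"
  shows "merge D \<in> DF"
proof -
  obtain M where M: "\<And>m n. n < M \<Longrightarrow> D m n = 0"
    using X unfolding lower2_def by blast
  have formula: "merge D m n = (\<Sum>k\<le>nat (n - M). fscale sc (of_int (m + int k) gchoose k) (D (m + int k) (n - int k)))" for m n
    using merge_formula[where X = D and n = n and K = "nat (n - M)", OF M, where m = m]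
    by (auto simp: fun_eq_iff sum_fun_apply fscale_def)
  have Eo_sum: "(\<And>i. i \<in> I \<Longrightarrow> g i \<in> Eo s) \<Longrightarrow> (\<Sum>i\<in>I. g i) \<in> Eo s" for I :: "nat set" and g
    by (induction I rule: infinite_finite_induct) (simp_all only: sum.infinite sum.empty sum.insert Eo_0 Eo_add insert_iff simp_thms)
  show ?thesis
  proof (rule DF_I)
    show "merge D i j \<in> Eo s" for i j
      unfolding formula by (intro Eo_sum Eo_scale) (use D in \<open>simp add: DF_def\<close>)
    show "merge D i j = 0" if "j < M" for i j
      unfolding formula using that by (simp add: M fscale_def fun_eq_iff)
    fix j
    have "\<exists>P. \<forall>j'\<in>{M..j}. \<forall>m. m < - P \<longrightarrow> D m j' = 0"
    proof (rule ex_uniform_bound)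
      fix j' show "\<exists>P. \<forall>i. i < - P \<longrightarrow> D i j' = 0"
        using col[of j'] by (metis minus_minus)
    qed auto
    then obtain P where P: "\<forall>j'\<in>{M..j}. \<forall>m. m < - P \<longrightarrow> D m j' = 0" ..
    have "merge D i j = 0" if "i < - P - \<bar>j - M\<bar>" for i
      unfolding formula
    proof (intro sum.neutral ballI)
      fix k assume "k \<in> {..nat (j - M)}"
      then have "int k \<le> \<bar>j - M\<bar>" by auto
      then have "i + int k < - P" "j - int k \<le> j"
        using that by auto
      then have "D (i + int k) (j - int k) = 0"
        using P M by (cases "j - int k < M") auto
      then show "fscale sc (of_int (i + int k) gchoose k) (D (i + int k) (j - int k)) = 0"
        by (simp add: fscale_def fun_eq_iff)
    qed
    then show "\<exists>M. \<forall>i<M. merge D i j = 0" by blast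
  qed
qed

text \<open>At x_1 = x_0 + y_2 + x, x_2 = y_2 + x the diagonal factors of the multiplier become
  x_0^k, (x_0 + y_2)^l and y_2^l. The monomials cancel, and so does the rest through its constant
  term; (x_0 + y_2)^l cannot be cancelled this way and stays.\<close>

lemma Y_weak_assoc:
  assumes a: "a \<in> Eo s" and b: "b \<in> Eo s" and c: "c \<in> Eo s"
    and p: "p \<noteq> 0" and ab: "comm_by p a b"
    and q: "q \<noteq> 0" and ac: "comm_by q a c" and bc: "comm_by q b c"
    and aD: "\<And>n. prod2 a (Y b n c) \<in> QH" and Dc: "\<And>m. prod2 (Y a m b) c \<in> QH"
  shows "\<exists>l. act3 sc ((v1 + v2) ^ l) (merge (\<lambda>m n. Y a m (Y b n c))) =
    act3 sc ((v1 + v2) ^ l) (\<lambda>m n. Y (Y a m b) n c)"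
proof -
  define f where "f = triple_poly p q"
  define F where "F = act3 sc f (prod3 a b c)"
  have F: "F \<in> Hom3"
    unfolding F_def f_def by (rule triple_Hom3[OF a b c ab ac bc])
  have abQ: "prod2 a b \<in> QH" and bcQ: "prod2 b c \<in> QH"
    using comm_by_QH a b c p q ab bc by blast+
  define X Z where "X = (\<lambda>m n. Y a m (Y b n c))" and "Z = (\<lambda>m n. Y (Y a m b) n c)"
  have X: "X \<in> DF" "X \<in> lower2"
    unfolding X_def by (rule iterated_left_DF[OF a bcQ aD])+
  have "act3 sc (ev3 (v1 + v3) (v2 + v3) v3 f) X = subst_both F"
    unfolding X_def F_def by (rule iterated_left[OF a bcQ aD]) (use F in \<open>simp add: F_def\<close>)
  then have "merge (act3 sc (ev3 (v1 + v3) (v2 + v3) v3 f) X) = subst_chain F"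
    by (simp only: merge_subst_both[OF F])
  then have 1: "act3 sc (ev3 (v1 + v2 + v3) (v2 + v3) v3 f) (merge X) = subst_chain F"
    by (simp add: merge_act3[OF X(2)] ev3_ev3)
  have 2: "act3 sc (ev3 (v1 + v2 + v3) (v2 + v3) v3 f) Z = subst_chain F"
    unfolding Z_def F_def by (rule iterated_right[OF abQ c Dc]) (use F in \<open>simp add: F_def\<close>)
  obtain k p' where p': "p = (var_outer - var_inner) ^ k * p'" "poly p' [:0, 1:] \<noteq> 0"
    using factor_diagonal[OF p] .
  obtain l q' where q': "q = (var_outer - var_inner) ^ l * q'" "poly q' [:0, 1:] \<noteq> 0"
    using factor_diagonal[OF q] .
  define u where "u = ev2 (v1 + v2 + v3) (v2 + v3) p' * (ev2 (v1 + v2 + v3) v3 q' * ev2 (v2 + v3) v3 q')"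
  define D where "D = act3 sc ((v1 + v2) ^ l) (merge X - Z)"
  define D' where "D' = act3 sc (v2 ^ l) (act3 sc (v1 ^ k) D)"
  have "ev3 (v1 + v2 + v3) (v2 + v3) v3 f = u * (v2 ^ l * (v1 ^ k * (v1 + v2) ^ l))"
    by (simp add: f_def triple_poly_def p' q' u_def)
  moreover have "act3 sc (ev3 (v1 + v2 + v3) (v2 + v3) v3 f) (merge X - Z) = 0"
    by (simp only: m3.scale_right_diff_distrib 1 2 diff_self)
  ultimately have "act3 sc u D' = 0"
    by (simp only: D'_def D_def m3.scale_scale)
  moreover have "coeff (coeff u 0) 0 \<noteq> 0"
    using p' q' unfolding const12_def[symmetric] u_def const12_hom
    by (simp add: const12_ev2 const12_vars)
  moreover have "D' \<in> DF"
  proof -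
    have "merge X \<in> DF"
      by (rule merge_DF[OF X]) (use LEo_D(2)[OF Y_LEo[OF aD]] in \<open>simp add: X_def\<close>)
    \<comment> \<open>In \<open>Z\<close> the powers of x_0 are bounded below, and those of y_2 for
      each power of x_0: the opposite order to \<open>merge X\<close>.\<close>
    moreover have "swap12 Z \<in> DF"
    proof -
      obtain M where M: "\<forall>m<M. Y a m b = 0"
        using LEo_D(2)[OF Y_LEo[OF abQ]] by blast
      show ?thesis
      proof (rule DF_I[where N = M])
        show "swap12 Z i j \<in> Eo s" for i j
          using LEo_D(1)[OF Y_LEo[OF Dc]] by (simp add: swap12_def Z_def)
        show "swap12 Z i j = 0" if "j < M" for i j
          using M that by (simp add: swap12_def[abs_def] Z_def Y_0)
        show "\<exists>M. \<forall>i<M. swap12 Z i j = 0" for j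
          using LEo_D(2)[OF Y_LEo[OF Dc, of j]] by (simp add: swap12_def Z_def)
      qed
    qed
    then have "swap12 (swap12 Z) \<in> DF"
      by (rule DF_swap)
    then have "Z \<in> DF"
      by (simp add: swap12_def)
    ultimately show ?thesis
      unfolding D'_def D_def by (intro DF_act3 DF_diff)
  qed
  ultimately have "D' = 0"
    by (intro DF_cancel[of D' u])
  then have "D = 0"
    unfolding D'_def by (blast dest: act3_v1_power_0 act3_v2_power_0)
  then show ?thesis
    unfolding D_def X_def Z_def by (auto simp only: m3.scale_right_diff_distrib right_minus_eq)
qed

subsection \<open>Quasi-compatibility of quasi-local sets\<close>

text \<open>The list gives the order of the operators while each keeps its variable, so a factor can
  be moved without renaming exponents.\<close>

definition ordered_prod :: "(int \<Rightarrow> 'w \<Rightarrow> 'w) list \<Rightarrow> nat list \<Rightarrow> (nat \<Rightarrow> int) \<Rightarrow> 'w \<Rightarrow> 'w" where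
  "ordered_prod as js n = foldr (\<lambda>i f. (as ! i) (n i) \<circ> f) js id"

lemma ordered_prod_simps:
  "ordered_prod as [] n = id"
  "ordered_prod as (j # js) n = (as ! j) (n j) \<circ> ordered_prod as js n"
  by (simp_all add: ordered_prod_def)

lemma ordered_prod_append: "ordered_prod as (xs @ ys) n = ordered_prod as xs n \<circ> ordered_prod as ys n"
  by (induction xs) (simp_all add: ordered_prod_simps comp_assoc)

lemma ordered_prod_upd: "i \<notin> set js \<Longrightarrow> ordered_prod as js (n(i := x)) = ordered_prod as js n"
  by (induction js) (auto simp: ordered_prod_simps)

lemma lin_ordered_prod: "set as \<subseteq> Eo s \<Longrightarrow> set js \<subseteq> {..<length as} \<Longrightarrow> lin (ordered_prod as js n)"
proof (induction js)
  case (Cons j js)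
  then have "as ! j \<in> Eo s" "lin (ordered_prod as js n)"
    by (auto simp: subset_iff)
  then show ?case
    unfolding ordered_prod_simps using lin_closed(5)[OF Eo_lin] by blast
qed (simp add: ordered_prod_simps lin_closed)

abbreviation pat :: "complex poly poly \<Rightarrow> nat \<Rightarrow> nat \<Rightarrow> ((nat \<Rightarrow> int) \<Rightarrow> 'w \<Rightarrow> 'w) \<Rightarrow> (nat \<Rightarrow> int) \<Rightarrow> 'w \<Rightarrow> 'w" where
  "pat \<equiv> poly_times_at sc"

text \<open>The outer parts do not involve x_i, x_j, and the left one is linear, so the two-variable
  identity passes through them.\<close>

lemma at_swap:
  assumes "i \<notin> set xs" "j \<notin> set xs" "i \<notin> set ys" "j \<notin> set ys" "i \<noteq> j"
    and as: "set as \<subseteq> Eo s" "set xs \<subseteq> {..<length as}" and comm: "comm_by p (as ! i) (as ! j)"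
  shows "pat p i j (ordered_prod as (xs @ i # j # ys)) = pat p i j (ordered_prod as (xs @ j # i # ys))"
proof (intro ext)
  fix n w
  define pre post where "pre = ordered_prod as xs n" and "post = ordered_prod as ys n"
  have lin: "lin pre"
    unfolding pre_def by (rule lin_ordered_prod[OF as])
  have eq: "(\<Sum>k\<le>degree p. \<Sum>l\<le>degree (coeff p k). sc (coeff (coeff p k) l)
       (pre \<circ> A (n i - int k) (n j - int l) \<circ> post)) w = pre (act2 p A (n i) (n j) (post w))" for A
    by (simp add: poly_times_def sum_fun_apply fscale_def lin_sum[OF lin])
      (use lin in \<open>simp add: lin_iff\<close>)
  have 1: "ordered_prod as (xs @ i # j # ys) (n(i := x, j := y)) = pre \<circ> prod2 (as ! i) (as ! j) x y \<circ> post" for x y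
    using assms by (simp add: ordered_prod_append ordered_prod_simps ordered_prod_upd pre_def post_def prod2_def comp_assoc)
  have 2: "ordered_prod as (xs @ j # i # ys) (n(i := x, j := y)) = pre \<circ> ((as ! j) y \<circ> (as ! i) x) \<circ> post" for x y
    using assms by (simp add: ordered_prod_append ordered_prod_simps ordered_prod_upd pre_def post_def comp_assoc)
  show "pat p i j (ordered_prod as (xs @ i # j # ys)) n w = pat p i j (ordered_prod as (xs @ j # i # ys)) n w"
    unfolding poly_times_at_def 1 2
    using eq[of "prod2 (as ! i) (as ! j)"] eq[of "\<lambda>x y. (as ! j) y \<circ> (as ! i) x"] comm
    by (simp add: comm_by_def)
qed

text \<open>Written as sums of translates by exponent vectors, such multiplications visibly commute,
  also when the two pairs of variables overlap.\<close>

lemma at_sum: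
  assumes "i \<noteq> j"
  shows "pat p i j A n = (\<Sum>x\<in>(SIGMA k:{..degree p}. {..degree (coeff p k)}). sc (coeff (coeff p (fst x)) (snd x))
    (A (\<lambda>t. n t - (if t = i then int (fst x) else if t = j then int (snd x) else 0))))"
proof -
  have "n(i := n i - int k, j := n j - int l) = (\<lambda>t. n t - (if t = i then int k else if t = j then int l else 0))" for k l
    using assms by (auto simp: fun_eq_iff)
  then show ?thesis
    by (simp add: poly_times_at_def sum.Sigma split_def)
qed

lemma at_commute:
  assumes "i \<noteq> j" "i' \<noteq> j'"
  shows "pat p i j (pat q i' j' A) = pat q i' j' (pat p i j A)"
proof
  fix n
  define S where "S = (\<lambda>p :: complex poly poly. SIGMA k:{..degree p}. {..degree (coeff p k)})"
  define e where "e = (\<lambda>i j (x :: nat \<times> nat) (t :: nat). if t = i then int (fst x) else if t = j then int (snd x) else 0)"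
  define c where "c = (\<lambda>(p :: complex poly poly) x. coeff (coeff p (fst x)) (snd x))"
  have *: "pat p i j A n = (\<Sum>x\<in>S p. sc (c p x) (A (\<lambda>t. n t - e i j x t)))" if "i \<noteq> j" for p i j A n
    unfolding S_def e_def c_def by (rule at_sum[OF that])
  have "pat p i j (pat q i' j' A) n =
      (\<Sum>x\<in>S p. \<Sum>y\<in>S q. sc (c p x) (sc (c q y) (A (\<lambda>t. n t - e i j x t - e i' j' y t))))"
    by (simp only: *[OF assms(1)] *[OF assms(2)] m0.scale_sum_right)
  also have "\<dots> = (\<Sum>y\<in>S q. \<Sum>x\<in>S p. sc (c q y) (sc (c p x) (A (\<lambda>t. n t - e i' j' y t - e i j x t))))"
    by (subst sum.swap) (simp add: m0.scale_left_commute algebra_simps)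
  also have "\<dots> = pat q i' j' (pat p i j A) n"
    by (simp only: *[OF assms(1)] *[OF assms(2)] m0.scale_sum_right)
  finally show "pat p i j (pat q i' j' A) n = pat q i' j' (pat p i j A) n" .
qed

definition at_pairs :: "complex poly poly \<Rightarrow> (nat \<times> nat) list \<Rightarrow> ((nat \<Rightarrow> int) \<Rightarrow> 'w \<Rightarrow> 'w) \<Rightarrow> (nat \<Rightarrow> int) \<Rightarrow> 'w \<Rightarrow> 'w" where
  "at_pairs p L = fold (\<lambda>(i, j). pat p i j) L"

text \<open>Multiplications commute, so the factor for (i,j) may be taken to act first.\<close>

lemma at_pairs_eq:
  assumes "(i, j) \<in> set L" "\<forall>(i, j)\<in>set L. i \<noteq> j" "pat p i j A = pat p i j B"
  shows "at_pairs p L A = at_pairs p L B"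
  using assms
proof (induction L arbitrary: A B)
  case (Cons x L)
  obtain i' j' where x: "x = (i', j')" by fastforce
  show ?case
  proof (cases "x = (i, j)")
    case True
    then show ?thesis
      using Cons.prems by (simp add: at_pairs_def)
  next
    case False
    have "pat p i j (pat p i' j' A) = pat p i j (pat p i' j' B)"
      using Cons.prems by (auto simp: at_commute[of i j i' j'] x)
    with False Cons show ?thesis
      by (auto simp: at_pairs_def x)
  qed
qed simp

text \<open>Adjacent transpositions, each allowed by the factor for the pair (j,y) that it
  exchanges.\<close>

lemma at_pairs_move_last:
  assumes "set as \<subseteq> Eo s" "set (xs @ j # ys) \<subseteq> {..<length as}" "distinct (xs @ j # ys)"
    and "\<And>y. y \<in> set ys \<Longrightarrow> (j, y) \<in> set L \<and> comm_by p (as ! j) (as ! y)" "\<forall>(i, j)\<in>set L. i \<noteq> j"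
  shows "at_pairs p L (ordered_prod as (xs @ j # ys)) = at_pairs p L (ordered_prod as (xs @ ys @ [j]))"
  using assms(2-4)
proof (induction ys arbitrary: xs)
  case (Cons y ys)
  have "at_pairs p L (ordered_prod as (xs @ j # y # ys)) = at_pairs p L (ordered_prod as (xs @ y # j # ys))"
    by (rule at_pairs_eq[of j y], use Cons.prems in simp, rule assms(5), rule at_swap)
      (use Cons.prems assms(1) in auto)
  also have "\<dots> = at_pairs p L (ordered_prod as ((xs @ [y]) @ ys @ [j]))"
    using Cons.IH[of "xs @ [y]"] Cons.prems by simp
  finally show ?case by simp
qed simp

lemma at_bounded:
  assumes ij: "i \<noteq> j" and A: "\<exists>N. \<forall>n. n t > N \<longrightarrow> A n w = 0"
  shows "\<exists>N. \<forall>n. n t > N \<longrightarrow> pat p i j A n w = 0"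
proof -
  obtain N where N: "\<forall>n. n t > N \<longrightarrow> A n w = 0"
    using A ..
  define M where "M = degree p + (\<Sum>k\<le>degree p. degree (coeff p k))"
  have "pat p i j A n w = 0" if n: "n t > N + int M" for n
  proof -
    have "A (\<lambda>t. n t - (if t = i then int (fst x) else if t = j then int (snd x) else 0)) w = 0"
      if "x \<in> (SIGMA k:{..degree p}. {..degree (coeff p k)})" for x
    proof -
      have "degree (coeff p (fst x)) \<le> (\<Sum>k\<le>degree p. degree (coeff p k))"
        using that by (intro member_le_sum) auto
      with that have "fst x \<le> M" "snd x \<le> M"
        by (auto simp: M_def)
      with n have "n t - (if t = i then int (fst x) else if t = j then int (snd x) else 0) > N"
        by auto
      then show ?thesis
        using N by (auto split: if_splits)
    qed
    then show ?thesis
      by (simp add: at_sum[OF ij] sum_fun_apply fscale_def)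
  qed
  then show ?thesis by blast
qed

lemma at_pairs_bounded:
  assumes "\<forall>(i, j)\<in>set L. i \<noteq> j" "\<exists>N. \<forall>n. n t > N \<longrightarrow> A n w = 0"
  shows "\<exists>N. \<forall>n. n t > N \<longrightarrow> at_pairs p L A n w = 0"
  using assms
proof (induction L arbitrary: A)
  case (Cons x L)
  obtain i j where x: "x = (i, j)" by fastforce
  have "\<exists>N. \<forall>n. n t > N \<longrightarrow> at_pairs p L (pat p i j A) n w = 0"
    using Cons.prems x by (intro Cons.IH at_bounded) auto
  then show ?case
    by (simp add: at_pairs_def x)
qed (simp add: at_pairs_def)

lemma at_pairs_lin:
  assumes "\<And>n. lin (A n)"
  shows "lin (at_pairs p L A n)"
  using assms
proof (induction L arbitrary: A n)
  case (Cons x L)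
  have "lin (pat p (fst x) (snd x) A n)" for n
    unfolding poly_times_at_def by (intro lin_sum_closed lin_closed Cons.prems)
  from Cons.IH[OF this] show ?case
    by (simp add: at_pairs_def split_def)
qed (simp add: at_pairs_def)

lemma comm_by_dvd: "comm_by p a b \<Longrightarrow> p dvd q \<Longrightarrow> comm_by q a b"
  by (auto elim!: dvdE intro: comm_by_mult)

text \<open>To bound the exponents of one variable, its operator is moved to the right end. It
  passes only operators of larger index, and for each such pair the product of polynomials contains
  the factor needed.\<close>

lemma quasi_local_imp_quasi_compatible:
  assumes S: "S \<subseteq> Eo s" and comm: "\<And>a b. a \<in> S \<Longrightarrow> b \<in> S \<Longrightarrow> \<exists>p. p \<noteq> 0 \<and> comm_by p a b"
  shows "quasi_compatible s S"
  unfolding quasi_compatible_def quasi_compatible_seq_def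
proof (intro conjI allI impI S)
  fix as assume as: "set as \<subseteq> S"
  then show asE: "set as \<subseteq> Eo s"
    using S by blast
  define r where "r = length as"
  have "\<forall>i\<in>{..<r}. \<forall>j\<in>{..<r}. \<exists>p. p \<noteq> 0 \<and> comm_by p (as ! i) (as ! j)"
    using comm as unfolding r_def by (auto simp: subset_iff)
  then obtain P where P: "\<And>i j. i < r \<Longrightarrow> j < r \<Longrightarrow> P i j \<noteq> 0 \<and> comm_by (P i j) (as ! i) (as ! j)"
    by (metis lessThan_iff)
  \<comment> \<open>One polynomial must serve all pairs; each \<open>P i j\<close> divides this
    product.\<close>
  define p where "p = (\<Prod>i<r. \<Prod>j<r. P i j)"
  have "p \<noteq> 0"
    unfolding p_def using P by simp
  have p: "comm_by p (as ! i) (as ! j)" if "i < r" "j < r" for i j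
  proof (rule comm_by_dvd)
    show "comm_by (P i j) (as ! i) (as ! j)"
      using P that by blast
    have "P i j dvd (\<Prod>j<r. P i j)"
      using that by (intro dvd_prodI) auto
    also have "\<dots> dvd p"
      unfolding p_def using that by (intro dvd_prodI) auto
    finally show "P i j dvd p" .
  qed
  define L where "L = [(i, j). i \<leftarrow> [0..<r], j \<leftarrow> [Suc i..<r]]"
  have L: "(i, j) \<in> set L \<longleftrightarrow> i < j \<and> j < r" for i j
    by (force simp: L_def image_iff)
  then have L': "\<forall>(i, j)\<in>set L. i \<noteq> j"
    by auto
  have F: "poly_times_pairs sc p r (prod_list_series as) = at_pairs p L (ordered_prod as [0..<r])"
  proof -
    have "prod_list_series as = ordered_prod as [0..<r]"
      by (simp add: fun_eq_iff prod_list_series_def ordered_prod_def r_def)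
    then show ?thesis
      by (simp add: poly_times_pairs_def at_pairs_def L_def)
  qed
  have bounded: "\<exists>N. \<forall>n. n j > N \<longrightarrow> at_pairs p L (ordered_prod as [0..<r]) n w = 0" if j: "j < r" for j w
  proof -
    have split: "[0..<r] = [0..<j] @ j # [Suc j..<r]"
      using upt_add_eq_append[of 0 j "r - j"] j by (simp add: upt_conv_Cons)
    have F: "at_pairs p L (ordered_prod as [0..<r]) = at_pairs p L (ordered_prod as ([0..<j] @ [Suc j..<r] @ [j]))"
      unfolding split
    proof (rule at_pairs_move_last)
      show "set as \<subseteq> Eo s" by fact
      show "set ([0..<j] @ j # [Suc j..<r]) \<subseteq> {..<length as}" "distinct ([0..<j] @ j # [Suc j..<r])"
        unfolding split[symmetric] by (auto simp: r_def)
    qed (use L L' p j in auto)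
    have "as ! j \<in> Eo s"
      using asE j by (auto simp: r_def)
    then obtain N where N: "\<forall>n>N. (as ! j) n w = 0"
      unfolding Eo_iff by blast
    have "lin (ordered_prod as ([0..<j] @ [Suc j..<r]) n)" for n
      using asE j by (intro lin_ordered_prod) (auto simp: r_def)
    then have "ordered_prod as (([0..<j] @ [Suc j..<r]) @ [j]) n w = 0" if "n j > N" for n
      using N that unfolding ordered_prod_append[of _ "_ @ _"] by (simp add: ordered_prod_simps lin_0)
    then show ?thesis
      unfolding F by (intro at_pairs_bounded L') auto
  qed
  have "\<exists>N. \<forall>n. (\<exists>i<r. n i > N) \<longrightarrow> at_pairs p L (ordered_prod as [0..<r]) n w = 0" for w
  proof -
    have "\<exists>N. \<forall>j\<in>{..<r}. \<forall>n. n j > N \<longrightarrow> at_pairs p L (ordered_prod as [0..<r]) n w = 0"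
      by (rule ex_uniform_bound) (use bounded in auto)
    then show ?thesis by blast
  qed
  moreover have "lin (at_pairs p L (ordered_prod as [0..<r]) n)" for n
    by (intro at_pairs_lin lin_ordered_prod asE) (auto simp: r_def)
  ultimately have "poly_times_pairs sc p r (prod_list_series as) \<in> Homr s r"
    unfolding F Homr_def by blast
  with \<open>p \<noteq> 0\<close> show "\<exists>p. p \<noteq> 0 \<and> poly_times_pairs sc p (length as) (prod_list_series as) \<in> Homr s (length as)"
    unfolding r_def by blast
qed

subsection \<open>The closed subspace generated by a quasi-local set\<close>

lemma act2_swap_poly: "act2 (swap_poly p) (\<lambda>m n. A n m) = (\<lambda>m n. act2 p A n m)"
proof -
  have "act2 p A \<in> UNIV \<and> (\<lambda>A m n. A n m) (act2 p A) =
      act2 (ev (ev (\<lambda>c. [:[:c:]:]) var_outer) var_inner p) ((\<lambda>A m n. A n m) A)"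
    by (rule intertwine2[OF m2.module_axioms m2.module_axioms hom_const2, where N = UNIV])
      (simp_all only: act2_gens act2_vars UNIV_I plus_fun_def)
  then show ?thesis
    by (simp add: swap_poly_def)
qed

lemma comm_by_swap: "comm_by p a b \<Longrightarrow> comm_by (swap_poly p) b a"
  unfolding comm_by_def
  using act2_swap_poly[of p "prod2 a b"] act2_swap_poly[of p "\<lambda>m n. b n \<circ> a m"]
  by (simp add: prod2_def)

lemma comm_by_add:
  assumes "comm_by p a c" "comm_by p b c" "\<And>n. lin (c n)"
  shows "comm_by p (a + b) c"
proof -
  have "prod2 (a + b) c = prod2 a c + prod2 b c"
    by (simp add: prod2_def fun_eq_iff)
  moreover have "(\<lambda>m n. c n \<circ> (a + b) m) = (\<lambda>m n. c n \<circ> a m) + (\<lambda>m n. c n \<circ> b m)"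
    using assms(3) by (simp add: fun_eq_iff lin_iff)
  ultimately show ?thesis
    using assms(1,2) by (simp only: comm_by_def m2.scale_right_distrib)
qed

lemma comm_by_scale:
  assumes "comm_by p a c" "\<And>n. lin (c n)"
  shows "comm_by p (fscale sc k a) c"
proof -
  have "prod2 (fscale sc k a) c = act2 [:[:k:]:] (prod2 a c)"
    by (simp add: prod2_def fun_eq_iff act2_gens fscale_def)
  moreover have "(\<lambda>m n. c n \<circ> fscale sc k a m) = act2 [:[:k:]:] (\<lambda>m n. c n \<circ> a m)"
    using assms(2) by (simp add: fun_eq_iff lin_iff act2_gens fscale_def)
  ultimately show ?thesis
    using assms(1) by (simp only: comm_by_def m2.scale_left_commute[of p])
qed

lemma comm_by_one: "(\<And>n. lin (c n)) \<Longrightarrow> comm_by 1 one_Eo c"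
  by (simp add: comm_by_def m2.scale_one) (simp add: prod2_def one_Eo_def fun_eq_iff lin_0)

lemma one_Eo_Eo: "one_Eo \<in> Eo s"
  unfolding Eo_iff one_Eo_def by (auto simp: lin_closed intro: exI[of _ 0])

text \<open>Quasi-locality and locality are treated uniformly: they are the cases where \<open>P\<close> consists of
  the nonzero polynomials and of the scalar multiples of powers of \<open>x\<^sub>1 - x\<^sub>2\<close>.\<close>

definition admissible :: "complex poly poly set \<Rightarrow> bool" where
  "admissible P \<longleftrightarrow> 1 \<in> P \<and> 0 \<notin> P \<and> (\<forall>p\<in>P. \<forall>q\<in>P. p * q \<in> P) \<and> (\<forall>p\<in>P. swap_poly p \<in> P)"

definition comm_in :: "complex poly poly set \<Rightarrow> (int \<Rightarrow> 'w \<Rightarrow> 'w) \<Rightarrow> (int \<Rightarrow> 'w \<Rightarrow> 'w) \<Rightarrow> bool" where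
  "comm_in P a b \<longleftrightarrow> (\<exists>p\<in>P. comm_by p a b)"

text \<open>In the last rule the condition on \<open>(a, b)\<close> makes the induction work; it turns out to be
  redundant.\<close>

inductive_set gen :: "complex poly poly set \<Rightarrow> (int \<Rightarrow> 'w \<Rightarrow> 'w) set \<Rightarrow> (int \<Rightarrow> 'w \<Rightarrow> 'w) set"
  for P U where
  gen_base: "a \<in> insert one_Eo U \<Longrightarrow> a \<in> gen P U"
| gen_add: "a \<in> gen P U \<Longrightarrow> b \<in> gen P U \<Longrightarrow> a + b \<in> gen P U"
| gen_scale: "a \<in> gen P U \<Longrightarrow> fscale sc c a \<in> gen P U"
| gen_Y: "a \<in> gen P U \<Longrightarrow> b \<in> gen P U \<Longrightarrow> comm_in P a b \<Longrightarrow> Y a m b \<in> gen P U"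

lemma comm_in_sym: "admissible P \<Longrightarrow> comm_in P a b \<Longrightarrow> comm_in P b a"
  unfolding comm_in_def admissible_def using comm_by_swap by blast

lemma comm_in_common:
  assumes "admissible P" "comm_in P a c" "comm_in P b d"
  obtains q where "q \<in> P" "comm_by q a c" "comm_by q b d"
  using assms unfolding comm_in_def admissible_def by (meson comm_by_mult)

lemma comm_in_add: "admissible P \<Longrightarrow> comm_in P a c \<Longrightarrow> comm_in P b c \<Longrightarrow> c \<in> Eo s \<Longrightarrow> comm_in P (a + b) c"
  by (erule (2) comm_in_common) (auto simp: comm_in_def intro: comm_by_add Eo_lin)

lemma comm_in_scale: "comm_in P a c \<Longrightarrow> c \<in> Eo s \<Longrightarrow> comm_in P (fscale sc k a) c"
  by (auto simp: comm_in_def intro: comm_by_scale Eo_lin)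

lemma comm_in_QH:
  assumes "admissible P" "a \<in> Eo s" "b \<in> Eo s" "comm_in P a b"
  shows "prod2 a b \<in> QH"
  using assms comm_by_QH unfolding comm_in_def admissible_def by metis

lemma admissible_power: "admissible P \<Longrightarrow> p \<in> P \<Longrightarrow> p ^ n \<in> P"
  by (induction n) (auto simp: admissible_def)

lemma comm_in_Y:
  assumes P: "admissible P" and E: "a \<in> Eo s" "b \<in> Eo s" "c \<in> Eo s"
    and comm: "comm_in P a b" "comm_in P a c" "comm_in P b c"
  shows "comm_in P (Y a m b) c"
proof -
  obtain q where q: "q \<in> P" "comm_by q a c" "comm_by q b c"
    using comm_in_common[OF P comm(2,3)] .
  obtain k where "comm_by ((q * q) ^ k) (Y a m b) c"
    using dong[OF E comm_in_QH[OF P E(1,2) comm(1)] q(2,3)] by blast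
  moreover have "(q * q) ^ k \<in> P"
    using P q(1) by (intro admissible_power) (auto simp: admissible_def)
  ultimately show ?thesis
    by (auto simp: comm_in_def)
qed

lemma gen_Eo:
  assumes P: "admissible P" and U: "U \<subseteq> Eo s" and a: "a \<in> gen P U"
  shows "a \<in> Eo s"
  using a
proof (induction rule: gen.induct)
  case (gen_base a)
  then show ?case
    using U one_Eo_Eo by blast
next
  case (gen_Y a b m)
  then show ?case
    using LEo_D(1)[OF Y_LEo[OF comm_in_QH[OF P]]] by blast
qed (rule Eo_add Eo_scale; assumption)+

text \<open>Two inductions: \<open>base\<close> extends one argument from the generators to
  \<open>gen P U\<close>, symmetry of \<open>comm_in\<close> exchanges the roles, and the second
  induction extends the other argument. Products are handled in both by \<open>comm_in_Y\<close>,
  which rests on Dong's lemma.\<close>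

lemma gen_comm:
  assumes P: "admissible P" and U: "U \<subseteq> Eo s" and comm: "\<And>a b. a \<in> U \<Longrightarrow> b \<in> U \<Longrightarrow> comm_in P a b"
    and a: "a \<in> gen P U" and b: "b \<in> gen P U"
  shows "comm_in P a b"
proof -
  note Eo = gen_Eo[OF P U]
  have one: "comm_in P one_Eo c" if "c \<in> Eo s" for c
    using P comm_by_one[of c] Eo_lin[OF that] unfolding comm_in_def admissible_def by blast
  have base: "comm_in P b x" if x: "x \<in> insert one_Eo U" and b: "b \<in> gen P U" for x b
    using b
  proof (induction rule: gen.induct)
    case (gen_base b)
    show ?case
    proof (cases "x \<in> U \<and> b \<in> U")
      case False
      then have "x = one_Eo \<or> b = one_Eo"
        using x gen_base by blast
      then show ?thesis
        using one[OF Eo[OF gen.gen_base[OF x]]] comm_in_sym[OF P one[OF Eo[OF gen.gen_base[OF gen_base]]]]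
        by (elim disjE) simp_all
    qed (use comm in blast)
  next
    case (gen_add b1 b2)
    then show ?case
      by (intro comm_in_add[OF P] Eo[OF gen.gen_base] x)
  next
    case (gen_scale b c)
    then show ?case
      by (intro comm_in_scale Eo[OF gen.gen_base] x)
  next
    case (gen_Y b1 b2 m)
    then show ?case
      by (intro comm_in_Y[OF P] Eo[OF gen.gen_base] x Eo)
  qed
  show ?thesis
    using a
  proof (induction rule: gen.induct)
    case (gen_base a)
    then show ?case
      using comm_in_sym[OF P base] b by blast
  next
    case (gen_add a1 a2)
    then show ?case
      by (intro comm_in_add[OF P] Eo b)
  next
    case (gen_scale a c)
    then show ?case
      by (intro comm_in_scale Eo b)
  next
    case (gen_Y a1 a2 m)
    then show ?case
      by (intro comm_in_Y[OF P] Eo b)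
  qed
qed

lemma module_ssc: "module (fscale sc)"
  by (rule module_fscale[OF module_sc])

lemma closed_gen:
  assumes P: "admissible P" and U: "U \<subseteq> Eo s" and comm: "\<And>a b. a \<in> U \<Longrightarrow> b \<in> U \<Longrightarrow> comm_in P a b"
  shows "closed_qc_subspace s (gen P U)"
  unfolding closed_qc_subspace_def
proof (intro conjI ballI allI)
  note gen_comm = gen_comm[OF P U comm]
  show "module.subspace (fscale sc) (gen P U)"
    unfolding module.subspace_def[OF module_ssc]
  proof (intro conjI ballI allI)
    have "fscale sc 0 one_Eo \<in> gen P U"
      by (intro gen_scale gen_base) simp
    moreover have "fscale sc 0 (one_Eo :: int \<Rightarrow> 'w \<Rightarrow> 'w) = 0"
      by (simp add: fun_eq_iff fscale_def)
    ultimately show "0 \<in> gen P U" by simp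
  qed (auto intro: gen_add gen_scale)
  show "quasi_compatible s (gen P U)"
  proof (rule quasi_local_imp_quasi_compatible)
    show "gen P U \<subseteq> Eo s"
      using gen_Eo[OF P U] by blast
    show "\<exists>p. p \<noteq> 0 \<and> comm_by p a b" if "a \<in> gen P U" "b \<in> gen P U" for a b
      using gen_comm[OF _ _ that] P unfolding comm_in_def admissible_def by metis
  qed
  show "Y a m b \<in> gen P U" if "a \<in> gen P U" "b \<in> gen P U" for a b m
    using that gen_comm[OF _ _ that] by (intro gen_Y)
qed

lemma generated_subset_gen:
  assumes "admissible P" "U \<subseteq> Eo s" "\<And>a b. a \<in> U \<Longrightarrow> b \<in> U \<Longrightarrow> comm_in P a b"
  shows "generated s U \<subseteq> gen P U"
proof -
  have "closed_qc_subspace s (gen P U)"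
    by (rule closed_gen) (use assms in auto)
  then show ?thesis
    unfolding generated_def by (rule hull_minimal[rotated]) (auto intro: gen_base)
qed

text \<open>Subspaces and closure under \<open>Y\<close> pass to intersections, quasi-compatibility
  to subsets; for the latter one member \<open>K\<close> of the family is exhibited, since the empty
  intersection is \<open>UNIV\<close>.\<close>

lemma closed_generated:
  assumes K: "closed_qc_subspace s K" "insert one_Eo U \<subseteq> K"
  shows "closed_qc_subspace s (generated s U)" "insert one_Eo U \<subseteq> generated s U"
proof -
  define C where "C = {t. closed_qc_subspace s t \<and> insert one_Eo U \<subseteq> t}"
  have gen: "generated s U = \<Inter>C"
    by (simp add: generated_def hull_def C_def)
  have "K \<in> C"
    using K by (simp add: C_def)
  have sub: "module.subspace (fscale sc) t" "quasi_compatible s t" "\<And>a b m. a \<in> t \<Longrightarrow> b \<in> t \<Longrightarrow> Y a m b \<in> t"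
    if "t \<in> C" for t
    using that by (auto simp: C_def closed_qc_subspace_def)
  show "closed_qc_subspace s (generated s U)"
    unfolding closed_qc_subspace_def gen
  proof (intro conjI ballI allI)
    show "module.subspace (fscale sc) (\<Inter>C)"
      by (rule module.subspace_Inter[OF module_ssc]) (use sub in blast)
    have "\<Inter>C \<subseteq> K"
      using \<open>K \<in> C\<close> by blast
    with sub(2)[OF \<open>K \<in> C\<close>] show "quasi_compatible s (\<Inter>C)"
      unfolding quasi_compatible_def by blast
  qed (use sub in blast)
  show "insert one_Eo U \<subseteq> generated s U"
    unfolding gen by (auto simp: C_def)
qed

subsection \<open>The axioms\<close>

lemma Y_one_left:
  assumes v: "v \<in> Eo s"
  shows "Y one_Eo m v = (if m = 0 then v else 0)"
proof -
  have "comm_by 1 one_Eo v"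
    by (rule comm_by_one) (rule Eo_lin[OF v])
  then have H: "prod2 one_Eo v \<in> Hom2 s"
    using comm_by_Hom2[OF one_Eo_Eo v, of 1] by (simp add: m2.scale_one)
  have "subst_add s (prod2 one_Eo v) m n w = (if m = 0 then v n w else 0)" for n w
  proof (cases "m < 0")
    case False
    then obtain k where k: "m = int k"
      by (metis not_less zero_le_imp_eq_int)
    \<comment> \<open>Only x_1^0 occurs, and binom(0,k) = 0 for k > 0.\<close>
    have "subst_add s (prod2 one_Eo v) (int k) n w =
        (\<Sum>i\<in>{0}. s (of_int i gchoose k) (prod2 one_Eo v i (n + int k - i) w))"
      by (rule subst_eq_sum) (auto simp: prod2_def one_Eo_def)
    then show ?thesis
      by (cases k) (simp_all add: k prod2_def one_Eo_def)
  qed (simp add: subst_neg)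
  then show ?thesis
    by (simp add: Y_Eo_T T_Hom2[OF H] fun_eq_iff)
qed

lemma Y_one_right:
  assumes v: "v \<in> Eo s"
  shows "m < 0 \<Longrightarrow> Y v m one_Eo = 0" "Y v 0 one_Eo = v"
proof -
  have "comm_by 1 one_Eo v"
    by (rule comm_by_one) (rule Eo_lin[OF v])
  then have "comm_by 1 v one_Eo"
    using comm_by_swap[of 1 one_Eo v] swap_poly_hom by (simp add: unital_hom_def)
  then have H: "prod2 v one_Eo \<in> Hom2 s"
    using comm_by_Hom2[OF v one_Eo_Eo, of 1] by (simp add: m2.scale_one)
  show "m < 0 \<Longrightarrow> Y v m one_Eo = 0"
    by (simp add: Y_Eo_T T_Hom2[OF H] subst_neg)
  have "subst_add s (prod2 v one_Eo) (int 0) n w = v n w" for n w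
  proof -
    have "subst_add s (prod2 v one_Eo) (int 0) n w =
        (\<Sum>i\<in>{n}. s (of_int i gchoose 0) (prod2 v one_Eo i (n + int 0 - i) w))"
      by (rule subst_eq_sum) (auto simp: prod2_def one_Eo_def lin_0 Eo_lin[OF v])
    then show ?thesis
      by (simp add: prod2_def one_Eo_def)
  qed
  then show "Y v 0 one_Eo = v"
    by (simp add: Y_Eo_T T_Hom2[OF H] fun_eq_iff)
qed

lemma Y_add_left: "prod2 a c \<in> QH \<Longrightarrow> prod2 b c \<in> QH \<Longrightarrow> Y (a + b) m c = Y a m c + Y b m c"
proof -
  assume "prod2 a c \<in> QH" "prod2 b c \<in> QH"
  moreover have "prod2 (a + b) c = prod2 a c + prod2 b c"
    by (simp add: prod2_def fun_eq_iff)
  ultimately show ?thesis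
    unfolding Y_Eo_T by (simp only: T_add plus_fun_apply)
qed

lemma Y_scale_left: "prod2 a c \<in> QH \<Longrightarrow> Y (fscale sc k a) m c = fscale sc k (Y a m c)"
proof -
  assume "prod2 a c \<in> QH"
  moreover have "prod2 (fscale sc k a) c = (\<lambda>m n. sc k (prod2 a c m n))"
    by (simp add: prod2_def fun_eq_iff fscale_def)
  ultimately show ?thesis
    unfolding Y_Eo_T by (simp add: T_scale fscale_def[of sc])
qed

lemma Y_add_right:
  assumes "prod2 a b \<in> QH" "prod2 a c \<in> QH" "a \<in> Eo s"
  shows "Y a m (b + c) = Y a m b + Y a m c"
proof -
  have "prod2 a (b + c) = prod2 a b + prod2 a c"
    using Eo_lin[OF assms(3)] by (simp add: prod2_def fun_eq_iff lin_iff)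
  with assms show ?thesis
    unfolding Y_Eo_T by (simp only: T_add plus_fun_apply)
qed

lemma Y_scale_right:
  assumes "prod2 a b \<in> QH" "a \<in> Eo s"
  shows "Y a m (fscale sc k b) = fscale sc k (Y a m b)"
proof -
  have "prod2 a (fscale sc k b) = (\<lambda>m n. sc k (prod2 a b m n))"
    using Eo_lin[OF assms(2)] by (simp add: prod2_def fun_eq_iff fscale_def lin_iff)
  with assms show ?thesis
    unfolding Y_Eo_T by (simp add: T_scale fscale_def[of sc])
qed

text \<open>The axioms concern two-variable series with values in \<open>Eo\<close>; their
  coefficients are again series in x, so this is the three-variable action of a polynomial free of
  x.\<close>

lemma poly_times_ssc: "poly_times (fscale sc) r X = act3 sc (ev2 v1 v2 r) X"
proof -
  have m: "module (poly_times (fscale sc))"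
    unfolding poly_times_pact by (rule module.module_pact2[OF module_ssc])
  have gens: "poly_times (fscale sc) [:[:c:]:] X = (\<lambda>m n. fscale sc c (X m n))"
    "poly_times (fscale sc) [:[:0, 1:]:] X = (\<lambda>m n. X m (n - 1))"
    "poly_times (fscale sc) [:0, 1:] X = (\<lambda>m n. X (m - 1) n)" for c X
    unfolding poly_times_pact by (rule pact_gens[OF module_ssc])+
  have "poly_times (fscale sc) r X \<in> UNIV \<and> id (poly_times (fscale sc) r X) = act3 sc (ev (ev c3 v2) v1 r) (id X)"
    by (rule intertwine2[OF m m3.module_axioms unital_hom_c3, where N = UNIV and \<Phi> = id])
      (simp_all only: gens act3_gens id_apply UNIV_I fscale_def[of sc])
  then show ?thesis
    by (simp add: ev2_def)
qed

text \<open>With the identity as \<open>YW\<close>, module associativity is the equation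
  \<open>T_spec\<close> that characterizes \<open>Y_Eo\<close>. It is at hand for any such
  \<open>p\<close>, not just the one picked by \<open>SOME\<close>, and the local case relies on
  this.\<close>

lemma module_assoc_comm:
  assumes "u \<in> Eo s" "v \<in> Eo s" "p \<noteq> 0" "comm_by p u v"
  shows "module_assoc_with s Y (\<lambda>a. a) p u v"
  using T_spec[OF comm_by_QH[OF assms] comm_by_Hom2[OF assms(1,2,4)]] comm_by_Hom2[OF assms(1,2,4)]
  by (simp add: module_assoc_with_def Y_Eo_T)

lemma vector_space_ssc: "vector_space (fscale sc)"
  using module_ssc by (simp add: vector_space_def module_def)

lemma
  assumes U: "U \<subseteq> Eo s" and comm: "\<And>a b. a \<in> U \<Longrightarrow> b \<in> U \<Longrightarrow> comm_in {p. p \<noteq> 0} a b"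
  shows vertex_algebra_generated: "vertex_algebra (fscale sc) (generated s U) Y one_Eo"
    and quasi_module_generated: "quasi_module_at_infinity (fscale sc) (generated s U) Y one_Eo s (\<lambda>a. a)"
proof -
  define V where "V = generated s U"
  have P: "admissible {p. p \<noteq> 0}"
    unfolding admissible_def
  proof (intro conjI ballI)
    fix p assume "p \<in> {p. p \<noteq> (0 :: complex poly poly)}"
    then show "swap_poly p \<in> {p. p \<noteq> 0}"
      using swap_poly_swap_poly[of p] unital_hom_0[OF swap_poly_hom] by auto
  qed auto
  have closed: "closed_qc_subspace s V" and one: "one_Eo \<in> V"
    using closed_generated[OF closed_gen[OF P U comm], of U] gen_base unfolding V_def by blast+
  have VG: "V \<subseteq> gen {p. p \<noteq> 0} U"
    unfolding V_def by (rule generated_subset_gen[OF P U comm])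
  have E: "a \<in> Eo s" if "a \<in> V" for a
    using gen_Eo[OF P U] VG that by blast
  have comm: "\<exists>p. p \<noteq> 0 \<and> comm_by p a b" if "a \<in> V" "b \<in> V" for a b
    using gen_comm[OF P U comm, of a b] VG that unfolding comm_in_def by blast
  have QH: "prod2 a b \<in> QH" if "a \<in> V" "b \<in> V" for a b
    using comm[OF that] comm_by_QH E that by blast
  have Y: "Y a m b \<in> V" if "a \<in> V" "b \<in> V" for a b m
    using closed that by (simp add: closed_qc_subspace_def)
  have common: "\<exists>q. q \<noteq> 0 \<and> comm_by q a c \<and> comm_by q b c"
    if abc: "a \<in> V" "b \<in> V" "c \<in> V" for a b c
  proof -
    obtain p q where "p \<noteq> 0" "comm_by p a c" "q \<noteq> 0" "comm_by q b c"
      using comm[OF abc(1,3)] comm[OF abc(2,3)] by blast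
    then have "p * q \<noteq> 0 \<and> comm_by (p * q) a c \<and> comm_by (p * q) b c"
      by (simp add: comm_by_mult)
    then show ?thesis ..
  qed
  interpret S: vector_space "fscale sc"
    by (rule vector_space_ssc)
  have nva: "nonlocal_vertex_algebra (fscale sc) V Y one_Eo"
  proof (unfold_locales)
    show "S.subspace V"
      using closed by (simp add: closed_qc_subspace_def)
    show "one_Eo \<in> V" by (rule one)
    show "Y u m v \<in> V" if "u \<in> V" "v \<in> V" for u v m
      using that by (rule Y)
    show "linear_on (fscale sc) (fscale sc) V (\<lambda>u. Y u m v)" if "v \<in> V" for v m
      unfolding linear_on_def using that by (blast intro: Y_add_left Y_scale_left QH)
    show "linear_on (fscale sc) (fscale sc) V (Y u m)" if "u \<in> V" for u m
      unfolding linear_on_def using that by (blast intro: Y_add_right Y_scale_right QH E)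
    show "\<exists>N. \<forall>m<N. Y u m v = 0" if "u \<in> V" "v \<in> V" for u v
      using LEo_D(2)[OF Y_LEo[OF QH[OF that]]] .
    show "Y one_Eo m v = (if m = 0 then v else 0)" if "v \<in> V" for v m
      by (rule Y_one_left[OF E[OF that]])
    show "Y v m one_Eo = 0" if "v \<in> V" "m < 0" for v m
      using Y_one_right(1)[OF E[OF that(1)] that(2)] .
    show "Y v 0 one_Eo = v" if "v \<in> V" for v
      by (rule Y_one_right(2)[OF E[OF that]])
    show "\<exists>l. poly_times (fscale sc) ((var_outer + var_inner) ^ l) (Y_shift (fscale sc) Y u v w) =
        poly_times (fscale sc) ((var_outer + var_inner) ^ l) (\<lambda>m n. Y (Y u m v) n w)"
      if u: "u \<in> V" and v: "v \<in> V" and w: "w \<in> V" for u v w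
    proof -
      obtain p where p: "p \<noteq> 0" "comm_by p u v"
        using comm[OF u v] by blast
      obtain q where q: "q \<noteq> 0" "comm_by q u w" "comm_by q v w"
        using common[OF u v w] by blast
      show ?thesis
        unfolding poly_times_ssc Y_shift_merge ev2_simps
        by (rule Y_weak_assoc[OF E[OF u] E[OF v] E[OF w] p q]) (intro QH Y u v w)+
    qed
  qed
  show "vertex_algebra (fscale sc) (generated s U) Y one_Eo"
    unfolding V_def[symmetric]
  proof (intro vertex_algebra.intro nva vertex_algebra_axioms.intro)
    fix u v assume u: "u \<in> V" and v: "v \<in> V"
    obtain p where p: "p \<noteq> 0" "comm_by p u v"
      using comm[OF u v] by blast
    \<comment> \<open>\<open>k\<close> is fixed before \<open>w\<close>; the \<open>q\<close> chosen
      below depends on \<open>w\<close> but contributes no power of y_1 - y_2.\<close>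
    obtain k p' where p': "p = (var_outer - var_inner) ^ k * p'" "poly p' [:0, 1:] \<noteq> 0"
      using factor_diagonal[OF p(1)] .
    show "\<exists>k. \<forall>w\<in>V. poly_times (fscale sc) ((var_outer - var_inner) ^ k)
        (\<lambda>m n. Y u m (Y v n w) - Y v n (Y u m w)) = 0"
    proof (intro exI ballI)
      fix w assume w: "w \<in> V"
      obtain q where q: "q \<noteq> 0" "comm_by q u w" "comm_by q v w"
        using common[OF u v w] by blast
      have "act3 sc ((v1 - v2) ^ k) (\<lambda>m n. Y u m (Y v n w)) = act3 sc ((v1 - v2) ^ k) (\<lambda>m n. Y v n (Y u m w))"
        by (rule Y_locality[OF E[OF u] E[OF v] E[OF w] p(2)[unfolded p'(1)] p'(2) q]) (intro QH Y u v w)+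
      then have "act3 sc ((v1 - v2) ^ k) ((\<lambda>m n. Y u m (Y v n w)) - (\<lambda>m n. Y v n (Y u m w))) = 0"
        by (simp only: m3.scale_right_diff_distrib diff_self)
      then show "poly_times (fscale sc) ((var_outer - var_inner) ^ k)
          (\<lambda>m n. Y u m (Y v n w) - Y v n (Y u m w)) = 0"
        unfolding poly_times_ssc ev2_simps by (simp only: fun_diff_def)
    qed
  qed
  show "quasi_module_at_infinity (fscale sc) (generated s U) Y one_Eo s (\<lambda>a. a)"
    unfolding V_def[symmetric]
  proof (intro quasi_module_at_infinity.intro nva quasi_module_at_infinity_axioms.intro)
    show "vector_space s" by unfold_locales
    show "linear_on (fscale sc) (fscale (fscale s)) V (\<lambda>a. a)"
      by (simp add: linear_on_def)
    fix u v assume u: "u \<in> V" and v: "v \<in> V"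
    obtain p where p: "p \<noteq> 0" "comm_by p u v"
      using comm[OF u v] by blast
    then show "\<exists>p. p \<noteq> 0 \<and> module_assoc_with s Y (\<lambda>a. a) p u v"
      using module_assoc_comm[OF E[OF u] E[OF v]] by blast
  qed (auto intro: E)
qed

lemma module_generated:
  assumes U: "U \<subseteq> Eo s"
    and comm: "\<And>a b. a \<in> U \<Longrightarrow> b \<in> U \<Longrightarrow> \<exists>k. comm_by ((var_outer - var_inner) ^ k) a b"
  shows "module_at_infinity (fscale sc) (generated s U) Y one_Eo s (\<lambda>a. a)"
proof -
  \<comment> \<open>The scalars are there because swapping the variables turns (x_1 - x_2)^k into
    (-1)^k (x_1 - x_2)^k, and \<open>admissible\<close> asks for stability under the swap.\<close>
  define P where "P = {[:[:c:]:] * (var_outer - var_inner) ^ k | c k. c \<noteq> 0}"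
  have pow: "(var_outer - var_inner) ^ k \<in> P" for k
    unfolding P_def by (rule CollectI, rule exI[of _ 1]) (auto simp: one_pCons[symmetric])
  have nz: "var_outer - var_inner \<noteq> 0"
    by (simp add: var_outer_def var_inner_def)
  have P: "admissible P"
    unfolding admissible_def
  proof (intro conjI ballI)
    show "1 \<in> P"
      using pow[of 0] by simp
    show "0 \<notin> P"
      using nz by (auto simp: P_def)
    show "p * q \<in> P" if "p \<in> P" "q \<in> P" for p q
    proof -
      obtain c d k l where *: "c \<noteq> 0" "d \<noteq> 0" "p = [:[:c:]:] * (var_outer - var_inner) ^ k"
        "q = [:[:d:]:] * (var_outer - var_inner) ^ l"
        using \<open>p \<in> P\<close> \<open>q \<in> P\<close> unfolding P_def by blast
      have "[:[:c:]:] * [:[:d:]:] = [:[:c * d:]:]"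
        by simp
      moreover have "p * q = ([:[:c:]:] * [:[:d:]:]) * ((var_outer - var_inner) ^ k * (var_outer - var_inner) ^ l)"
        unfolding * by (simp only: mult_ac)
      ultimately have "p * q = [:[:c * d:]:] * (var_outer - var_inner) ^ (k + l)"
        by (simp only: power_add)
      moreover have "c * d \<noteq> 0"
        using * by simp
      ultimately show ?thesis
        unfolding P_def by blast
    qed
    show "swap_poly p \<in> P" if "p \<in> P" for p
    proof -
      obtain c k where *: "c \<noteq> 0" "p = [:[:c:]:] * (var_outer - var_inner) ^ k"
        using \<open>p \<in> P\<close> unfolding P_def by blast
      have "swap_poly p = swap_poly [:[:c:]:] * swap_poly ((var_outer - var_inner) ^ k)"
        unfolding *(2) using swap_poly_hom unfolding unital_hom_def by blast
      also have "\<dots> = [:[:c:]:] * (var_inner - var_outer) ^ k"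
        by (simp only: unital_hom_power[OF swap_poly_hom] unital_hom_diff[OF swap_poly_hom] swap_poly_vars)
      also have "var_inner - var_outer = [:[:-1:]:] * (var_outer - var_inner)"
        by (simp add: var_outer_def var_inner_def) (simp add: one_pCons)
      also have "[:[:c:]:] * ([:[:-1:]:] * (var_outer - var_inner)) ^ k =
          [:[:c:]:] * [:[:-1:]:] ^ k * (var_outer - var_inner) ^ k"
        by (simp only: power_mult_distrib mult.assoc)
      also have "[:[:c:]:] * [:[:-1:]:] ^ k = [:[:c * (-1) ^ k:]:]"
        by (simp add: poly_const_pow)
      finally show ?thesis
        using *(1) unfolding P_def by force
    qed
  qed
  have commP: "comm_in P a b" if "a \<in> U" "b \<in> U" for a b
    using comm[OF that] pow unfolding comm_in_def by blast
  have "quasi_module_at_infinity (fscale sc) (generated s U) Y one_Eo s (\<lambda>a. a)"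
  proof (rule quasi_module_generated[OF U])
    show "comm_in {p. p \<noteq> 0} a b" if "a \<in> U" "b \<in> U" for a b
      using commP[OF that] P unfolding comm_in_def admissible_def by (metis mem_Collect_eq)
  qed
  then show ?thesis
  proof (rule module_at_infinity.intro, intro module_at_infinity_axioms.intro)
    fix u v assume "u \<in> generated s U" "v \<in> generated s U"
    then have uv: "u \<in> gen P U" "v \<in> gen P U"
      using generated_subset_gen[OF P U commP] by blast+
    obtain c k where c: "c \<noteq> 0" and p: "comm_by ([:[:c:]:] * (var_outer - var_inner) ^ k) u v"
      using gen_comm[OF P U commP uv] unfolding comm_in_def P_def by blast
    \<comment> \<open>The scalar is removed, since the module axiom asks for a pure power.\<close>
    have "[:[:inverse c:]:] * [:[:c:]:] = 1"
      using c by (simp add: one_pCons)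
    then have "comm_by ((var_outer - var_inner) ^ k) u v"
      using comm_by_mult(2)[OF p, of "[:[:inverse c:]:]"] by (metis mult.assoc mult_1)
    then show "\<exists>k. module_assoc_with s Y (\<lambda>a. a) ((var_outer - var_inner) ^ k) u v"
      using module_assoc_comm[OF gen_Eo[OF P U uv(1)] gen_Eo[OF P U uv(2)]] nz by (meson power_not_zero)
  qed
qed

end

theorem theorem5p4:
  fixes scale :: "complex \<Rightarrow> 'w::ab_group_add \<Rightarrow> 'w"
    and U :: "(int \<Rightarrow> 'w \<Rightarrow> 'w) set"
  assumes "vector_space scale" and "quasi_local scale U"
  shows "quasi_compatible scale U \<and>
    vertex_algebra (fscale (fscale scale)) (generated scale U) (Y_Eo scale) one_Eo \<and>
    quasi_module_at_infinity (fscale (fscale scale)) (generated scale U) (Y_Eo scale) one_Eo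
      scale (\<lambda>a. a) \<and>
    (mutually_local scale U \<longrightarrow>
      module_at_infinity (fscale (fscale scale)) (generated scale U) (Y_Eo scale) one_Eo
        scale (\<lambda>a. a))"
proof -
  interpret wspace scale
    unfolding wspace_def by fact
  have U: "U \<subseteq> Eo scale" and comm: "\<And>a b. a \<in> U \<Longrightarrow> b \<in> U \<Longrightarrow> \<exists>p. p \<noteq> 0 \<and> comm_by p a b"
    using assms(2) unfolding quasi_local_def comm_by_def by blast+
  have commP: "comm_in {p. p \<noteq> 0} a b" if "a \<in> U" "b \<in> U" for a b
    using comm[OF that] by (auto simp: comm_in_def)
  have "mutually_local scale U \<Longrightarrow>
      module_at_infinity (fscale (fscale scale)) (generated scale U) (Y_Eo scale) one_Eo scale (\<lambda>a. a)"
    unfolding mutually_local_def by (intro module_generated U) (auto simp: comm_by_def)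
  then show ?thesis
    using quasi_local_imp_quasi_compatible[OF U comm] vertex_algebra_generated[OF U commP]
      quasi_module_generated[OF U commP] by blast
qed

end
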